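(* Let $G$ be a locally compact group and let $A=C_0(G)$ be the C$^*$-algebra of continuous complex functions on $G$ tending to $0$ at infinity. Identify $M(A\otimes A)$ with $C_b(G\times G)$ and define $\phi:A\to M(A\otimes A)$ by $\phi(f)(p,q)=f(pq)$ for $f\in C_0(G)$ and $p,q\in G$. Then $\phi$ is a comultiplication on $A$ and $(A,\phi)$ is a Hopf C$^*$-algebra.
   Context: For a C$^*$-algebra $A$: $A\odot A$ is the algebraic tensor product, $A\otimes A$ the minimal C$^*$-tensor product, $M(A)$ the multiplier algebra. $C_b(G\times G)$ is the algebra of bounded continuous complex functions; $C_0(G)\otimes C_0(G)$ is identified with $C_0(G\times G)$. A comultiplication on $A$ is a non-degenerate $^*$-homomorphism $\phi:A\to M(A\otimes A)$ with $(\phi\otimes\iota)\phi=(\iota\otimes\phi)\phi$, where $\iota$ is the identity map and the maps $\phi\otimes\iota$, $\iota\otimes\phi$ are extended to $M(A\otimes A)$. Haagerup tensor product: $A\otimes_h A$ is the completion of $A\odot A$ for the norm $\|x\|_h=\inf\{\|\sum_i p_ip_i^*\|^{1/2}\|\sum_i q_i^*q_i\|^{1/2} : x=\sum_{i=1}^n p_i\otimes q_i\}$. Hopf C$^*$-algebra: a pair $(A,\phi)$ of a C$^*$-algebra and a comultiplication such that $\phi(a)(1\otimes b)$ and $\phi(a)(b\otimes 1)$ lie in $A\otimes A$ for all $a,b\in A$, and such that the maps $T_1(a\otimes b)=\phi(a)(1\otimes b)$ and $T_2(a\otimes b)=(a\otimes1)\phi(b)$, which are contractive from $A\odot A$ with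 $\|\cdot\|_h$ to $A\otimes A$ and are extended by continuity to $A\otimes_hA\to A\otimes A$, are injective on $A\otimes_hA$. *)

theory Defs
  imports "HOL-Analysis.Analysis" "HOL-Algebra.Group"
begin

section \<open>C*-algebras\<close>

record 'a star_alg = "'a partial_object" +
  zeroA :: 'a
  addA :: "'a \<Rightarrow> 'a \<Rightarrow> 'a" (infixl "\<boxplus>\<index>" 65)
  scaleA :: "complex \<Rightarrow> 'a \<Rightarrow> 'a"
  multA :: "'a \<Rightarrow> 'a \<Rightarrow> 'a" (infixl "\<cdot>\<index>" 70)
  starA :: "'a \<Rightarrow> 'a"
  normA :: "'a \<Rightarrow> real"

definition diffA :: "'a star_alg \<Rightarrow> 'a \<Rightarrow> 'a \<Rightarrow> 'a" where
  "diffA A x y = x \<boxplus>\<^bsub>A\<^esub> scaleA A (-1) y"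

definition lsum :: "'a star_alg \<Rightarrow> 'a list \<Rightarrow> 'a" where
  "lsum A xs = foldr (addA A) xs (zeroA A)"

definition lin_span :: "'a star_alg \<Rightarrow> 'a set \<Rightarrow> 'a set" where
  "lin_span A S = {lsum A (map (\<lambda>(c, x). scaleA A c x) cs) | cs. snd ` set cs \<subseteq> S}"

definition converges_in :: "'a star_alg \<Rightarrow> (nat \<Rightarrow> 'a) \<Rightarrow> 'a \<Rightarrow> bool" where
  "converges_in A u l \<longleftrightarrow> (\<lambda>n. normA A (diffA A (u n) l)) \<longlonglongrightarrow> 0"

definition dense_in :: "'a star_alg \<Rightarrow> 'a set \<Rightarrow> bool" where
  "dense_in A S \<longleftrightarrow> S \<subseteq> carrier A \<and>
     (\<forall>x\<in>carrier A. \<forall>\<epsilon>>0. \<exists>s\<in>S. normA A (diffA A x s) < \<epsilon>)"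

text \<open>C*-norms on a *-subalgebra \<open>S\<close> of \<open>A\<close>; completeness is not part of the notion.\<close>

definition cstar_norm_on :: "'a star_alg \<Rightarrow> 'a set \<Rightarrow> ('a \<Rightarrow> real) \<Rightarrow> bool" where
  "cstar_norm_on A S p \<longleftrightarrow>
     (\<forall>x\<in>S. 0 \<le> p x \<and> (p x = 0 \<longleftrightarrow> x = zeroA A)) \<and>
     (\<forall>c. \<forall>x\<in>S. p (scaleA A c x) = cmod c * p x) \<and>
     (\<forall>x\<in>S. \<forall>y\<in>S. p (x \<boxplus>\<^bsub>A\<^esub> y) \<le> p x + p y) \<and>
     (\<forall>x\<in>S. \<forall>y\<in>S. p (x \<cdot>\<^bsub>A\<^esub> y) \<le> p x * p y) \<and>
     (\<forall>x\<in>S. p (starA A x) = p x) \<and>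
     (\<forall>x\<in>S. p (starA A x \<cdot>\<^bsub>A\<^esub> x) = (p x)\<^sup>2)"

locale cstar_algebra =
  fixes A :: "'a star_alg" (structure)
  assumes zero_closed: "zeroA A \<in> carrier A"
    and add_closed: "\<lbrakk>x \<in> carrier A; y \<in> carrier A\<rbrakk> \<Longrightarrow> x \<boxplus> y \<in> carrier A"
    and scale_closed: "x \<in> carrier A \<Longrightarrow> scaleA A c x \<in> carrier A"
    and mult_closed: "\<lbrakk>x \<in> carrier A; y \<in> carrier A\<rbrakk> \<Longrightarrow> x \<cdot> y \<in> carrier A"
    and star_closed: "x \<in> carrier A \<Longrightarrow> starA A x \<in> carrier A"
    and add_assoc: "\<lbrakk>x \<in> carrier A; y \<in> carrier A; z \<in> carrier A\<rbrakk> \<Longrightarrow>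
          (x \<boxplus> y) \<boxplus> z = x \<boxplus> (y \<boxplus> z)"
    and add_comm: "\<lbrakk>x \<in> carrier A; y \<in> carrier A\<rbrakk> \<Longrightarrow> x \<boxplus> y = y \<boxplus> x"
    and add_zero: "x \<in> carrier A \<Longrightarrow> x \<boxplus> zeroA A = x"
    and add_neg: "x \<in> carrier A \<Longrightarrow> x \<boxplus> scaleA A (-1) x = zeroA A"
    and scale_one: "x \<in> carrier A \<Longrightarrow> scaleA A 1 x = x"
    and scale_scale: "x \<in> carrier A \<Longrightarrow> scaleA A c (scaleA A d x) = scaleA A (c * d) x"
    and scale_add_left: "x \<in> carrier A \<Longrightarrow> scaleA A (c + d) x = scaleA A c x \<boxplus> scaleA A d x"
    and scale_add_right: "\<lbrakk>x \<in> carrier A; y \<in> carrier A\<rbrakk> \<Longrightarrow>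
          scaleA A c (x \<boxplus> y) = scaleA A c x \<boxplus> scaleA A c y"
    and mult_assoc: "\<lbrakk>x \<in> carrier A; y \<in> carrier A; z \<in> carrier A\<rbrakk> \<Longrightarrow>
          (x \<cdot> y) \<cdot> z = x \<cdot> (y \<cdot> z)"
    and distrib_right: "\<lbrakk>x \<in> carrier A; y \<in> carrier A; z \<in> carrier A\<rbrakk> \<Longrightarrow>
          (x \<boxplus> y) \<cdot> z = (x \<cdot> z) \<boxplus> (y \<cdot> z)"
    and distrib_left: "\<lbrakk>x \<in> carrier A; y \<in> carrier A; z \<in> carrier A\<rbrakk> \<Longrightarrow>
          z \<cdot> (x \<boxplus> y) = (z \<cdot> x) \<boxplus> (z \<cdot> y)"
    and scale_mult_left: "\<lbrakk>x \<in> carrier A; y \<in> carrier A\<rbrakk> \<Longrightarrow>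
          scaleA A c x \<cdot> y = scaleA A c (x \<cdot> y)"
    and scale_mult_right: "\<lbrakk>x \<in> carrier A; y \<in> carrier A\<rbrakk> \<Longrightarrow>
          x \<cdot> scaleA A c y = scaleA A c (x \<cdot> y)"
    and star_star: "x \<in> carrier A \<Longrightarrow> starA A (starA A x) = x"
    and star_add: "\<lbrakk>x \<in> carrier A; y \<in> carrier A\<rbrakk> \<Longrightarrow>
          starA A (x \<boxplus> y) = starA A x \<boxplus> starA A y"
    and star_scale: "x \<in> carrier A \<Longrightarrow> starA A (scaleA A c x) = scaleA A (cnj c) (starA A x)"
    and star_mult: "\<lbrakk>x \<in> carrier A; y \<in> carrier A\<rbrakk> \<Longrightarrow>
          starA A (x \<cdot> y) = starA A y \<cdot> starA A x"
    and cstar_norm: "cstar_norm_on A (carrier A) (normA A)"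
    and complete: "\<lbrakk>\<And>n. u n \<in> carrier A;
          \<And>\<epsilon>. \<epsilon> > 0 \<Longrightarrow> \<exists>N. \<forall>m\<ge>N. \<forall>n\<ge>N. normA A (diffA A (u m) (u n)) < \<epsilon>\<rbrakk>
          \<Longrightarrow> \<exists>l\<in>carrier A. converges_in A u l"

definition star_hom :: "'a star_alg \<Rightarrow> 'b star_alg \<Rightarrow> ('a \<Rightarrow> 'b) \<Rightarrow> bool" where
  "star_hom A B \<pi> \<longleftrightarrow>
     (\<forall>x\<in>carrier A. \<pi> x \<in> carrier B \<and> \<pi> (starA A x) = starA B (\<pi> x) \<and>
        (\<forall>c. \<pi> (scaleA A c x) = scaleA B c (\<pi> x)) \<and>
        (\<forall>y\<in>carrier A. \<pi> (x \<boxplus>\<^bsub>A\<^esub> y) = \<pi> x \<boxplus>\<^bsub>B\<^esub> \<pi> y \<and>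
                       \<pi> (x \<cdot>\<^bsub>A\<^esub> y) = \<pi> x \<cdot>\<^bsub>B\<^esub> \<pi> y))"


section \<open>Multiplier algebras\<close>

definition double_centralizer :: "'a star_alg \<Rightarrow> ('a \<Rightarrow> 'a) \<Rightarrow> ('a \<Rightarrow> 'a) \<Rightarrow> bool" where
  "double_centralizer B L R \<longleftrightarrow>
     (\<forall>F\<in>{L, R}.
        (\<forall>x\<in>carrier B. F x \<in> carrier B \<and> (\<forall>c. F (scaleA B c x) = scaleA B c (F x)) \<and>
           (\<forall>y\<in>carrier B. F (x \<boxplus>\<^bsub>B\<^esub> y) = F x \<boxplus>\<^bsub>B\<^esub> F y)) \<and>
        (\<exists>K. \<forall>x\<in>carrier B. normA B (F x) \<le> K * normA B x)) \<and>
     (\<forall>x\<in>carrier B. \<forall>y\<in>carrier B.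
        L (x \<cdot>\<^bsub>B\<^esub> y) = L x \<cdot>\<^bsub>B\<^esub> y \<and> R (x \<cdot>\<^bsub>B\<^esub> y) = x \<cdot>\<^bsub>B\<^esub> R y \<and>
        R x \<cdot>\<^bsub>B\<^esub> y = x \<cdot>\<^bsub>B\<^esub> L y)"

text \<open>\<open>M\<close> is (a realisation of) the multiplier algebra of \<open>B\<close>: it contains \<open>B\<close> as a closed
  two-sided ideal, and \<open>m \<mapsto> (x \<mapsto> mx, x \<mapsto> xm)\<close> is a bijection of \<open>M\<close> onto the
  double centralizers of \<open>B\<close>.\<close>

definition multiplier_algebra :: "'a star_alg \<Rightarrow> 'a star_alg \<Rightarrow> bool" where
  "multiplier_algebra B M \<longleftrightarrow> cstar_algebra B \<and> cstar_algebra M \<and>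
     carrier B \<subseteq> carrier M \<and> star_hom B M (\<lambda>x. x) \<and>
     (\<forall>x\<in>carrier B. normA M x = normA B x) \<and>
     (\<forall>m\<in>carrier M. \<forall>x\<in>carrier B. m \<cdot>\<^bsub>M\<^esub> x \<in> carrier B \<and> x \<cdot>\<^bsub>M\<^esub> m \<in> carrier B) \<and>
     (\<forall>L R. double_centralizer B L R \<longrightarrow>
        (\<exists>!m. m \<in> carrier M \<and> (\<forall>x\<in>carrier B. L x = m \<cdot>\<^bsub>M\<^esub> x \<and> R x = x \<cdot>\<^bsub>M\<^esub> m)))"

text \<open>Here \<open>B\<close> is the target algebra and \<open>M\<close> its multiplier algebra.\<close>

definition nondegenerate_hom ::
    "'a star_alg \<Rightarrow> 'b star_alg \<Rightarrow> 'b star_alg \<Rightarrow> ('a \<Rightarrow> 'b) \<Rightarrow> bool" where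
  "nondegenerate_hom A B M \<pi> \<longleftrightarrow> star_hom A M \<pi> \<and>
     dense_in B (lin_span B {\<pi> a \<cdot>\<^bsub>M\<^esub> x | a x. a \<in> carrier A \<and> x \<in> carrier B})"


section \<open>Tensor products\<close>

definition bilinear_form :: "'a star_alg \<Rightarrow> 'b star_alg \<Rightarrow> ('a \<Rightarrow> 'b \<Rightarrow> complex) \<Rightarrow> bool" where
  "bilinear_form A B \<beta> \<longleftrightarrow>
     (\<forall>a\<in>carrier A. \<forall>b\<in>carrier B.
        (\<forall>a'\<in>carrier A. \<beta> (a \<boxplus>\<^bsub>A\<^esub> a') b = \<beta> a b + \<beta> a' b) \<and>
        (\<forall>b'\<in>carrier B. \<beta> a (b \<boxplus>\<^bsub>B\<^esub> b') = \<beta> a b + \<beta> a b') \<and>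
        (\<forall>c. \<beta> (scaleA A c a) b = c * \<beta> a b \<and> \<beta> a (scaleA B c b) = c * \<beta> a b))"

definition bilinear_map ::
    "'a star_alg \<Rightarrow> 'b star_alg \<Rightarrow> 'c star_alg \<Rightarrow> ('a \<Rightarrow> 'b \<Rightarrow> 'c) \<Rightarrow> bool" where
  "bilinear_map A B T t \<longleftrightarrow>
     (\<forall>a\<in>carrier A. \<forall>b\<in>carrier B. t a b \<in> carrier T \<and>
        (\<forall>a'\<in>carrier A. t (a \<boxplus>\<^bsub>A\<^esub> a') b = t a b \<boxplus>\<^bsub>T\<^esub> t a' b) \<and>
        (\<forall>b'\<in>carrier B. t a (b \<boxplus>\<^bsub>B\<^esub> b') = t a b \<boxplus>\<^bsub>T\<^esub> t a b') \<and>
        (\<forall>c. t (scaleA A c a) b = scaleA T c (t a b) \<and> t a (scaleA B c b) = scaleA T c (t a b)))"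

text \<open>A list of pairs \<open>(a\<^sub>i, b\<^sub>i)\<close> represents the tensor \<open>\<Sum>\<^sub>i a\<^sub>i \<otimes> b\<^sub>i\<close>.\<close>

definition tsum :: "'c star_alg \<Rightarrow> ('a \<Rightarrow> 'b \<Rightarrow> 'c) \<Rightarrow> ('a \<times> 'b) list \<Rightarrow> 'c" where
  "tsum T t xs = lsum T (map (\<lambda>(a, b). t a b) xs)"

definition alg_tensor ::
    "'a star_alg \<Rightarrow> 'b star_alg \<Rightarrow> 'c star_alg \<Rightarrow> ('a \<Rightarrow> 'b \<Rightarrow> 'c) \<Rightarrow> 'c set" where
  "alg_tensor A B T t = {tsum T t xs | xs. set xs \<subseteq> carrier A \<times> carrier B}"

text \<open>\<open>T\<close>, with elementary tensors \<open>t a b\<close>, is (a realisation of) the minimal C*-tensor product of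
  \<open>A\<close> and \<open>B\<close>, i.e. the completion of the algebraic tensor product for its least C*-norm.
  A sum \<open>\<Sum>\<^sub>i a\<^sub>i \<otimes> b\<^sub>i\<close> vanishes in the algebraic tensor product iff every bilinear form \<open>\<beta>\<close> gives
  \<open>\<Sum>\<^sub>i \<beta>(a\<^sub>i, b\<^sub>i) = 0\<close>, so the fifth conjunct says that the canonical map from the algebraic
  tensor product to \<open>T\<close> is injective; its image \<open>alg_tensor A B T t\<close> thereby is the algebraic
  tensor product.\<close>

definition min_tensor ::
    "'a star_alg \<Rightarrow> 'b star_alg \<Rightarrow> 'c star_alg \<Rightarrow> ('a \<Rightarrow> 'b \<Rightarrow> 'c) \<Rightarrow> bool" where
  "min_tensor A B T t \<longleftrightarrow>
     (cstar_algebra A \<and> cstar_algebra B \<and> cstar_algebra T) \<and>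
     bilinear_map A B T t \<and>
     (\<forall>a\<in>carrier A. \<forall>a'\<in>carrier A. \<forall>b\<in>carrier B. \<forall>b'\<in>carrier B.
        t a b \<cdot>\<^bsub>T\<^esub> t a' b' = t (a \<cdot>\<^bsub>A\<^esub> a') (b \<cdot>\<^bsub>B\<^esub> b')) \<and>
     (\<forall>a\<in>carrier A. \<forall>b\<in>carrier B. starA T (t a b) = t (starA A a) (starA B b)) \<and>
     (\<forall>xs. set xs \<subseteq> carrier A \<times> carrier B \<longrightarrow> tsum T t xs = zeroA T \<longrightarrow>
        (\<forall>\<beta>. bilinear_form A B \<beta> \<longrightarrow> (\<Sum>(a, b)\<leftarrow>xs. \<beta> a b) = 0)) \<and>
     dense_in T (alg_tensor A B T t) \<and>
     (\<forall>p. cstar_norm_on T (alg_tensor A B T t) p \<longrightarrow>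
        (\<forall>x\<in>alg_tensor A B T t. normA T x \<le> p x))"

text \<open>The linear map on the algebraic tensor product induced by a bilinear map \<open>g\<close> into \<open>T\<close>.\<close>

definition tensor_lift ::
    "'a star_alg \<Rightarrow> 'b star_alg \<Rightarrow> 'c star_alg \<Rightarrow> ('a \<Rightarrow> 'b \<Rightarrow> 'c) \<Rightarrow> ('a \<Rightarrow> 'b \<Rightarrow> 'c) \<Rightarrow> 'c \<Rightarrow> 'c"
  where
  "tensor_lift A B T t g x =
     (THE y. \<exists>xs. set xs \<subseteq> carrier A \<times> carrier B \<and> tsum T t xs = x \<and> y = tsum T g xs)"


section \<open>Comultiplications\<close>

text \<open>Realisations of \<open>A \<otimes> A\<close>, \<open>A \<otimes> A \<otimes> A\<close> and of their multiplier algebras. The triple tensor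
  product is both \<open>(A \<otimes> A) \<otimes> A\<close> (elementary tensors \<open>tnl x c\<close>) and \<open>A \<otimes> (A \<otimes> A)\<close>
  (elementary tensors \<open>tnr c x\<close>).\<close>

record ('a, 'b, 'c) tensor_frame =
  alg :: "'a star_alg"
  alg2 :: "'b star_alg"
  alg3 :: "'c star_alg"
  mul2 :: "'b star_alg"
  mul3 :: "'c star_alg"
  tn :: "'a \<Rightarrow> 'a \<Rightarrow> 'b"
  tnl :: "'b \<Rightarrow> 'a \<Rightarrow> 'c"
  tnr :: "'a \<Rightarrow> 'b \<Rightarrow> 'c"

definition valid_frame :: "('a, 'b, 'c) tensor_frame \<Rightarrow> bool" where
  "valid_frame F \<longleftrightarrow>
     min_tensor (alg F) (alg F) (alg2 F) (tn F) \<and>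
     min_tensor (alg2 F) (alg F) (alg3 F) (tnl F) \<and>
     min_tensor (alg F) (alg2 F) (alg3 F) (tnr F) \<and>
     (\<forall>a\<in>carrier (alg F). \<forall>b\<in>carrier (alg F). \<forall>c\<in>carrier (alg F).
        tnl F (tn F a b) c = tnr F a (tn F b c)) \<and>
     multiplier_algebra (alg2 F) (mul2 F) \<and>
     multiplier_algebra (alg3 F) (mul3 F)"

text \<open>\<open>\<Phi>\<close> is the extension to \<open>M(A \<otimes> A)\<close> of \<open>\<phi> \<otimes> \<iota> : A \<otimes> A \<rightarrow> M(A \<otimes> A \<otimes> A)\<close>, where
  \<open>(\<phi> \<otimes> \<iota>)(a \<otimes> b)\<close> is the multiplier \<open>x \<otimes> c \<mapsto> \<phi>(a)x \<otimes> bc\<close>; similarly for \<open>\<iota> \<otimes> \<phi>\<close>.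
  For non-degenerate \<open>\<phi>\<close> such a *-homomorphism \<open>\<Phi>\<close> is unique, also without a continuity
  requirement, because \<open>\<Phi>(m)\<Phi>(x)y = \<Phi>(mx)y\<close> for \<open>x\<close> in \<open>A \<otimes> A\<close>.\<close>

definition extends_phi_iota ::
    "('a, 'b, 'c) tensor_frame \<Rightarrow> ('a \<Rightarrow> 'b) \<Rightarrow> ('b \<Rightarrow> 'c) \<Rightarrow> bool" where
  "extends_phi_iota F \<phi> \<Phi> \<longleftrightarrow> star_hom (mul2 F) (mul3 F) \<Phi> \<and>
     (\<forall>a\<in>carrier (alg F). \<forall>b\<in>carrier (alg F). \<forall>x\<in>carrier (alg2 F). \<forall>c\<in>carrier (alg F).
        \<Phi> (tn F a b) \<cdot>\<^bsub>mul3 F\<^esub> tnl F x c = tnl F (\<phi> a \<cdot>\<^bsub>mul2 F\<^esub> x) (b \<cdot>\<^bsub>alg F\<^esub> c))"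

definition extends_iota_phi ::
    "('a, 'b, 'c) tensor_frame \<Rightarrow> ('a \<Rightarrow> 'b) \<Rightarrow> ('b \<Rightarrow> 'c) \<Rightarrow> bool" where
  "extends_iota_phi F \<phi> \<Phi> \<longleftrightarrow> star_hom (mul2 F) (mul3 F) \<Phi> \<and>
     (\<forall>a\<in>carrier (alg F). \<forall>b\<in>carrier (alg F). \<forall>c\<in>carrier (alg F). \<forall>x\<in>carrier (alg2 F).
        \<Phi> (tn F a b) \<cdot>\<^bsub>mul3 F\<^esub> tnr F c x = tnr F (a \<cdot>\<^bsub>alg F\<^esub> c) (\<phi> b \<cdot>\<^bsub>mul2 F\<^esub> x))"

definition comultiplication :: "('a, 'b, 'c) tensor_frame \<Rightarrow> ('a \<Rightarrow> 'b) \<Rightarrow> bool" where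
  "comultiplication F \<phi> \<longleftrightarrow> valid_frame F \<and>
     nondegenerate_hom (alg F) (alg2 F) (mul2 F) \<phi> \<and>
     (\<exists>\<Phi> \<Psi>. extends_phi_iota F \<phi> \<Phi> \<and> extends_iota_phi F \<phi> \<Psi> \<and>
        (\<forall>a\<in>carrier (alg F). \<Phi> (\<phi> a) = \<Psi> (\<phi> a)))"


section \<open>Haagerup tensor product\<close>

definition haagerup_norm :: "('a, 'b, 'c) tensor_frame \<Rightarrow> 'b \<Rightarrow> real" where
  "haagerup_norm F x = Inf
     {sqrt (normA (alg F) (lsum (alg F) (map (\<lambda>(p, q). p \<cdot>\<^bsub>alg F\<^esub> starA (alg F) p) xs))) *
      sqrt (normA (alg F) (lsum (alg F) (map (\<lambda>(p, q). starA (alg F) q \<cdot>\<^bsub>alg F\<^esub> q) xs)))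
      | xs. set xs \<subseteq> carrier (alg F) \<times> carrier (alg F) \<and> tsum (alg2 F) (tn F) xs = x}"

abbreviation alg_sq :: "('a, 'b, 'c) tensor_frame \<Rightarrow> 'b set" where
  "alg_sq F \<equiv> alg_tensor (alg F) (alg F) (alg2 F) (tn F)"

text \<open>The completion, as Cauchy sequences modulo null sequences.\<close>

definition haagerup_cauchy :: "('a, 'b, 'c) tensor_frame \<Rightarrow> (nat \<Rightarrow> 'b) set" where
  "haagerup_cauchy F = {u. (\<forall>n. u n \<in> alg_sq F) \<and>
     (\<forall>\<epsilon>>0. \<exists>N. \<forall>m\<ge>N. \<forall>n\<ge>N. haagerup_norm F (diffA (alg2 F) (u m) (u n)) < \<epsilon>)}"

definition haagerup_equiv :: "('a, 'b, 'c) tensor_frame \<Rightarrow> ((nat \<Rightarrow> 'b) \<times> (nat \<Rightarrow> 'b)) set" where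
  "haagerup_equiv F = {(u, v). u \<in> haagerup_cauchy F \<and> v \<in> haagerup_cauchy F \<and>
     (\<lambda>n. haagerup_norm F (diffA (alg2 F) (u n) (v n))) \<longlonglongrightarrow> 0}"

definition haagerup_tensor :: "('a, 'b, 'c) tensor_frame \<Rightarrow> (nat \<Rightarrow> 'b) set set" where
  "haagerup_tensor F = haagerup_cauchy F // haagerup_equiv F"

definition haagerup_contractive :: "('a, 'b, 'c) tensor_frame \<Rightarrow> ('b \<Rightarrow> 'b) \<Rightarrow> bool" where
  "haagerup_contractive F S \<longleftrightarrow>
     (\<forall>x\<in>alg_sq F. S x \<in> carrier (alg2 F) \<and> normA (alg2 F) (S x) \<le> haagerup_norm F x)"

text \<open>Extension by continuity to the Haagerup tensor product of a contractive linear map \<open>S\<close>.\<close>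

definition haagerup_extension ::
    "('a, 'b, 'c) tensor_frame \<Rightarrow> ('b \<Rightarrow> 'b) \<Rightarrow> (nat \<Rightarrow> 'b) set \<Rightarrow> 'b" where
  "haagerup_extension F S \<xi> =
     (THE l. l \<in> carrier (alg2 F) \<and> (\<forall>u\<in>\<xi>. converges_in (alg2 F) (\<lambda>n. S (u n)) l))"


section \<open>Hopf C*-algebras\<close>

text \<open>The multipliers \<open>b \<otimes> 1\<close> and \<open>1 \<otimes> b\<close> of \<open>A \<otimes> A\<close>.\<close>

definition leg1 :: "('a, 'b, 'c) tensor_frame \<Rightarrow> 'a \<Rightarrow> 'b" where
  "leg1 F b = (THE m. m \<in> carrier (mul2 F) \<and>
     (\<forall>c\<in>carrier (alg F). \<forall>d\<in>carrier (alg F).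
        m \<cdot>\<^bsub>mul2 F\<^esub> tn F c d = tn F (b \<cdot>\<^bsub>alg F\<^esub> c) d))"

definition leg2 :: "('a, 'b, 'c) tensor_frame \<Rightarrow> 'a \<Rightarrow> 'b" where
  "leg2 F b = (THE m. m \<in> carrier (mul2 F) \<and>
     (\<forall>c\<in>carrier (alg F). \<forall>d\<in>carrier (alg F).
        m \<cdot>\<^bsub>mul2 F\<^esub> tn F c d = tn F c (b \<cdot>\<^bsub>alg F\<^esub> d)))"

definition T1 :: "('a, 'b, 'c) tensor_frame \<Rightarrow> ('a \<Rightarrow> 'b) \<Rightarrow> 'b \<Rightarrow> 'b" where
  "T1 F \<phi> = tensor_lift (alg F) (alg F) (alg2 F) (tn F) (\<lambda>a b. \<phi> a \<cdot>\<^bsub>mul2 F\<^esub> leg2 F b)"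

definition T2 :: "('a, 'b, 'c) tensor_frame \<Rightarrow> ('a \<Rightarrow> 'b) \<Rightarrow> 'b \<Rightarrow> 'b" where
  "T2 F \<phi> = tensor_lift (alg F) (alg F) (alg2 F) (tn F) (\<lambda>a b. leg1 F a \<cdot>\<^bsub>mul2 F\<^esub> \<phi> b)"

text \<open>Contractivity of \<open>T1\<close> and \<open>T2\<close> holds automatically; it is listed since the extensions by
  continuity depend on it.\<close>

definition hopf_cstar_algebra :: "('a, 'b, 'c) tensor_frame \<Rightarrow> ('a \<Rightarrow> 'b) \<Rightarrow> bool" where
  "hopf_cstar_algebra F \<phi> \<longleftrightarrow> comultiplication F \<phi> \<and>
     (\<forall>a\<in>carrier (alg F). \<forall>b\<in>carrier (alg F).
        \<phi> a \<cdot>\<^bsub>mul2 F\<^esub> leg2 F b \<in> carrier (alg2 F) \<and>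
        \<phi> a \<cdot>\<^bsub>mul2 F\<^esub> leg1 F b \<in> carrier (alg2 F)) \<and>
     haagerup_contractive F (T1 F \<phi>) \<and> haagerup_contractive F (T2 F \<phi>) \<and>
     inj_on (haagerup_extension F (T1 F \<phi>)) (haagerup_tensor F) \<and>
     inj_on (haagerup_extension F (T2 F \<phi>)) (haagerup_tensor F)"


section \<open>Function algebras on a locally compact group\<close>

locale locally_compact_group = group G for G :: "('g, 'm) monoid_scheme" (structure) +
  fixes X :: "'g topology"
  assumes topspace_eq: "topspace X = carrier G"
    and continuous_mult: "continuous_map (prod_topology X X) X (\<lambda>(p, q). p \<otimes> q)"
    and continuous_inv: "continuous_map X X (\<lambda>p. inv p)"
    and Hausdorff: "Hausdorff_space X"
    and locally_compact: "locally_compact_space X"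

text \<open>A function on \<open>topspace X\<close> is represented by its extension by 0 to the whole type; hence the
  supremum over the type below is the supremum over \<open>topspace X\<close>.\<close>

definition function_algebra :: "('x \<Rightarrow> complex) set \<Rightarrow> ('x \<Rightarrow> complex) star_alg" where
  "function_algebra S = \<lparr>carrier = S, zeroA = (\<lambda>x. 0), addA = (\<lambda>f g x. f x + g x),
     scaleA = (\<lambda>c f x. c * f x), multA = (\<lambda>f g x. f x * g x), starA = (\<lambda>f x. cnj (f x)),
     normA = (\<lambda>f. SUP x. cmod (f x))\<rparr>"

definition C0 :: "'x topology \<Rightarrow> ('x \<Rightarrow> complex) star_alg" where
  "C0 X = function_algebra {f. continuous_map X euclidean f \<and> (\<forall>x. x \<notin> topspace X \<longrightarrow> f x = 0) \<and>
     (\<forall>\<epsilon>>0. compactin X {x \<in> topspace X. cmod (f x) \<ge> \<epsilon>})}"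

definition Cb :: "'x topology \<Rightarrow> ('x \<Rightarrow> complex) star_alg" where
  "Cb X = function_algebra {f. continuous_map X euclidean f \<and> (\<forall>x. x \<notin> topspace X \<longrightarrow> f x = 0) \<and>
     bounded (range f)}"

definition C0_frame ::
    "'x topology \<Rightarrow> ('x \<Rightarrow> complex, 'x \<times> 'x \<Rightarrow> complex, 'x \<times> 'x \<times> 'x \<Rightarrow> complex) tensor_frame"
  where
  "C0_frame X = \<lparr>alg = C0 X,
     alg2 = C0 (prod_topology X X),
     alg3 = C0 (prod_topology X (prod_topology X X)),
     mul2 = Cb (prod_topology X X),
     mul3 = Cb (prod_topology X (prod_topology X X)),
     tn = (\<lambda>f g (p, q). f p * g q),
     tnl = (\<lambda>h f (p, q, r). h (p, q) * f r),
     tnr = (\<lambda>f h (p, q, r). f p * h (q, r))\<rparr>"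

definition C0_comult ::
    "('g, 'm) monoid_scheme \<Rightarrow> ('g \<Rightarrow> complex) \<Rightarrow> 'g \<times> 'g \<Rightarrow> complex" where
  "C0_comult G f = (\<lambda>(p, q). if p \<in> carrier G \<and> q \<in> carrier G then f (p \<otimes>\<^bsub>G\<^esub> q) else 0)"

end

theory Submission
  imports Defs
begin

text \<open>The minimal tensor norm: for a C*-norm \<open>p\<close> on \<open>C\<^sub>0(X) \<odot> C\<^sub>0(Y)\<close>, bounded continuous functions of one
  variable act by multiplication with operator norm at most their supremum, because real contractions
  are averages of unitaries and unitaries are isometric by the C*-identity. Testing \<open>x\<close> on elementary
  tensors concentrated near a point \<open>z\<close> then gives \<open>\<bar>x z\<bar> \<le> p x\<close>, so the supremum norm is the least
  C*-norm.

  The maps \<open>T\<^sub>1\<close> and \<open>T\<^sub>2\<close> are compositions with the homeomorphisms \<open>(p, q) \<mapsto> (pq, q)\<close> and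
  \<open>(p, q) \<mapsto> (p, pq)\<close> of \<open>G \<times> G\<close>. Their injectivity thus amounts to that of the canonical map from the
  Haagerup tensor product to \<open>C\<^sub>0(G \<times> G)\<close>, which follows from an approximation property: finite rank
  contractions \<open>f \<mapsto> \<Sum>\<^sub>k f(k) \<phi>\<^sub>k\<close> built from partitions of unity converge strongly to the identity
  and, tensored with the identity, are contractive for the Haagerup norm.\<close>

section \<open>Algebras of bounded functions\<close>

text \<open>A C*-norm \<open>p\<close> on the algebraic tensor product is only given on a space of
  functions that in general is neither complete nor closed under functional calculus. Multiplication
  by a function of one variable does preserve this space, being absorbed into one tensor factor;
  hence every auxiliary multiplier in the minimality argument depends on a single coordinate. For
  injectivity the obstacle is that the Haagerup norm dominates the supremum norm but is in general
  not controlled by it, so uniform convergence to 0 says nothing directly about Haagerup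
  convergence. On the range of a fixed compression the two are comparable, with a constant depending
  on the number of sample points; the Cauchy property allows the compression to be fixed before the
  uniform bound is chosen. For functions the Haagerup norm is concrete: the two factors of a
  representation are suprema of Euclidean norms of a row of values \<open>a_i(p)\<close> and a
  column of values \<open>b_i(q)\<close>. Contractivity of a compression then comes from convexity
  of the squared modulus.\<close>

lemma function_algebra_simps [simp]:
  "carrier (function_algebra S) = S"
  "zeroA (function_algebra S) = (\<lambda>x. 0)"
  "addA (function_algebra S) f g = (\<lambda>x. f x + g x)"
  "scaleA (function_algebra S) c f = (\<lambda>x. c * f x)"
  "multA (function_algebra S) f g = (\<lambda>x. f x * g x)"
  "starA (function_algebra S) f = (\<lambda>x. cnj (f x))"
  "normA (function_algebra S) f = (SUP x. cmod (f x))"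
  "diffA (function_algebra S) f g = (\<lambda>x. f x - g x)"
  by (auto simp: function_algebra_def diffA_def)

lemma lsum_function_algebra [simp]:
  "lsum (function_algebra S) fs = (\<lambda>x. \<Sum>f\<leftarrow>fs. f x)"
proof (induction fs)
  case (Cons f fs)
  then show ?case
    unfolding lsum_def by simp
qed (auto simp: lsum_def)

lemma tsum_function_algebra [simp]:
  "tsum (function_algebra S) t xs = (\<lambda>z. \<Sum>(a, b)\<leftarrow>xs. t a b z)"
  by (simp add: tsum_def comp_def split_def)

lemma sup_norm_le:
  fixes f :: "'x \<Rightarrow> complex"
  shows "(\<And>x. cmod (f x) \<le> c) \<Longrightarrow> (SUP x. cmod (f x)) \<le> c"
  by (rule cSUP_least) auto

lemma le_sup_norm:
  fixes f :: "'x \<Rightarrow> complex"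
  assumes "bounded (range f)"
  shows "cmod (f x) \<le> (SUP x. cmod (f x))"
proof -
  have "bdd_above (range (\<lambda>x. cmod (f x)))"
    using assms unfolding bounded_iff bdd_above_def by auto
  then show ?thesis by (rule cSUP_upper2) auto
qed

lemma sup_norm_nonneg:
  fixes f :: "'x \<Rightarrow> complex"
  shows "bounded (range f) \<Longrightarrow> 0 \<le> (SUP x. cmod (f x))"
  using le_sup_norm[of f undefined] norm_ge_zero order_trans by blast

lemma sup_norm_le_iff:
  fixes f :: "'x \<Rightarrow> complex"
  shows "bounded (range f) \<Longrightarrow> (SUP x. cmod (f x)) \<le> c \<longleftrightarrow> (\<forall>x. cmod (f x) \<le> c)"
  using le_sup_norm[of f] sup_norm_le[of f c] by (meson order_trans)

lemma bounded_rangeI: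
  fixes f :: "'x \<Rightarrow> complex"
  shows "(\<And>x. cmod (f x) \<le> c) \<Longrightarrow> bounded (range f)"
  unfolding bounded_iff by auto

lemma bounded_range_add:
  fixes f g :: "'x \<Rightarrow> complex"
  assumes "bounded (range f)" "bounded (range g)"
  shows "bounded (range (\<lambda>x. f x + g x))"
  using bounded_plus_comp[OF assms] by simp

lemma bounded_range_mult:
  fixes f g :: "'x \<Rightarrow> complex"
  assumes "bounded (range f)" "bounded (range g)"
  shows "bounded (range (\<lambda>x. f x * g x))"
proof (rule bounded_rangeI)
  fix x
  show "cmod (f x * g x) \<le> (SUP x. cmod (f x)) * (SUP x. cmod (g x))"
    unfolding norm_mult
    by (intro mult_mono le_sup_norm sup_norm_nonneg assms) auto
qed

lemma sup_norm_scale: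
  fixes f :: "'x \<Rightarrow> complex"
  assumes "bounded (range f)"
  shows "(SUP x. cmod (c * f x)) = cmod c * (SUP x. cmod (f x))"
proof (rule antisym)
  have le: "(SUP x. cmod (c * f x)) \<le> cmod c * (SUP x. cmod (f x))"
    if "bounded (range f)" for c and f :: "'x \<Rightarrow> complex"
    by (rule sup_norm_le) (auto simp: norm_mult intro!: mult_left_mono le_sup_norm that)
  then show "(SUP x. cmod (c * f x)) \<le> cmod c * (SUP x. cmod (f x))"
    using assms by blast
  show "cmod c * (SUP x. cmod (f x)) \<le> (SUP x. cmod (c * f x))"
  proof (cases "c = 0")
    case False
    have "bounded (range (\<lambda>x. c * f x))"
      using bounded_range_mult[of "\<lambda>_. c" f] assms by auto
    \<comment> \<open>The reverse inequality is \<open>le\<close> for the scalar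
      \<open>inverse c\<close> and the function \<open>c * f\<close>.\<close>
    from le[OF this, of "inverse c"] False show ?thesis
      by (simp add: field_simps norm_inverse norm_divide)
  qed auto
qed

lemma sup_norm_add:
  fixes f g :: "'x \<Rightarrow> complex"
  assumes "bounded (range f)" "bounded (range g)"
  shows "(SUP x. cmod (f x + g x)) \<le> (SUP x. cmod (f x)) + (SUP x. cmod (g x))"
proof (rule sup_norm_le)
  fix x
  show "cmod (f x + g x) \<le> (SUP x. cmod (f x)) + (SUP x. cmod (g x))"
    using le_sup_norm[OF assms(1), of x] le_sup_norm[OF assms(2), of x]
      norm_triangle_ineq[of "f x" "g x"] by linarith
qed

lemma sup_norm_mult:
  fixes f g :: "'x \<Rightarrow> complex"
  assumes "bounded (range f)" "bounded (range g)"
  shows "(SUP x. cmod (f x * g x)) \<le> (SUP x. cmod (f x)) * (SUP x. cmod (g x))"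
  by (intro sup_norm_le) (auto simp: norm_mult intro!: mult_mono le_sup_norm sup_norm_nonneg assms)

text \<open>Submultiplicativity gives one inequality. For the other, each |f x| is at most the
  square root of the supremum on the left, so the supremum of |f| is too, and squaring is postponed
  to the end.\<close>

lemma sup_norm_cstar:
  fixes f :: "'x \<Rightarrow> complex"
  assumes "bounded (range f)"
  shows "(SUP x. cmod (cnj (f x) * f x)) = (SUP x. cmod (f x))\<^sup>2"
proof (rule antisym)
  have b: "bounded (range (\<lambda>x. cnj (f x)))"
    using assms unfolding bounded_iff by auto
  show "(SUP x. cmod (cnj (f x) * f x)) \<le> (SUP x. cmod (f x))\<^sup>2"
    using sup_norm_mult[OF b assms] by (simp add: power2_eq_square)
  have "cmod (f x) \<le> sqrt (SUP x. cmod (cnj (f x) * f x))" for x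
  proof (rule real_le_rsqrt)
    show "(cmod (f x))\<^sup>2 \<le> (SUP x. cmod (cnj (f x) * f x))"
      using le_sup_norm[OF bounded_range_mult[OF b assms], of x]
      by (simp add: norm_mult power2_eq_square)
  qed
  then have "(SUP x. cmod (f x)) \<le> sqrt (SUP x. cmod (cnj (f x) * f x))"
    by (rule sup_norm_le)
  then show "(SUP x. cmod (f x))\<^sup>2 \<le> (SUP x. cmod (cnj (f x) * f x))"
    using sup_norm_nonneg[OF assms] sup_norm_nonneg[OF bounded_range_mult[OF b assms]]
    by (metis power_mono real_sqrt_pow2)
qed

lemma cstar_norm_on_sup_norm:
  assumes "\<And>f. f \<in> S \<Longrightarrow> bounded (range f)"
  shows "cstar_norm_on (function_algebra S') S (normA (function_algebra S'))"
proof -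
  have "f = (\<lambda>x. 0)" if "f \<in> S" "(SUP x. cmod (f x)) = 0" for f
    using le_sup_norm[OF assms[OF that(1)]] that by auto
  then show ?thesis
    unfolding cstar_norm_on_def
    using assms
    by (auto simp: sup_norm_nonneg sup_norm_scale sup_norm_add sup_norm_mult sup_norm_cstar)
qed

text \<open>Norm convergence is uniform convergence. The pointwise bounds are nonstrict because
  strict bounds at every point do not bound a supremum strictly; halving \<open>e\<close> bridges
  the two.\<close>

lemma converges_in_function_algebra:
  assumes "\<And>n. bounded (range (u n))" "bounded (range l)"
  shows "converges_in (function_algebra S) u l \<longleftrightarrow>
    (\<forall>e>0. \<exists>N. \<forall>n\<ge>N. \<forall>x. cmod (u n x - l x) \<le> e)"
proof -
  have b: "bounded (range (\<lambda>x. u n x - l x))" for n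
    using bounded_minus_comp[OF assms] by auto
  have "converges_in (function_algebra S) u l \<longleftrightarrow>
    (\<forall>e>0. \<exists>N. \<forall>n\<ge>N. (SUP x. cmod (u n x - l x)) < e)"
    unfolding converges_in_def LIMSEQ_iff using sup_norm_nonneg[OF b] by auto
  also have "\<dots> \<longleftrightarrow> (\<forall>e>0. \<exists>N. \<forall>n\<ge>N. (SUP x. cmod (u n x - l x)) \<le> e)" (is "?P = ?Q")
  proof
    assume Q: ?Q
    show ?P
    proof (intro allI impI)
      fix e :: real assume "e > 0"
      then obtain N where "\<forall>n\<ge>N. (SUP x. cmod (u n x - l x)) \<le> e / 2"
        using Q half_gt_zero by blast
      with \<open>e > 0\<close> show "\<exists>N. \<forall>n\<ge>N. (SUP x. cmod (u n x - l x)) < e"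
        by (intro exI[of _ N]) force
    qed
  qed (meson less_imp_le)
  finally show ?thesis
    by (simp add: sup_norm_le_iff[OF b])
qed

text \<open>\<open>closed\<close> asks for one approximant in \<open>S\<close> per tolerance, which
  is all that continuity, decay and boundedness of a uniform limit require. A Cauchy sequence
  converges pointwise by completeness of the complex numbers, and then uniformly.\<close>

lemma cstar_function_algebra:
  fixes S :: "('x \<Rightarrow> complex) set"
  assumes bdd: "\<And>f. f \<in> S \<Longrightarrow> bounded (range f)"
    and zero: "(\<lambda>x. 0) \<in> S"
    and add: "\<And>f g. f \<in> S \<Longrightarrow> g \<in> S \<Longrightarrow> (\<lambda>x. f x + g x) \<in> S"
    and scale: "\<And>c f. f \<in> S \<Longrightarrow> (\<lambda>x. c * f x) \<in> S"
    and mult: "\<And>f g. f \<in> S \<Longrightarrow> g \<in> S \<Longrightarrow> (\<lambda>x. f x * g x) \<in> S"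
    and star: "\<And>f. f \<in> S \<Longrightarrow> (\<lambda>x. cnj (f x)) \<in> S"
    and closed: "\<And>l. (\<And>e. e > 0 \<Longrightarrow> \<exists>f\<in>S. \<forall>x. cmod (f x - l x) \<le> e) \<Longrightarrow> l \<in> S"
  shows "cstar_algebra (function_algebra S)"
proof (unfold_locales; (simp add: zero add scale mult star)?)
  show "cstar_norm_on (function_algebra S) S (normA (function_algebra S))"
    by (rule cstar_norm_on_sup_norm) (rule bdd)
  fix u :: "nat \<Rightarrow> 'x \<Rightarrow> complex"
  assume uS: "\<And>n. u n \<in> S"
    and cau: "\<And>\<epsilon>. 0 < \<epsilon> \<Longrightarrow> \<exists>N. \<forall>m\<ge>N. \<forall>n\<ge>N. (SUP x. cmod (u m x - u n x)) < \<epsilon>"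
  have b: "bounded (range (\<lambda>x. u m x - u n x))" for m n
    using bounded_minus_comp[OF bdd bdd, OF uS uS] by auto
  have cau': "\<exists>N. \<forall>m\<ge>N. \<forall>n\<ge>N. \<forall>x. cmod (u m x - u n x) \<le> e" if "e > 0" for e
    using cau[OF that] sup_norm_le_iff[OF b] by (meson less_imp_le)
  have "Cauchy (\<lambda>n. u n x)" for x
    unfolding Cauchy_iff
    by (meson cau' dense order_le_less_trans)
  then have lim: "(\<lambda>n. u n x) \<longlonglongrightarrow> lim (\<lambda>n. u n x)" for x
    using Cauchy_convergent_iff convergent_LIMSEQ_iff by blast
  define l where "l x = lim (\<lambda>n. u n x)" for x
  have conv: "\<exists>N. \<forall>n\<ge>N. \<forall>x. cmod (u n x - l x) \<le> e" if "e > 0" for e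
  proof -
    obtain N where N: "\<And>m n x. m \<ge> N \<Longrightarrow> n \<ge> N \<Longrightarrow> cmod (u m x - u n x) \<le> e"
      using cau' \<open>e > 0\<close> by blast
    have "cmod (u n x - l x) \<le> e" if n: "n \<ge> N" for n x
    \<comment> \<open>Letting \<open>m\<close> tend to infinity turns the uniform Cauchy estimate
      into a bound against the limit.\<close>
    proof (rule LIMSEQ_le_const2)
      show "(\<lambda>m. cmod (u n x - u m x)) \<longlonglongrightarrow> cmod (u n x - l x)"
        unfolding l_def by (intro tendsto_intros lim)
      show "\<exists>N. \<forall>m\<ge>N. cmod (u n x - u m x) \<le> e"
        using N n by blast
    qed
    then show ?thesis by blast
  qed
  have lS: "l \<in> S"
    by (rule closed) (meson conv order_refl uS)
  show "\<exists>l\<in>S. converges_in (function_algebra S) u l"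
    using conv lS by (auto simp: converges_in_function_algebra bdd uS)
qed (auto simp: algebra_simps)

section \<open>Continuous functions\<close>

text \<open>Decay is easier to verify by exhibiting some compact set than by proving a superlevel
  set compact. The two agree: a superlevel set is closed, as the preimage of a closed set, and lies
  in any such \<open>K\<close>.\<close>

lemma C0_iff:
  "f \<in> carrier (C0 X) \<longleftrightarrow> continuous_map X euclidean f \<and> (\<forall>x. x \<notin> topspace X \<longrightarrow> f x = 0) \<and>
     (\<forall>e>0. \<exists>K. compactin X K \<and> (\<forall>x\<in>topspace X. x \<notin> K \<longrightarrow> cmod (f x) < e))"
    (is "?L \<longleftrightarrow> ?c \<and> ?z \<and> ?k")
proof (intro iffI conjI)
  show ?c ?z if ?L using that by (auto simp: C0_def)
  show ?k if ?L
  proof (intro allI impI)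
    fix e :: real assume "e > 0"
    then show "\<exists>K. compactin X K \<and> (\<forall>x\<in>topspace X. x \<notin> K \<longrightarrow> cmod (f x) < e)"
      using that by (intro exI[of _ "{x \<in> topspace X. cmod (f x) \<ge> e}"]) (auto simp: C0_def)
  qed
  assume a: "?c \<and> ?z \<and> ?k"
  have "compactin X {x \<in> topspace X. cmod (f x) \<ge> e}" if e: "e > 0" for e
  proof -
    obtain K where K: "compactin X K" "\<And>x. x\<in>topspace X \<Longrightarrow> x \<notin> K \<Longrightarrow> cmod (f x) < e"
      using a e by blast
    have "{x \<in> topspace X. cmod (f x) \<ge> e} = {x \<in> topspace X. f x \<in> {z. cmod z \<ge> e}}"
      by auto
    also have "closedin X \<dots>"
    proof (rule closedin_continuous_map_preimage)
      show "continuous_map X euclidean f" using a by blast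
      show "closedin euclidean {z :: complex. e \<le> cmod z}"
        by (auto simp: closed_closedin [symmetric] intro!: closed_Collect_le continuous_intros)
    qed
    finally show ?thesis
      using K by (intro closed_compactin[OF K(1)]) force+
  qed
  then show ?L using a by (auto simp: C0_def)
qed

lemma Cb_iff:
  "f \<in> carrier (Cb X) \<longleftrightarrow> continuous_map X euclidean f \<and> (\<forall>x. x \<notin> topspace X \<longrightarrow> f x = 0) \<and>
     bounded (range f)"
  by (auto simp: Cb_def)

lemma C0_off: "f \<in> carrier (C0 X) \<Longrightarrow> x \<notin> topspace X \<Longrightarrow> f x = 0"
  unfolding C0_iff by blast

lemma Cb_off: "f \<in> carrier (Cb X) \<Longrightarrow> x \<notin> topspace X \<Longrightarrow> f x = 0"
  unfolding Cb_iff by blast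

lemma C0_simps [simp]:
  "zeroA (C0 X) = (\<lambda>x. 0)"
  "addA (C0 X) f g = (\<lambda>x. f x + g x)"
  "scaleA (C0 X) c f = (\<lambda>x. c * f x)"
  "multA (C0 X) f g = (\<lambda>x. f x * g x)"
  "starA (C0 X) f = (\<lambda>x. cnj (f x))"
  "normA (C0 X) f = (SUP x. cmod (f x))"
  "diffA (C0 X) f g = (\<lambda>x. f x - g x)"
  "lsum (C0 X) fs = (\<lambda>x. \<Sum>f\<leftarrow>fs. f x)"
  "tsum (C0 X) t xs = (\<lambda>z. \<Sum>(a, b)\<leftarrow>xs. t a b z)"
  unfolding C0_def by simp_all

lemma Cb_simps [simp]:
  "zeroA (Cb X) = (\<lambda>x. 0)"
  "addA (Cb X) f g = (\<lambda>x. f x + g x)"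
  "scaleA (Cb X) c f = (\<lambda>x. c * f x)"
  "multA (Cb X) f g = (\<lambda>x. f x * g x)"
  "starA (Cb X) f = (\<lambda>x. cnj (f x))"
  "normA (Cb X) f = (SUP x. cmod (f x))"
  unfolding Cb_def by simp_all

text \<open>Continuity as a limit along \<open>atin\<close> makes the \<open>tendsto\<close> rules
  applicable over an abstract topology.\<close>

lemma continuous_map_ring:
  fixes f g :: "'x \<Rightarrow> complex"
  assumes "continuous_map X euclidean f" "continuous_map X euclidean g"
  shows "continuous_map X euclidean (\<lambda>x. f x + g x)"
    "continuous_map X euclidean (\<lambda>x. f x * g x)"
    "continuous_map X euclidean (\<lambda>x. cnj (f x))"
  using assms unfolding continuous_map_atin limitin_canonical_iff
  by (auto intro!: tendsto_intros)

lemma continuous_map_uniform_approx: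
  fixes l :: "'x \<Rightarrow> complex"
  assumes "\<And>e. e > 0 \<Longrightarrow> \<exists>f. continuous_map X euclidean f \<and> (\<forall>x. cmod (f x - l x) \<le> e)"
  shows "continuous_map X euclidean l"
  unfolding continuous_map_atin limitin_canonical_iff
proof
  fix x assume x: "x \<in> topspace X"
  show "(l \<longlongrightarrow> l x) (atin X x)"
  proof (rule tendstoI)
    fix e :: real assume "e > 0"
    then obtain f where f: "continuous_map X euclidean f" "\<And>x. cmod (f x - l x) \<le> e / 4"
      using assms[of "e / 4"] by auto
    have "(f \<longlongrightarrow> f x) (atin X x)"
      using f x by (auto simp: continuous_map_atin)
    then have "\<forall>\<^sub>F y in atin X x. dist (f y) (f x) < e / 4"
      using \<open>e > 0\<close> by (intro tendstoD) auto
    then show "\<forall>\<^sub>F y in atin X x. dist (l y) (l x) < e"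
    proof (rule eventually_mono)
      fix y assume y: "dist (f y) (f x) < e / 4"
      have "dist (l y) (l x) \<le> dist (f y) (l y) + (dist (f y) (f x) + dist (f x) (l x))"
        by (metis add.commute add_left_mono dist_commute dist_triangle dist_triangle2 order_trans)
      also have "\<dots> < e"
        using y f(2)[of x] f(2)[of y] \<open>e > 0\<close> by (simp add: dist_norm)
      finally show "dist (l y) (l x) < e" .
    qed
  qed
qed

lemma C0_bounded:
  assumes "f \<in> carrier (C0 X)"
  shows "bounded (range f)"
proof -
  obtain K where K: "compactin X K" "\<And>x. x\<in>topspace X \<Longrightarrow> x \<notin> K \<Longrightarrow> cmod (f x) < 1"
    using assms zero_less_one unfolding C0_iff by blast
  have "compactin euclidean (f ` K)"
    using image_compactin[OF K(1), of euclidean f] assms by (simp add: C0_iff)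
  then have "bounded (f ` K)" by (simp add: compact_imp_bounded)
  then obtain c where c: "\<And>x. x \<in> K \<Longrightarrow> cmod (f x) \<le> c"
    unfolding bounded_iff by auto
  have "cmod (f x) \<le> max c 1" for x
    using K(2)[of x] c[of x] assms unfolding C0_iff
    by (cases "x \<in> topspace X"; cases "x \<in> K") (auto simp: le_max_iff_disj)
  then show ?thesis by (rule bounded_rangeI)
qed

lemma Cb_closed:
  fixes X :: "'x topology"
  shows "(\<lambda>x. 0) \<in> carrier (Cb X)"
    and "f \<in> carrier (Cb X) \<Longrightarrow> g \<in> carrier (Cb X) \<Longrightarrow> (\<lambda>x. f x + g x) \<in> carrier (Cb X)"
    and "f \<in> carrier (Cb X) \<Longrightarrow> g \<in> carrier (Cb X) \<Longrightarrow> (\<lambda>x. f x * g x) \<in> carrier (Cb X)"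
    and "f \<in> carrier (Cb X) \<Longrightarrow> (\<lambda>x. cnj (f x)) \<in> carrier (Cb X)"
    and "f \<in> carrier (Cb X) \<Longrightarrow> (\<lambda>x. c * f x) \<in> carrier (Cb X)"
  using bounded_range_mult[of "\<lambda>x. c" f]
  by (auto simp: Cb_iff bounded_range_add bounded_range_mult continuous_map_ring)
    (auto simp: bounded_iff)

text \<open>The multiplier \<open>u\<close> may be nonzero off \<open>topspace X\<close>, so
  constants are covered as well as members of \<open>Cb X\<close>. The summand 1 in
  \<open>\<bar>c\<bar> + 1\<close> avoids a division by 0.\<close>

lemma C0_multiplier:
  fixes X :: "'x topology" and f u :: "'x \<Rightarrow> complex"
  assumes f: "f \<in> carrier (C0 X)" and u: "continuous_map X euclidean u" "\<And>x. cmod (u x) \<le> c"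
  shows "(\<lambda>x. u x * f x) \<in> carrier (C0 X)"
  unfolding C0_iff
proof (intro conjI allI impI)
  show "continuous_map X euclidean (\<lambda>x. u x * f x)"
    using assms by (auto simp: C0_iff continuous_map_ring)
  show "u x * f x = 0" if "x \<notin> topspace X" for x
    using that f by (auto simp: C0_iff)
  fix e :: real assume "e > 0"
  then have "e / (\<bar>c\<bar> + 1) > 0" by (auto intro!: divide_pos_pos)
  then obtain K where K: "compactin X K"
    "\<And>x. x\<in>topspace X \<Longrightarrow> x \<notin> K \<Longrightarrow> cmod (f x) < e / (\<bar>c\<bar> + 1)"
    using f unfolding C0_iff by meson
  have "cmod (u x * f x) < e" if "x\<in>topspace X" "x \<notin> K" for x
  proof -
    have "cmod (u x * f x) \<le> (\<bar>c\<bar> + 1) * cmod (f x)"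
      unfolding norm_mult using u(2)[of x] by (intro mult_right_mono) auto
    also have "\<dots> < e"
      using K(2)[OF that] by (simp add: field_simps)
    finally show ?thesis .
  qed
  then show "\<exists>K. compactin X K \<and> (\<forall>x\<in>topspace X. x \<notin> K \<longrightarrow> cmod (u x * f x) < e)"
    using K by blast
qed

lemma C0_subset_Cb: "carrier (C0 X) \<subseteq> carrier (Cb X)"
  using C0_bounded[of _ X] by (auto simp: Cb_iff simp del: One_nat_def) (auto simp: C0_iff)

lemma Cb_mult_C0:
  "m \<in> carrier (Cb X) \<Longrightarrow> f \<in> carrier (C0 X) \<Longrightarrow> (\<lambda>x. m x * f x) \<in> carrier (C0 X)"
  using C0_multiplier[of f X m] unfolding Cb_iff bounded_iff by auto

lemma C0_closed:
  fixes X :: "'x topology"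
  shows "(\<lambda>x. 0) \<in> carrier (C0 X)"
    and "f \<in> carrier (C0 X) \<Longrightarrow> g \<in> carrier (C0 X) \<Longrightarrow> (\<lambda>x. f x + g x) \<in> carrier (C0 X)"
    and "f \<in> carrier (C0 X) \<Longrightarrow> g \<in> carrier (C0 X) \<Longrightarrow> (\<lambda>x. f x * g x) \<in> carrier (C0 X)"
    and "f \<in> carrier (C0 X) \<Longrightarrow> (\<lambda>x. cnj (f x)) \<in> carrier (C0 X)"
    and "f \<in> carrier (C0 X) \<Longrightarrow> (\<lambda>x. c * f x) \<in> carrier (C0 X)"
proof -
  show "(\<lambda>x. 0) \<in> carrier (C0 X)"
    by (auto simp: C0_iff intro: exI[of _ "{}"])
  show "(\<lambda>x. f x * g x) \<in> carrier (C0 X)"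
    if "f \<in> carrier (C0 X)" "g \<in> carrier (C0 X)"
    using that C0_subset_Cb Cb_mult_C0 by blast
  show "(\<lambda>x. c * f x) \<in> carrier (C0 X)" if "f \<in> carrier (C0 X)"
    using C0_multiplier[OF that, of "\<lambda>_. c" "cmod c"] by auto
  show "(\<lambda>x. cnj (f x)) \<in> carrier (C0 X)" if "f \<in> carrier (C0 X)"
    using that by (auto simp: C0_iff continuous_map_ring)
  show "(\<lambda>x. f x + g x) \<in> carrier (C0 X)"
    if f: "f \<in> carrier (C0 X)" and g: "g \<in> carrier (C0 X)"
    unfolding C0_iff
  proof (intro conjI allI impI)
    show "continuous_map X euclidean (\<lambda>x. f x + g x)"
      using that by (auto simp: C0_iff continuous_map_ring)
    show "f x + g x = 0" if "x \<notin> topspace X" for x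
      using that f g by (auto simp: C0_iff)
    fix e :: real assume e: "e > 0"
    obtain K where K: "compactin X K"
      "\<And>x. x\<in>topspace X \<Longrightarrow> x \<notin> K \<Longrightarrow> cmod (f x) < e / 2"
      using f e half_gt_zero unfolding C0_iff by meson
    obtain L where L: "compactin X L"
      "\<And>x. x\<in>topspace X \<Longrightarrow> x \<notin> L \<Longrightarrow> cmod (g x) < e / 2"
      using g e half_gt_zero unfolding C0_iff by meson
    have "cmod (f x + g x) < e" if "x\<in>topspace X" "x \<notin> K \<union> L" for x
      using that K(2)[of x] L(2)[of x] norm_triangle_ineq[of "f x" "g x"] by force
    then show "\<exists>K. compactin X K \<and> (\<forall>x\<in>topspace X. x \<notin> K \<longrightarrow> cmod (f x + g x) < e)"
      using compactin_Un[OF K(1) L(1)] by blast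
  qed
qed

lemma C0_diff:
  fixes X :: "'x topology"
  assumes "f \<in> carrier (C0 X)" "g \<in> carrier (C0 X)"
  shows "(\<lambda>x. f x - g x) \<in> carrier (C0 X)"
  using C0_closed(2)[OF assms(1) C0_closed(5)[OF assms(2), of "-1"]] by simp

lemma cstar_C0: "cstar_algebra (C0 X)"
proof -
  have "cstar_algebra (function_algebra (carrier (C0 X)))"
  proof (rule cstar_function_algebra)
    fix l :: "'a \<Rightarrow> complex"
    assume l: "\<And>e. e > 0 \<Longrightarrow> \<exists>f\<in>carrier (C0 X). \<forall>x. cmod (f x - l x) \<le> e"
    show "l \<in> carrier (C0 X)"
      unfolding C0_iff
    proof (intro conjI allI impI)
      show "continuous_map X euclidean l"
      proof (rule continuous_map_uniform_approx)
        fix e :: real assume "e > 0"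
        then obtain f where "f \<in> carrier (C0 X)" "\<forall>x. cmod (f x - l x) \<le> e"
          using l by blast
        then show "\<exists>f. continuous_map X euclidean f \<and> (\<forall>x. cmod (f x - l x) \<le> e)"
          by (auto simp: C0_iff)
      qed
      show "l x = 0" if "x \<notin> topspace X" for x
      proof (rule ccontr)
        assume "l x \<noteq> 0"
        \<comment> \<open>The approximant vanishes at \<open>x\<close>, so it cannot be within half
          of |l x| of \<open>l x\<close>.\<close>
        then obtain f where "f \<in> carrier (C0 X)" "cmod (f x - l x) \<le> cmod (l x) / 2"
          using l[of "cmod (l x) / 2"] by auto
        with that \<open>l x \<noteq> 0\<close> show False by (auto simp: C0_iff)
      qed
      fix e :: real assume e: "e > 0"
      then obtain f where f: "f \<in> carrier (C0 X)" "\<And>x. cmod (f x - l x) \<le> e / 2"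
        using l[of "e / 2"] by auto
      obtain K where K: "compactin X K"
        "\<And>x. x\<in>topspace X \<Longrightarrow> x \<notin> K \<Longrightarrow> cmod (f x) < e / 2"
        using f e half_gt_zero unfolding C0_iff by meson
      have "cmod (l x) < e" if "x\<in>topspace X" "x \<notin> K" for x
        using K(2)[OF that] f(2)[of x] norm_triangle_sub[of "l x" "f x"]
        by (simp add: norm_minus_commute)
      then show "\<exists>K. compactin X K \<and> (\<forall>x\<in>topspace X. x \<notin> K \<longrightarrow> cmod (l x) < e)"
        using K by blast
    qed
  qed (auto simp: C0_closed C0_bounded)
  then show ?thesis by (simp add: C0_def)
qed

lemma cstar_Cb: "cstar_algebra (Cb X)"
proof -
  have "cstar_algebra (function_algebra (carrier (Cb X)))"
  proof (rule cstar_function_algebra)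
    fix l :: "'a \<Rightarrow> complex"
    assume l: "\<And>e. e > 0 \<Longrightarrow> \<exists>f\<in>carrier (Cb X). \<forall>x. cmod (f x - l x) \<le> e"
    show "l \<in> carrier (Cb X)"
      unfolding Cb_iff
    proof (intro conjI allI impI)
      show "continuous_map X euclidean l"
      proof (rule continuous_map_uniform_approx)
        fix e :: real assume "e > 0"
        then obtain f where "f \<in> carrier (Cb X)" "\<forall>x. cmod (f x - l x) \<le> e"
          using l by blast
        then show "\<exists>f. continuous_map X euclidean f \<and> (\<forall>x. cmod (f x - l x) \<le> e)"
          by (auto simp: Cb_iff)
      qed
      show "l x = 0" if "x \<notin> topspace X" for x
      proof (rule ccontr)
        assume "l x \<noteq> 0"
        then obtain f where "f \<in> carrier (Cb X)" "cmod (f x - l x) \<le> cmod (l x) / 2"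
          using l[of "cmod (l x) / 2"] by auto
        with that \<open>l x \<noteq> 0\<close> show False by (auto simp: Cb_iff)
      qed
      obtain f where f: "f \<in> carrier (Cb X)" "\<And>x. cmod (f x - l x) \<le> 1"
        using l[of 1] by auto
      then obtain c where c: "\<And>x. cmod (f x) \<le> c"
        unfolding Cb_iff bounded_iff by auto
      have "cmod (l x) \<le> c + 1" for x
        using c[of x] f(2)[of x] norm_triangle_sub[of "l x" "f x"]
        by (simp add: norm_minus_commute)
      then show "bounded (range l)" by (rule bounded_rangeI)
    qed
  qed (blast intro: Cb_closed | simp add: Cb_iff)+
  then show ?thesis by (simp add: Cb_def)
qed

section \<open>Partitions of unity\<close>

text \<open>Complete regularity separates \<open>x\<close> from the complement of an open
  \<open>V\<close> that lies in a compact \<open>K\<close> inside \<open>U\<close>. One minus the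
  separating function then lives on \<open>K\<close>, which yields both decay and vanishing off
  \<open>U\<close>.\<close>

lemma C0_bump:
  assumes "locally_compact_space X" "Hausdorff_space X" "openin X U" "x \<in> U"
  obtains g :: "'x \<Rightarrow> real" where "(\<lambda>y. of_real (g y)) \<in> carrier (C0 X)"
    "\<And>y. 0 \<le> g y" "\<And>y. g y \<le> 1" "g x = 1" "\<And>y. y \<notin> U \<Longrightarrow> g y = 0"
proof -
  obtain V K where V: "openin X V" "compactin X K" "x \<in> V" "V \<subseteq> K" "K \<subseteq> U"
  proof -
    have "neighbourhood_base_at x (compactin X) X"
      using assms openin_subset locally_compact_space_neighbourhood_base[of X]
      unfolding neighbourhood_base_of_def by blast
    then show thesis
      using assms(3,4) that unfolding neighbourhood_base_at_def by blast
  qed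
  have cr: "completely_regular_space X"
    using assms locally_compact_regular_imp_completely_regular_space by blast
  have x: "x \<in> topspace X" using V openin_subset by blast
  have "closedin X (topspace X - V)" using V by blast
  then obtain f :: "'x \<Rightarrow> real" where f: "continuous_map X (top_of_set {0..1}) f"
    "f x = 0" "f ` (topspace X - V) \<subseteq> {1}"
    using cr V x unfolding completely_regular_space_def
    by (metis (no_types, lifting) DiffD2 DiffI)
  define g where "g y = (if y \<in> topspace X then 1 - f y else 0)" for y
  have f01: "0 \<le> f y \<and> f y \<le> 1" if "y \<in> topspace X" for y
    using f(1) that by (auto simp: continuous_map_in_subtopology)
  have f1: "f y = 1" if "y \<in> topspace X" "y \<notin> V" for y
    using f(3) that by auto
  have gc: "continuous_map X euclidean (\<lambda>y. of_real (g y) :: complex)"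
  proof -
    have "continuous_map X euclidean f" using f(1) by (simp add: continuous_map_in_subtopology)
    then have "continuous_map X euclidean (\<lambda>y. of_real (1 - f y) :: complex)"
      unfolding continuous_map_atin limitin_canonical_iff by (auto intro!: tendsto_intros)
    then show ?thesis
      by (rule continuous_map_eq) (simp add: g_def)
  qed
  show thesis
  proof
    show "(\<lambda>y. of_real (g y) :: complex) \<in> carrier (C0 X)"
      unfolding C0_iff
    proof (intro conjI allI impI)
      show "\<exists>K. compactin X K \<and> (\<forall>y\<in>topspace X. y \<notin> K \<longrightarrow> cmod (of_real (g y)) < e)"
        if "e > 0" for e
        using V f1 that by (intro exI[of _ K] conjI ballI impI) (force simp: g_def)+
    qed (use gc in \<open>auto simp: g_def\<close>)
    show "g y = 0" if "y \<notin> U" for y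
      using that f1[of y] V by (auto simp: g_def)
  qed (use f01 x f in \<open>auto simp: g_def\<close>)
qed

lemma C0_real_times_continuous:
  assumes "(\<lambda>y. of_real (g y) :: complex) \<in> carrier (C0 X)"
    and "continuous_map X euclideanreal h" "\<And>y. \<bar>h y\<bar> \<le> c"
  shows "(\<lambda>y. of_real (h y * g y) :: complex) \<in> carrier (C0 X)"
proof -
  have "continuous_map X euclidean (\<lambda>y. of_real (h y) :: complex)"
    using assms(2) unfolding continuous_map_atin limitin_canonical_iff
    by (auto intro!: tendsto_intros)
  from C0_multiplier[OF assms(1) this, of c] assms(3) show ?thesis by simp
qed

text \<open>The bumps are divided by \<open>max 1 s\<close>, with \<open>s\<close> the sum of the
  doubled bumps. This keeps the total at most 1 everywhere, and makes it equal to 1 wherever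
  \<open>s\<close> is at least 1, in particular on \<open>K\<close>.\<close>

lemma C0_partition:
  fixes X :: "'x topology"
  assumes X: "locally_compact_space X" "Hausdorff_space X" and K: "compactin X K"
    and U: "\<And>x. x \<in> K \<Longrightarrow> openin X (U x) \<and> x \<in> U x"
  obtains I and \<phi> :: "'x \<Rightarrow> 'x \<Rightarrow> real" where "finite I" "I \<subseteq> K"
    "\<And>k. k \<in> I \<Longrightarrow> (\<lambda>y. of_real (\<phi> k y)) \<in> carrier (C0 X)"
    "\<And>k y. 0 \<le> \<phi> k y" "\<And>k y. k \<in> I \<Longrightarrow> y \<notin> U k \<Longrightarrow> \<phi> k y = 0"
    "\<And>y. (\<Sum>k\<in>I. \<phi> k y) \<le> 1" "\<And>y. y \<in> K \<Longrightarrow> (\<Sum>k\<in>I. \<phi> k y) = 1"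
proof -
  let ?P = "\<lambda>x g. (\<lambda>y. of_real (g y)) \<in> carrier (C0 X) \<and>
    (\<forall>y. 0 \<le> g y) \<and> (\<forall>y. g y \<le> 1) \<and> g x = 1 \<and> (\<forall>y. y \<notin> U x \<longrightarrow> g y = 0)"
  have "\<forall>x\<in>K. \<exists>g :: 'x \<Rightarrow> real. ?P x g"
  proof
    fix x assume x: "x \<in> K"
    show "\<exists>g :: 'x \<Rightarrow> real. ?P x g"
      by (rule C0_bump[OF X, of "U x" x]) (use U[OF x] in auto)
  qed
  from bchoice[OF this] obtain g :: "'x \<Rightarrow> 'x \<Rightarrow> real" where g': "\<forall>x\<in>K. ?P x (g x)" ..
  have g: "\<And>x. x \<in> K \<Longrightarrow> (\<lambda>y. of_real (g x y)) \<in> carrier (C0 X)"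
    "\<And>x y. x \<in> K \<Longrightarrow> 0 \<le> g x y" "\<And>x y. x \<in> K \<Longrightarrow> g x y \<le> 1"
    "\<And>x. x \<in> K \<Longrightarrow> g x x = 1" "\<And>x y. x \<in> K \<Longrightarrow> y \<notin> U x \<Longrightarrow> g x y = 0"
    using g' by blast+
  have gc: "continuous_map X euclideanreal (g x)" if "x \<in> K" for x
  proof -
    have "continuous_map X euclidean (\<lambda>y. Re (of_real (g x y)))"
      using g(1)[OF that] unfolding C0_iff continuous_map_atin limitin_canonical_iff
      by (intro ballI tendsto_Re) blast
    then show ?thesis by simp
  qed
  define W where "W x = {y \<in> topspace X. g x y \<in> {1/2<..}}" for x
  have W: "openin X (W x)" if "x \<in> K" for x
    unfolding W_def using gc[OF that] by (intro openin_continuous_map_preimage) auto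
  have "K \<subseteq> \<Union> (W ` K)"
    using g(4) compactin_subset_topspace[OF K] by (auto simp: W_def)
  then obtain \<F> where \<F>: "finite \<F>" "\<F> \<subseteq> W ` K" "K \<subseteq> \<Union> \<F>"
    using K W unfolding compactin_def by (metis (no_types, lifting) imageE)
  then obtain I where I: "finite I" "I \<subseteq> K" "\<F> = W ` I"
    using finite_subset_image by metis
  \<comment> \<open>The sets \<open>W k\<close> with \<open>k\<close> in \<open>I\<close> cover
    \<open>K\<close>, and the factor 2 makes the doubled bump exceed 1 on \<open>W k\<close>.
    Setting \<open>\<phi> k\<close> to 0 for \<open>k\<close> outside \<open>I\<close> makes
    nonnegativity hold for all \<open>k\<close>.\<close>
  define s where "s y = (\<Sum>k\<in>I. 2 * g k y)" for y
  define \<phi> where "\<phi> k y = (if k \<in> I then 1 / max 1 (s y) * (2 * g k y) else 0)" for k y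
  have s: "continuous_map X euclideanreal s"
    unfolding s_def using gc I(2)
    by (intro continuous_map_sum continuous_map_real_mult_left) (auto simp: I(1))
  have max: "max 1 (s y) > 0" for y by auto
  have h: "continuous_map X euclideanreal (\<lambda>y. 1 / max 1 (s y))"
    using s by (intro continuous_intros) (auto simp: max_def)
  have sum: "(\<Sum>k\<in>I. \<phi> k y) = s y / max 1 (s y)" for y
    unfolding s_def \<phi>_def by (simp add: sum_divide_distrib)
  show thesis
  proof
    show "(\<lambda>y. of_real (\<phi> k y)) \<in> carrier (C0 X)" if "k \<in> I" for k
    proof -
      have "(\<lambda>y. of_real (2 * g k y) :: complex) \<in> carrier (C0 X)"
        using C0_closed(5)[OF g(1), of k 2] that I(2) by auto
      from C0_real_times_continuous[OF this h, of 1] that show ?thesis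
        by (simp add: \<phi>_def)
    qed
    show "0 \<le> \<phi> k y" for k y
      using g(2)[of k y] I(2) by (auto simp: \<phi>_def)
    show "\<phi> k y = 0" if "k \<in> I" "y \<notin> U k" for k y
      using g(5)[of k y] I(2) that by (auto simp: \<phi>_def)
    show "(\<Sum>k\<in>I. \<phi> k y) \<le> 1" for y
      unfolding sum using max by (simp add: divide_le_eq)
    show "(\<Sum>k\<in>I. \<phi> k y) = 1" if y: "y \<in> K" for y
    proof -
      obtain k where k: "k \<in> I" "y \<in> W k" using \<F> I y by blast
      have "2 * g k y \<le> s y"
        unfolding s_def using I g(2) k by (intro member_le_sum) auto
      then have "s y \<ge> 1" using k by (auto simp: W_def)
      then show ?thesis unfolding sum by auto
    qed
  qed (use I in auto)
qed

text \<open>\<open>F\<close> is sampled at the points \<open>k\<close> and interpolated by a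
  partition. With \<open>s\<close> the sum of the partition at \<open>x\<close>, the error splits
  into \<open>(1 - s) * F x j\<close>, nonzero only off \<open>K\<close> where \<open>F\<close> is
  small, and a weighted sum of the differences \<open>F x j - F k j\<close>, to which only those
  \<open>k\<close> with \<open>x\<close> in \<open>U k\<close> contribute. One partition serves all
  \<open>j\<close>: the index is the second coordinate of a product in one use and a member of a
  finite set of functions in the other.\<close>

lemma C0_family_approx:
  fixes X :: "'x topology" and F :: "'x \<Rightarrow> 'j \<Rightarrow> complex"
  assumes X: "locally_compact_space X" "Hausdorff_space X" and K: "compactin X K"
    and out: "\<And>x j. x \<notin> K \<Longrightarrow> j \<in> J \<Longrightarrow> cmod (F x j) \<le> e"
    and osc: "\<And>x. x \<in> K \<Longrightarrow> \<exists>U. openin X U \<and> x \<in> U \<and> (\<forall>y\<in>U. \<forall>j\<in>J. cmod (F y j - F x j) \<le> e)"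
  obtains I and \<phi> :: "'x \<Rightarrow> 'x \<Rightarrow> real" where "finite I" "I \<subseteq> K"
    "\<And>k. k \<in> I \<Longrightarrow> (\<lambda>y. of_real (\<phi> k y)) \<in> carrier (C0 X)"
    "\<And>k y. 0 \<le> \<phi> k y" "\<And>y. (\<Sum>k\<in>I. \<phi> k y) \<le> 1"
    "\<And>x j. j \<in> J \<Longrightarrow> cmod (F x j - (\<Sum>k\<in>I. of_real (\<phi> k x) * F k j)) \<le> 2 * \<bar>e\<bar>"
proof -
  obtain U where U: "\<And>x. x \<in> K \<Longrightarrow> openin X (U x) \<and> x \<in> U x"
    "\<And>x y j. x \<in> K \<Longrightarrow> y \<in> U x \<Longrightarrow> j \<in> J \<Longrightarrow> cmod (F y j - F x j) \<le> e"
    using osc by metis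
  obtain I and \<phi> :: "'x \<Rightarrow> 'x \<Rightarrow> real" where I: "finite I" "I \<subseteq> K"
    and \<phi>: "\<And>k. k \<in> I \<Longrightarrow> (\<lambda>y. of_real (\<phi> k y)) \<in> carrier (C0 X)"
    "\<And>k y. 0 \<le> \<phi> k y" "\<And>k y. k \<in> I \<Longrightarrow> y \<notin> U k \<Longrightarrow> \<phi> k y = 0"
    "\<And>y. (\<Sum>k\<in>I. \<phi> k y) \<le> 1" "\<And>y. y \<in> K \<Longrightarrow> (\<Sum>k\<in>I. \<phi> k y) = 1"
    using C0_partition[OF X K, of U] U(1) by blast
  show thesis
  proof (rule that[OF I \<phi>(1,2,4)])
    fix x j assume j: "j \<in> J"
    let ?s = "\<Sum>k\<in>I. \<phi> k x"
    have "F x j - (\<Sum>k\<in>I. of_real (\<phi> k x) * F k j) =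
      of_real (1 - ?s) * F x j + (\<Sum>k\<in>I. of_real (\<phi> k x) * (F x j - F k j))"
      by (simp add: algebra_simps sum_subtractf sum_distrib_left)
    also have "cmod \<dots> \<le> (1 - ?s) * cmod (F x j) + (\<Sum>k\<in>I. \<phi> k x * cmod (F x j - F k j))"
    proof (rule order_trans[OF norm_triangle_ineq], rule add_mono)
      show "cmod (of_real (1 - ?s) * F x j) \<le> (1 - ?s) * cmod (F x j)"
        unfolding norm_mult norm_of_real using \<phi>(4)[of x] by simp
      show "cmod (\<Sum>k\<in>I. of_real (\<phi> k x) * (F x j - F k j)) \<le> (\<Sum>k\<in>I. \<phi> k x * cmod (F x j - F k j))"
        using \<phi>(2) by (intro order_trans[OF norm_sum] sum_mono) (simp add: norm_mult)
    qed
    also have "\<dots> \<le> \<bar>e\<bar> + \<bar>e\<bar>"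
    proof (rule add_mono)
      show "(1 - ?s) * cmod (F x j) \<le> \<bar>e\<bar>"
      proof (cases "x \<in> K")
        case False
        have "(1 - ?s) * cmod (F x j) \<le> 1 * \<bar>e\<bar>"
          using out[OF False j] \<phi>(4)[of x] sum_nonneg[of I "\<lambda>k. \<phi> k x"] \<phi>(2)
          by (intro mult_mono) auto
        then show ?thesis by simp
      qed (simp add: \<phi>(5))
      have "(\<Sum>k\<in>I. \<phi> k x * cmod (F x j - F k j)) \<le> (\<Sum>k\<in>I. \<phi> k x * \<bar>e\<bar>)"
      proof (rule sum_mono)
        fix k assume k: "k \<in> I"
        show "\<phi> k x * cmod (F x j - F k j) \<le> \<phi> k x * \<bar>e\<bar>"
        proof (cases "x \<in> U k")
          case True
          then have "cmod (F x j - F k j) \<le> \<bar>e\<bar>"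
            using U(2)[of k x j] j k I by auto
          then show ?thesis using \<phi>(2) by (intro mult_left_mono)
        qed (simp add: \<phi>(3) k)
      qed
      also have "\<dots> \<le> \<bar>e\<bar>"
        using \<phi>(4)[of x] mult_right_mono[of ?s 1 "\<bar>e\<bar>"] by (simp add: sum_distrib_right)
      finally show "(\<Sum>k\<in>I. \<phi> k x * cmod (F x j - F k j)) \<le> \<bar>e\<bar>" .
    qed
    finally show "cmod (F x j - (\<Sum>k\<in>I. of_real (\<phi> k x) * F k j)) \<le> 2 * \<bar>e\<bar>" by simp
  qed
qed

section \<open>The multiplier algebra\<close>

lemma C0_peak:
  assumes "locally_compact_space X" "Hausdorff_space X" "x \<in> topspace X"
  obtains f where "f \<in> carrier (C0 X)" "f x = 1" "\<And>y. cmod (f y) \<le> 1"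
proof -
  obtain g :: "'a \<Rightarrow> real" where "(\<lambda>y. of_real (g y)) \<in> carrier (C0 X)"
    "\<And>y. 0 \<le> g y" "\<And>y. g y \<le> 1" "g x = 1"
    using C0_bump[OF assms(1,2) openin_topspace assms(3)] by metis
  then show ?thesis by (intro that[of "\<lambda>y. of_real (g y)"]) auto
qed

text \<open>The multiplier is read off pointwise: \<open>m x\<close> is the value at
  \<open>x\<close> of \<open>L\<close> applied to a function peaking at \<open>x\<close>.
  Commutativity gives \<open>L f * g = L g * f\<close>, which forces \<open>L f = m * f\<close>, and
  the mixed relation between \<open>R\<close> and \<open>L\<close> yields \<open>R\<close>.
  Boundedness of \<open>m\<close> comes from that of \<open>L\<close>.\<close>

lemma double_centralizer_C0:
  assumes X: "locally_compact_space X" "Hausdorff_space X" and LR: "double_centralizer (C0 X) L R"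
  shows "\<exists>m\<in>carrier (Cb X). \<forall>f\<in>carrier (C0 X). L f = (\<lambda>x. m x * f x) \<and> R f = (\<lambda>x. f x * m x)"
proof -
  have L: "\<And>f. f \<in> carrier (C0 X) \<Longrightarrow> L f \<in> carrier (C0 X)"
    and Lm: "\<And>f g. f \<in> carrier (C0 X) \<Longrightarrow> g \<in> carrier (C0 X) \<Longrightarrow> L (\<lambda>x. f x * g x) = (\<lambda>x. L f x * g x)"
    and R: "\<And>f. f \<in> carrier (C0 X) \<Longrightarrow> R f \<in> carrier (C0 X)"
    and RL: "\<And>f g. f \<in> carrier (C0 X) \<Longrightarrow> g \<in> carrier (C0 X) \<Longrightarrow> (\<lambda>x. R f x * g x) = (\<lambda>x. f x * L g x)"
    using LR unfolding double_centralizer_def by simp_all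
  obtain c where c: "\<And>f. f \<in> carrier (C0 X) \<Longrightarrow> (SUP x. cmod (L f x)) \<le> c * (SUP x. cmod (f x))"
  proof -
    have "\<exists>c. \<forall>f\<in>carrier (C0 X). (SUP x. cmod (L f x)) \<le> c * (SUP x. cmod (f x))"
      using LR unfolding double_centralizer_def by simp
    then show thesis using that by blast
  qed
  have comm: "L f x * g x = L g x * f x" if "f \<in> carrier (C0 X)" "g \<in> carrier (C0 X)" for f g x
    using Lm[OF that] Lm[OF that(2,1)] by (simp add: mult.commute fun_eq_iff)
  have "\<exists>f. f \<in> carrier (C0 X) \<and> f x = 1 \<and> (\<forall>y. cmod (f y) \<le> 1)" if "x \<in> topspace X" for x
    using C0_peak[OF X that] by metis
  then obtain p where p: "\<And>x. x \<in> topspace X \<Longrightarrow> p x \<in> carrier (C0 X)"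
    "\<And>x. x \<in> topspace X \<Longrightarrow> p x x = 1" "\<And>x y. x \<in> topspace X \<Longrightarrow> cmod (p x y) \<le> 1"
    by metis
  define m where "m x = (if x \<in> topspace X then L (p x) x else 0)" for x
  have Lfm: "L f x = m x * f x" if f: "f \<in> carrier (C0 X)" for f x
  proof (cases "x \<in> topspace X")
    case True
    then show ?thesis
      using comm[OF f p(1)[OF True], of x] p(2)[OF True] by (simp add: m_def)
  next
    case False
    then show ?thesis
      using L[OF f] f by (simp add: C0_iff m_def)
  qed
  have Rfm: "R f x = f x * m x" if f: "f \<in> carrier (C0 X)" for f x
  proof (cases "x \<in> topspace X")
    case True
    then show ?thesis
      using RL[OF f p(1)[OF True]] p(2)[OF True] Lfm[OF p(1)[OF True], of x]
      by (metis mult.right_neutral)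
  next
    case False
    then show ?thesis
      using R[OF f] f by (simp add: C0_iff m_def)
  qed
  have "m \<in> carrier (Cb X)"
    unfolding Cb_iff
  proof (intro conjI allI impI)
    show "continuous_map X euclidean m"
      unfolding continuous_map_atin limitin_canonical_iff
    proof
      fix x assume x: "x \<in> topspace X"
      have l: "(L (p x) \<longlongrightarrow> L (p x) x) (atin X x)" "(p x \<longlongrightarrow> p x x) (atin X x)"
        using L[OF p(1)[OF x]] p(1)[OF x] x by (auto simp: C0_iff continuous_map_atin)
      have ne: "\<forall>\<^sub>F y in atin X x. p x y \<noteq> 0"
        using l(2) by (rule tendsto_imp_eventually_ne) (simp add: p(2) x)
      \<comment> \<open>Peak functions for different points are unrelated, so continuity of
        \<open>m\<close> is obtained near \<open>x\<close> from the single peak \<open>p x\<close>,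
        of which \<open>m\<close> is there a quotient.\<close>
      have "((\<lambda>y. L (p x) y / p x y) \<longlongrightarrow> L (p x) x / p x x) (atin X x)"
        using l by (intro tendsto_intros) (auto simp: p x)
      moreover have "\<forall>\<^sub>F y in atin X x. L (p x) y / p x y = m y"
        using ne by (rule eventually_mono) (simp add: Lfm p x)
      ultimately have "(m \<longlongrightarrow> L (p x) x / p x x) (atin X x)"
        by (rule Lim_transform_eventually)
      then show "(m \<longlongrightarrow> m x) (atin X x)"
        by (simp add: p x m_def)
    qed
    show "m x = 0" if "x \<notin> topspace X" for x using that by (simp add: m_def)
    have "cmod (m x) \<le> \<bar>c\<bar>" for x
    proof (cases "x \<in> topspace X")
      case True
      note px = p(1)[OF True]
      have "cmod (m x) \<le> (SUP y. cmod (L (p x) y))"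
        using le_sup_norm[OF C0_bounded[OF L[OF px]], of x] True by (simp add: m_def)
      also have "\<dots> \<le> c * (SUP y. cmod (p x y))" by (rule c[OF px])
      also have "\<dots> \<le> \<bar>c\<bar> * 1"
        using sup_norm_nonneg[OF C0_bounded[OF px]] p(3)[OF True]
        by (intro mult_mono sup_norm_le) auto
      finally show ?thesis by simp
    qed (simp add: m_def)
    then show "bounded (range m)" by (rule bounded_rangeI)
  qed
  then show ?thesis using Lfm Rfm by blast
qed

text \<open>Existence is \<open>double_centralizer_C0\<close>; for uniqueness, a multiplier is
  determined at each point by its product with a function equal to 1 there.\<close>

lemma multiplier_algebra_C0:
  assumes X: "locally_compact_space X" "Hausdorff_space X"
  shows "multiplier_algebra (C0 X) (Cb X)"
proof -
  have uniq: "m = m'" if m: "m \<in> carrier (Cb X)" "m' \<in> carrier (Cb X)"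
    and eq: "\<And>f. f \<in> carrier (C0 X) \<Longrightarrow> (\<lambda>x. m x * f x) = (\<lambda>x. m' x * f x)" for m m'
  proof
    fix x
    show "m x = m' x"
    proof (cases "x \<in> topspace X")
      case True
      then obtain f where "f \<in> carrier (C0 X)" "f x = 1" using C0_peak[OF X] by metis
      then show ?thesis using eq by (metis mult.right_neutral)
    qed (use m in \<open>simp add: Cb_iff\<close>)
  qed
  have "\<exists>!m. m \<in> carrier (Cb X) \<and>
      (\<forall>f\<in>carrier (C0 X). L f = (\<lambda>x. m x * f x) \<and> R f = (\<lambda>x. f x * m x))"
    if LR: "double_centralizer (C0 X) L R" for L R
  proof -
    obtain m where m: "m \<in> carrier (Cb X)"
      "\<forall>f\<in>carrier (C0 X). L f = (\<lambda>x. m x * f x) \<and> R f = (\<lambda>x. f x * m x)"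
      using double_centralizer_C0[OF X LR] by blast
    show ?thesis
    proof (rule ex1I[of _ m])
      fix m' assume m': "m' \<in> carrier (Cb X) \<and>
        (\<forall>f\<in>carrier (C0 X). L f = (\<lambda>x. m' x * f x) \<and> R f = (\<lambda>x. f x * m' x))"
      show "m' = m"
      proof (rule uniq)
        show "(\<lambda>x. m' x * f x) = (\<lambda>x. m x * f x)" if "f \<in> carrier (C0 X)" for f
          using m(2) m' that by metis
      qed (use m m' in auto)
    qed (use m in auto)
  qed
  moreover have "(\<lambda>x. f x * m x) \<in> carrier (C0 X)"
    if "m \<in> carrier (Cb X)" "f \<in> carrier (C0 X)" for m f
    using Cb_mult_C0[OF that] by (simp add: mult.commute)
  ultimately show ?thesis
    unfolding multiplier_algebra_def
    using cstar_C0[of X] cstar_Cb[of X] C0_subset_Cb[of X]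
    by (auto simp: star_hom_def Cb_mult_C0)
qed

section \<open>Functions on products\<close>

lemma C0_compose_homeomorphic:
  assumes f: "f \<in> carrier (C0 Y)" and h: "homeomorphic_map Z Y h"
  shows "(\<lambda>z. if z \<in> topspace Z then f (h z) else 0) \<in> carrier (C0 Z)"
  unfolding C0_iff
proof (intro conjI allI impI)
  have hc: "continuous_map Z Y h" using h by (rule homeomorphic_imp_continuous_map)
  have "continuous_map Z euclidean (\<lambda>z. f (h z))"
    using continuous_map_compose[OF hc, of euclidean f] f by (simp add: C0_iff o_def)
  then show "continuous_map Z euclidean (\<lambda>z. if z \<in> topspace Z then f (h z) else 0)"
    by (rule continuous_map_eq) simp
  fix e :: real assume "e > 0"
  then obtain K where K: "compactin Y K" "\<And>x. x \<in> topspace Y \<Longrightarrow> x \<notin> K \<Longrightarrow> cmod (f x) < e"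
    using f unfolding C0_iff by meson
  define L where "L = {z \<in> topspace Z. h z \<in> K}"
  have "h ` L = K \<inter> h ` topspace Z" unfolding L_def by blast
  then have "h ` L = K"
    using homeomorphic_imp_surjective_map[OF h] compactin_subset_topspace[OF K(1)] by auto
  then have "compactin Z L"
    using homeomorphic_map_compactness_eq[OF h, of L] K(1) by (auto simp: L_def)
  moreover have "\<forall>z\<in>topspace Z. z \<notin> L \<longrightarrow> cmod (if z \<in> topspace Z then f (h z) else 0) < e"
    using K(2) continuous_map_funspace[OF hc] unfolding L_def by (simp add: Pi_iff)
  ultimately show "\<exists>K. compactin Z K \<and> (\<forall>z\<in>topspace Z. z \<notin> K \<longrightarrow>
      cmod (if z \<in> topspace Z then f (h z) else 0) < e)"
    by blast
qed simp

text \<open>When \<open>h\<close> also maps the complement into the complement, plain composition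
  respects the convention that functions vanish off the space. This gives exact equalities of
  functions on the whole type.\<close>

lemma C0_compose:
  assumes "f \<in> carrier (C0 Y)" "homeomorphic_map Z Y h" "\<And>z. z \<notin> topspace Z \<Longrightarrow> h z \<notin> topspace Y"
  shows "(\<lambda>z. f (h z)) \<in> carrier (C0 Z)"
proof -
  have "(\<lambda>z. f (h z)) = (\<lambda>z. if z \<in> topspace Z then f (h z) else 0)"
    using assms by (auto simp: C0_iff)
  then show ?thesis using C0_compose_homeomorphic[OF assms(1,2)] by simp
qed

lemma C0_tensor:
  fixes f :: "'x \<Rightarrow> complex" and g :: "'y \<Rightarrow> complex"
  assumes f: "f \<in> carrier (C0 X)" and g: "g \<in> carrier (C0 Y)"
  shows "(\<lambda>z. f (fst z) * g (snd z)) \<in> carrier (C0 (prod_topology X Y))"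
  unfolding C0_iff
proof (intro conjI allI impI)
  have "continuous_map (prod_topology X Y) euclidean (\<lambda>z. f (fst z))"
    "continuous_map (prod_topology X Y) euclidean (\<lambda>z. g (snd z))"
    using continuous_map_compose[OF continuous_map_fst, of X euclidean f Y]
      continuous_map_compose[OF continuous_map_snd, of Y euclidean g X] f g
    by (simp_all add: C0_iff o_def)
  then show "continuous_map (prod_topology X Y) euclidean (\<lambda>z. f (fst z) * g (snd z))"
    by (rule continuous_map_ring)
  show "f (fst z) * g (snd z) = 0" if "z \<notin> topspace (prod_topology X Y)" for z
    using that f g by (cases z) (auto simp: C0_iff)
  fix e :: real assume e: "e > 0"
  obtain M where M: "\<And>x. cmod (f x) \<le> M" using C0_bounded[OF f] unfolding bounded_iff by auto
  obtain N where N: "\<And>x. cmod (g x) \<le> N" using C0_bounded[OF g] unfolding bounded_iff by auto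
  have MN: "M \<ge> 0" "N \<ge> 0" using M N norm_ge_zero order_trans by blast+
  have "e / (N + 1) > 0" "e / (M + 1) > 0" using MN e by simp_all
  then obtain K L where K: "compactin X K" "\<And>x. x \<in> topspace X \<Longrightarrow> x \<notin> K \<Longrightarrow> cmod (f x) < e / (N + 1)"
    and L: "compactin Y L" "\<And>x. x \<in> topspace Y \<Longrightarrow> x \<notin> L \<Longrightarrow> cmod (g x) < e / (M + 1)"
    using f g unfolding C0_iff by meson
  have "cmod (f p * g q) < e" if pq: "p \<in> topspace X" "q \<in> topspace Y" "p \<notin> K \<or> q \<notin> L" for p q
    using pq(3)
  proof
    assume "p \<notin> K"
    have "cmod (f p * g q) \<le> cmod (f p) * (N + 1)"
      unfolding norm_mult using N[of q] by (intro mult_left_mono) auto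
    also have "\<dots> < e" using K(2)[OF pq(1) \<open>p \<notin> K\<close>] MN by (simp add: field_simps)
    finally show ?thesis .
  next
    assume "q \<notin> L"
    have "cmod (f p * g q) \<le> (M + 1) * cmod (g q)"
      unfolding norm_mult using M[of p] by (intro mult_right_mono) auto
    also have "\<dots> < e" using L(2)[OF pq(2) \<open>q \<notin> L\<close>] MN by (simp add: field_simps)
    finally show ?thesis .
  qed
  moreover have "compactin (prod_topology X Y) (K \<times> L)"
    using K L by (simp add: compactin_Times)
  ultimately show "\<exists>K. compactin (prod_topology X Y) K \<and>
      (\<forall>z\<in>topspace (prod_topology X Y). z \<notin> K \<longrightarrow> cmod (f (fst z) * g (snd z)) < e)"
    by (intro exI[of _ "K \<times> L"]) auto
qed

text \<open>The first variable is frozen at finitely many sample points \<open>k\<close>, so the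
  approximant is a sum of products of one-variable functions. Oscillation in the first variable has
  to be small uniformly in the second, which compactness of \<open>L\<close> provides.\<close>

lemma C0_prod_approx:
  fixes F :: "'x \<times> 'y \<Rightarrow> complex"
  assumes X: "locally_compact_space X" "Hausdorff_space X"
    and F: "F \<in> carrier (C0 (prod_topology X Y))" and e: "e > 0"
  obtains I and \<phi> :: "'x \<Rightarrow> 'x \<Rightarrow> complex" where "finite I"
    "\<And>k. k \<in> I \<Longrightarrow> \<phi> k \<in> carrier (C0 X)" "\<And>k. k \<in> I \<Longrightarrow> (\<lambda>y. F (k, y)) \<in> carrier (C0 Y)"
    "\<And>x y. cmod (F (x, y) - (\<Sum>k\<in>I. \<phi> k x * F (k, y))) \<le> e"
proof -
  have cover: "\<exists>K L. compactin X K \<and> compactin Y L \<and>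
    (\<forall>x y. x \<notin> K \<or> y \<notin> L \<longrightarrow> cmod (F (x, y)) < d)" if d: "d > 0" for d
  proof -
    obtain C where C: "compactin (prod_topology X Y) C"
      "\<And>z. z \<in> topspace (prod_topology X Y) \<Longrightarrow> z \<notin> C \<Longrightarrow> cmod (F z) < d"
      using F d unfolding C0_iff by meson
    have "compactin X (fst ` C)" "compactin Y (snd ` C)"
      using image_compactin[OF C(1)] continuous_map_fst continuous_map_snd by metis+
    moreover have "cmod (F (x, y)) < d" if "x \<notin> fst ` C \<or> y \<notin> snd ` C" for x y
      using that C(2)[of "(x, y)"] d F
      by (cases "(x, y) \<in> topspace (prod_topology X Y)") (force simp: C0_iff)+
    ultimately show ?thesis by blast
  qed
  have cF: "continuous_map (prod_topology X Y) euclidean F" using F by (simp add: C0_iff)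
  have slice: "(\<lambda>y. F (x, y)) \<in> carrier (C0 Y)" if x: "x \<in> topspace X" for x
    unfolding C0_iff
  proof (intro conjI allI impI)
    have "continuous_map Y (prod_topology X Y) (\<lambda>y. (x, y))"
      using x by (intro continuous_map_pairedI) auto
    from continuous_map_compose[OF this cF] show "continuous_map Y euclidean (\<lambda>y. F (x, y))"
      by (simp add: o_def)
    show "F (x, y) = 0" if "y \<notin> topspace Y" for y using that F by (auto simp: C0_iff)
    show "\<exists>K. compactin Y K \<and> (\<forall>y\<in>topspace Y. y \<notin> K \<longrightarrow> cmod (F (x, y)) < d)" if "d > 0" for d
      using cover[OF that] by blast
  qed
  obtain K L where K: "compactin X K" and L: "compactin Y L"
    and KL: "\<And>x y. x \<notin> K \<or> y \<notin> L \<Longrightarrow> cmod (F (x, y)) < e / 4"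
    using cover[of "e / 4"] e by auto
  have KX: "K \<subseteq> topspace X" using K compactin_subset_topspace by blast
  obtain I and \<phi> :: "'x \<Rightarrow> 'x \<Rightarrow> real" where I: "finite I" "I \<subseteq> K"
    and \<phi>: "\<And>k. k \<in> I \<Longrightarrow> (\<lambda>y. of_real (\<phi> k y)) \<in> carrier (C0 X)"
    "\<And>x j. j \<in> UNIV \<Longrightarrow> cmod (F (x, j) - (\<Sum>k\<in>I. of_real (\<phi> k x) * F (k, j))) \<le> 2 * \<bar>e / 2\<bar>"
  proof (rule C0_family_approx[OF X K, of UNIV "\<lambda>x j. F (x, j)" "e / 2"])
    show "cmod (F (x, j)) \<le> e / 2" if "x \<notin> K" for x j
      using KL[of x j] that e by auto
    fix x assume x: "x \<in> K"
    define W where "W = {w \<in> topspace (prod_topology X Y). F w - F (x, snd w) \<in> ball 0 (e / 2)}"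
    have "continuous_map (prod_topology X Y) euclidean (\<lambda>w. F (x, snd w))"
      using continuous_map_compose[OF continuous_map_snd, of Y euclidean "\<lambda>y. F (x, y)" X]
        slice[of x] x KX by (auto simp: C0_iff o_def)
    then have "continuous_map (prod_topology X Y) euclidean (\<lambda>w. F w - F (x, snd w))"
      using cF unfolding continuous_map_atin limitin_canonical_iff by (auto intro!: tendsto_intros)
    then have W: "openin (prod_topology X Y) W"
      unfolding W_def by (rule openin_continuous_map_preimage) auto
    have sub: "{x} \<times> L \<subseteq> W"
      using x KX compactin_subset_topspace[OF L] e by (auto simp: W_def)
    \<comment> \<open>Tube lemma: \<open>W\<close> contains \<open>{x} \<times> L\<close>, hence a
      product neighbourhood of it. For \<open>j\<close> off \<open>L\<close> both values are below
      \<open>e / 4\<close>, so their difference is below \<open>e / 2\<close>.\<close>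
    obtain U V where U: "openin X U" "x \<in> U" "L \<subseteq> V" "U \<times> V \<subseteq> W"
      by (rule Wallace_theorem_prod_topology[OF _ L W sub]) (use x KX in auto)
    have "cmod (F (y, j) - F (x, j)) \<le> e / 2" if y: "y \<in> U" for y j
    proof (cases "j \<in> L")
      case True
      then have "(y, j) \<in> W" using U y by blast
      then show ?thesis by (auto simp: W_def)
    next
      case False
      then show ?thesis
        using KL[of y j] KL[of x j] norm_triangle_ineq4[of "F (y, j)" "F (x, j)"] by force
    qed
    then show "\<exists>U. openin X U \<and> x \<in> U \<and> (\<forall>y\<in>U. \<forall>j\<in>UNIV. cmod (F (y, j) - F (x, j)) \<le> e / 2)"
      using U by blast
  qed (rule that)
  show thesis
    by (rule that[of I "\<lambda>k y. of_real (\<phi> k y)"]) (use I \<phi> slice KX e in auto)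
qed

section \<open>The minimal tensor product\<close>

lemma bilinear_form_add_left:
  assumes "bilinear_form (C0 X) (C0 Y) \<beta>"
    and "a \<in> carrier (C0 X)" "a' \<in> carrier (C0 X)" "b \<in> carrier (C0 Y)"
  shows "\<beta> (\<lambda>x. a x + a' x) b = \<beta> a b + \<beta> a' b"
  using assms unfolding bilinear_form_def by simp

text \<open>The coefficient \<open>d a'\<close> depends on the first entry of the pair: this is the
  shape that arises when a linear relation is solved for one of the second factors.\<close>

lemma bilinear_form_sum_right:
  assumes \<beta>: "bilinear_form (C0 X) (C0 Y) \<beta>" and a: "a \<in> carrier (C0 X)"
    and xs: "snd ` set xs \<subseteq> carrier (C0 Y)"
  shows "(\<lambda>q. \<Sum>(a', b')\<leftarrow>xs. d a' * b' q) \<in> carrier (C0 Y) \<and>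
    \<beta> a (\<lambda>q. \<Sum>(a', b')\<leftarrow>xs. d a' * b' q) = (\<Sum>(a', b')\<leftarrow>xs. d a' * \<beta> a b')"
  using xs
proof (induction xs)
  case Nil
  \<comment> \<open>That the form vanishes on the zero function comes from homogeneity with the
    scalar 0.\<close>
  have "\<beta> a (\<lambda>q. 0 * 0) = 0 * \<beta> a (\<lambda>q. 0)"
    using \<beta> a C0_closed(1)[of Y] unfolding bilinear_form_def by fastforce
  then show ?case by (simp add: C0_closed)
next
  case (Cons x xs)
  obtain a' b' where x: "x = (a', b')" by fastforce
  have b: "b' \<in> carrier (C0 Y)" "(\<lambda>q. d a' * b' q) \<in> carrier (C0 Y)"
    using Cons.prems by (auto simp: x C0_closed)
  let ?s = "\<lambda>q. \<Sum>(a', b')\<leftarrow>xs. d a' * b' q"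
  have s: "?s \<in> carrier (C0 Y)" "\<beta> a ?s = (\<Sum>(a', b')\<leftarrow>xs. d a' * \<beta> a b')"
    using Cons by auto
  have "\<beta> a (\<lambda>q. d a' * b' q + ?s q) = \<beta> a (\<lambda>q. d a' * b' q) + \<beta> a ?s"
    using \<beta> a b(2) s(1) unfolding bilinear_form_def by simp
  also have "\<beta> a (\<lambda>q. d a' * b' q) = d a' * \<beta> a b'"
    using \<beta> a b(1) unfolding bilinear_form_def by simp
  finally show ?case
    using C0_closed(2)[OF b(2) s(1)] s(2) by (simp add: x)
qed

text \<open>Elimination of one term. If the first factor \<open>a\<close> is nonzero at
  \<open>p0\<close>, evaluating the relation there expresses \<open>b\<close> through the other
  second factors; substituting leaves a vanishing sum of the terms
  \<open>(a' - c a' * a) \<otimes> b'\<close>, one fewer than before. Since the remaining terms are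
  altered, the induction runs over the length of the list.\<close>

lemma tensor_zero_bilinear_form:
  assumes \<beta>: "bilinear_form (C0 X) (C0 Y) \<beta>" and xs: "set xs \<subseteq> carrier (C0 X) \<times> carrier (C0 Y)"
    and zero: "\<And>p q. (\<Sum>(a, b)\<leftarrow>xs. a p * b q) = 0"
  shows "(\<Sum>(a, b)\<leftarrow>xs. \<beta> a b) = 0"
  using xs zero
proof (induction "length xs" arbitrary: xs)
  case (Suc n)
  then obtain a b ys where xs: "xs = (a, b) # ys" by (metis length_Suc_conv prod.exhaust)
  have a: "a \<in> carrier (C0 X)" and b: "b \<in> carrier (C0 Y)"
    and ys: "set ys \<subseteq> carrier (C0 X) \<times> carrier (C0 Y)"
    using Suc.prems by (auto simp: xs)
  have zero: "a p * b q + (\<Sum>(a', b')\<leftarrow>ys. a' p * b' q) = 0" for p q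
    using Suc.prems(2)[of p q] by (simp add: xs)
  show ?case
  proof (cases "\<forall>p. a p = 0")
    case True
    have "\<beta> (\<lambda>p. 0 * a p) b = 0 * \<beta> a b"
      using \<beta> a b unfolding bilinear_form_def C0_simps by blast
    moreover have "(\<lambda>p. 0 * a p) = a" using True by auto
    ultimately have "\<beta> a b = 0" by simp
    moreover have "(\<Sum>(a, b)\<leftarrow>ys. \<beta> a b) = 0"
      using zero Suc.hyps(2) ys True by (intro Suc.hyps(1)) (auto simp: xs)
    ultimately show ?thesis by (simp add: xs)
  next
    case False
    then obtain p0 where p0: "a p0 \<noteq> 0" by blast
    define c where "c a' = a' p0 / a p0" for a' :: "'a \<Rightarrow> complex"
    let ?s = "\<lambda>q. \<Sum>(a', b')\<leftarrow>ys. - c a' * b' q"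
    have bs: "b = ?s"
    proof
      fix q
      have "?s q = (\<Sum>y\<leftarrow>ys. (- 1 / a p0) * (case y of (a', b') \<Rightarrow> a' p0 * b' q))"
        by (intro arg_cong[where f = sum_list] map_cong) (auto simp: c_def)
      also have "\<dots> = (- 1 / a p0) * (\<Sum>(a', b')\<leftarrow>ys. a' p0 * b' q)"
        by (rule sum_list_const_mult)
      also have "(\<Sum>(a', b')\<leftarrow>ys. a' p0 * b' q) = - (a p0 * b q)"
        using zero[of p0 q] by (simp add: eq_neg_iff_add_eq_0 add.commute)
      finally show "b q = ?s q" using p0 by simp
    qed
    have sub: "snd ` set ys \<subseteq> carrier (C0 Y)" using ys by auto
    have \<beta>b: "\<beta> a b = (\<Sum>(a', b')\<leftarrow>ys. - c a' * \<beta> a b')"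
      using bilinear_form_sum_right[OF \<beta> a sub, of "\<lambda>a'. - c a'"] bs by simp
    define f where "f = (\<lambda>(a', b' :: 'b \<Rightarrow> complex). (\<lambda>p. a' p + - c a' * a p, b'))"
    have "(\<Sum>(a, b)\<leftarrow>map f ys. \<beta> a b) = 0"
    proof (rule Suc.hyps(1))
      show "n = length (map f ys)" using Suc.hyps(2) by (simp add: xs)
      show "set (map f ys) \<subseteq> carrier (C0 X) \<times> carrier (C0 Y)"
        using ys by (auto simp: f_def intro!: C0_diff C0_closed(5) a)
      show "(\<Sum>(a, b)\<leftarrow>map f ys. a p * b q) = 0" for p q
      proof -
        have "(\<Sum>(a, b)\<leftarrow>map f ys. a p * b q) =
          (\<Sum>y\<leftarrow>ys. (case y of (a', b') \<Rightarrow> a' p * b' q) + a p * (case y of (a', b') \<Rightarrow> - c a' * b' q))"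
          unfolding map_map
          by (intro arg_cong[where f = sum_list] map_cong) (auto simp: f_def algebra_simps)
        also have "\<dots> = (\<Sum>(a', b')\<leftarrow>ys. a' p * b' q) + a p * ?s q"
          by (simp add: sum_list_addf sum_list_const_mult)
        also have "\<dots> = 0" using zero[of p q] bs by (metis add.commute)
        finally show ?thesis .
      qed
    qed
    also have "(\<Sum>(a, b)\<leftarrow>map f ys. \<beta> a b) =
      (\<Sum>y\<leftarrow>ys. (case y of (a', b') \<Rightarrow> \<beta> a' b') + (case y of (a', b') \<Rightarrow> - c a' * \<beta> a b'))"
      unfolding map_map
    proof (intro arg_cong[where f = sum_list] map_cong refl)
      fix y assume "y \<in> set ys"
      then obtain a' b' where y: "y = (a', b')" "a' \<in> carrier (C0 X)" "b' \<in> carrier (C0 Y)"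
        using ys by blast
      have "\<beta> (\<lambda>p. a' p + - c a' * a p) b' = \<beta> a' b' + \<beta> (\<lambda>p. - c a' * a p) b'"
        by (rule bilinear_form_add_left[OF \<beta> y(2) C0_closed(5)[OF a] y(3)])
      also have "\<beta> (\<lambda>p. - c a' * a p) b' = - c a' * \<beta> a b'"
        using \<beta> y a unfolding bilinear_form_def C0_simps by blast
      finally show "((\<lambda>(a, b). \<beta> a b) \<circ> f) y =
        (case y of (a', b') \<Rightarrow> \<beta> a' b') + (case y of (a', b') \<Rightarrow> - c a' * \<beta> a b')"
        by (simp add: y f_def)
    qed
    also have "\<dots> = (\<Sum>(a', b')\<leftarrow>ys. \<beta> a' b') + \<beta> a b"
      unfolding \<beta>b by (simp add: sum_list_addf)
    finally show ?thesis by (simp add: xs add.commute)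
  qed
qed simp

section \<open>Multipliers are bounded for every C*-norm\<close>

lemma cstar_norm_on_C0:
  assumes "cstar_norm_on (C0 Z) S p" "x \<in> S"
  shows "y \<in> S \<Longrightarrow> p (\<lambda>z. x z + y z) \<le> p x + p y"
    and "p (\<lambda>z. c * x z) = cmod c * p x"
    and "p (\<lambda>z. cnj (x z)) = p x" "p (\<lambda>z. cnj (x z) * x z) = (p x)\<^sup>2" "0 \<le> p x"
    and "p x = 0 \<longleftrightarrow> x = (\<lambda>z. 0)"
    and "y \<in> S \<Longrightarrow> p (\<lambda>z. x z * y z) \<le> p x * p y"
  using assms unfolding cstar_norm_on_def by simp_all

text \<open>A contraction \<open>u\<close> with real values is the average of the unitary \<open>u + \<i> \<surd>(1 - u\<^sup>2)\<close> and its
  adjoint, and unitary multipliers are isometric for a C*-norm.\<close>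

lemma cstar_norm_real_multiplier:
  fixes S :: "('z \<Rightarrow> complex) set" and u :: "'z \<Rightarrow> real"
  assumes p: "cstar_norm_on (C0 Z) S p"
    and star: "\<And>x. x \<in> S \<Longrightarrow> (\<lambda>z. cnj (x z)) \<in> S"
    and scale: "\<And>c x. x \<in> S \<Longrightarrow> (\<lambda>z. c * x z) \<in> S"
    and u: "\<And>z. \<bar>u z\<bar> \<le> 1"
    and w: "\<And>x. x \<in> S \<Longrightarrow> (\<lambda>z. Complex (u z) (sqrt (1 - (u z)\<^sup>2)) * x z) \<in> S"
    and x: "x \<in> S"
  shows "p (\<lambda>z. of_real (u z) * x z) \<le> p x"
proof -
  define w where "w z = Complex (u z) (sqrt (1 - (u z)\<^sup>2))" for z
  have wS: "(\<lambda>z. w z * y z) \<in> S" if "y \<in> S" for y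
    using w[OF that] by (simp add: w_def)
  have cww: "cnj (w z) * w z = 1" for z
  proof -
    have "1 - (u z)\<^sup>2 \<ge> 0" using u[of z] by (simp add: abs_square_le_1)
    then show ?thesis by (simp add: w_def complex_eq_iff power2_eq_square)
  qed
  have p_star: "p (\<lambda>z. cnj (y z)) = p y" and p_sq: "p (\<lambda>z. cnj (y z) * y z) = (p y)\<^sup>2"
    and p_nn: "0 \<le> p y" if "y \<in> S" for y
    by (rule cstar_norm_on_C0[OF p that])+
  have iso: "p (\<lambda>z. w z * y z) = p y" if y: "y \<in> S" for y
  proof -
    have "(\<lambda>z. cnj (w z * y z) * (w z * y z)) = (\<lambda>z. cnj (w z) * w z * (cnj (y z) * y z))"
      by (auto simp: mult_ac)
    then have "(p (\<lambda>z. w z * y z))\<^sup>2 = (p y)\<^sup>2"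
      using p_sq[OF wS[OF y]] p_sq[OF y] unfolding cww by simp
    then show ?thesis
      using p_nn[OF wS[OF y]] p_nn[OF y] by (simp add: power2_eq_iff_nonneg)
  qed
  \<comment> \<open>Multiplication by \<open>cnj w\<close> is multiplication by \<open>w\<close>
    between two adjoints, so closure and isometry carry over.\<close>
  have ws: "(\<lambda>z. cnj (w z) * x z) \<in> S" "p (\<lambda>z. cnj (w z) * x z) = p x"
    using star[OF wS[OF star[OF x]]] p_star[OF wS[OF star[OF x]]] iso[OF star[OF x]] p_star[OF x]
    by simp_all
  have eq: "(\<lambda>z. of_real (u z) * x z) = (\<lambda>z. (1/2) * (w z * x z) + (1/2) * (cnj (w z) * x z))"
  proof
    fix z
    have "of_real (u z) = (1/2) * (w z + cnj (w z))"
      by (simp add: w_def complex_eq_iff)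
    then show "of_real (u z) * x z = (1/2) * (w z * x z) + (1/2) * (cnj (w z) * x z)"
      by (simp add: algebra_simps)
  qed
  have "p (\<lambda>z. (1/2) * (w z * x z) + (1/2) * (cnj (w z) * x z)) \<le>
    p (\<lambda>z. (1/2) * (w z * x z)) + p (\<lambda>z. (1/2) * (cnj (w z) * x z))"
    by (rule cstar_norm_on_C0(1)[OF p scale[OF wS[OF x]] scale[OF ws(1)]])
  moreover have "p (\<lambda>z. (1/2) * (w z * x z)) = p x / 2"
    unfolding cstar_norm_on_C0(2)[OF p wS[OF x]] iso[OF x] by simp
  moreover have "p (\<lambda>z. (1/2) * (cnj (w z) * x z)) = p x / 2"
    unfolding cstar_norm_on_C0(2)[OF p ws(1)] ws(2) by simp
  ultimately show ?thesis unfolding eq by linarith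
qed

text \<open>The C*-identity reduces a complex multiplier to a real one: the square of
  \<open>p (v * x)\<close> is the norm of the adjoint of \<open>x\<close> times \<open>x\<close>,
  multiplied by |v|^2, and \<open>u\<close>, which is |v|^2 divided by c^2, is a real contraction.
  \<open>M\<close> is stated for all continuous functions of \<open>v\<close> because both
  \<open>u\<close> and the unitary built from \<open>u\<close> are of this form.\<close>

lemma cstar_norm_multiplier:
  fixes S :: "('z \<Rightarrow> complex) set" and v :: "'z \<Rightarrow> complex"
  assumes p: "cstar_norm_on (C0 Z) S p"
    and star: "\<And>x. x \<in> S \<Longrightarrow> (\<lambda>z. cnj (x z)) \<in> S"
    and scale: "\<And>c x. x \<in> S \<Longrightarrow> (\<lambda>z. c * x z) \<in> S"
    and mult: "\<And>x y. x \<in> S \<Longrightarrow> y \<in> S \<Longrightarrow> (\<lambda>z. x z * y z) \<in> S"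
    and v: "\<And>z. cmod (v z) \<le> c" and c: "c > 0"
    and M: "\<And>h x. continuous_on UNIV h \<Longrightarrow> bounded (range (\<lambda>z. h (v z))) \<Longrightarrow> x \<in> S \<Longrightarrow>
      (\<lambda>z. h (v z) * x z) \<in> S"
    and x: "x \<in> S"
  shows "p (\<lambda>z. v z * x z) \<le> c * p x"
proof -
  define u where "u z = (cmod (v z))\<^sup>2 / c\<^sup>2" for z
  have u: "0 \<le> u z" "u z \<le> 1" for z
    using v[of z] c by (auto simp: u_def power_mono divide_le_eq)
  have p_sq: "p (\<lambda>z. cnj (y z) * y z) = (p y)\<^sup>2" and p_nn: "0 \<le> p y" if "y \<in> S" for y
    by (rule cstar_norm_on_C0[OF p that])+
  have vx: "(\<lambda>z. v z * x z) \<in> S"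
    using M[of "\<lambda>s. s"] x bounded_rangeI[of v c] v by simp
  have xx: "(\<lambda>z. cnj (x z) * x z) \<in> S" by (rule mult[OF star[OF x] x])
  have ux: "(\<lambda>z. of_real (u z) * (cnj (x z) * x z)) \<in> S"
    unfolding u_def
  proof (rule M[OF _ _ xx, of "\<lambda>s. of_real ((cmod s)\<^sup>2 / c\<^sup>2)"])
    show "continuous_on UNIV (\<lambda>s. complex_of_real ((cmod s)\<^sup>2 / c\<^sup>2))"
      using c by (auto intro!: continuous_intros)
    have "cmod (of_real (u z)) \<le> 1" for z using u[of z] by (simp only: norm_of_real)
    then show "bounded (range (\<lambda>z. complex_of_real ((cmod (v z))\<^sup>2 / c\<^sup>2)))"
      unfolding u_def by (rule bounded_rangeI)
  qed
  have "(p (\<lambda>z. v z * x z))\<^sup>2 = p (\<lambda>z. cnj (v z * x z) * (v z * x z))"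
    using p_sq[OF vx] by simp
  also have "(\<lambda>z. cnj (v z * x z) * (v z * x z)) =
    (\<lambda>z. of_real (c\<^sup>2) * (of_real (u z) * (cnj (x z) * x z)))"
  proof
    fix z
    have "cnj (v z) * v z = of_real ((cmod (v z))\<^sup>2)"
      by (metis complex_norm_square mult.commute)
    then show "cnj (v z * x z) * (v z * x z) = of_real (c\<^sup>2) * (of_real (u z) * (cnj (x z) * x z))"
      using c by (simp add: u_def field_simps)
  qed
  also have "p \<dots> = cmod (of_real (c\<^sup>2)) * p (\<lambda>z. of_real (u z) * (cnj (x z) * x z))"
    by (rule cstar_norm_on_C0(2)[OF p ux])
  also have "\<dots> \<le> cmod (of_real (c\<^sup>2)) * p (\<lambda>z. cnj (x z) * x z)"
  proof (intro mult_left_mono cstar_norm_real_multiplier[OF p star scale _ _ xx])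
    show "(\<lambda>z. Complex (u z) (sqrt (1 - (u z)\<^sup>2)) * y z) \<in> S" if "y \<in> S" for y
      unfolding u_def
    \<comment> \<open>\<open>sqrt\<close> is continuous on the whole real line, so this formula is
      continuous on the whole plane, also where the radicand is negative; a bound is only required
      on the range of \<open>v\<close>.\<close>
    proof (rule M[OF _ _ that, of "\<lambda>s. Complex ((cmod s)\<^sup>2 / c\<^sup>2) (sqrt (1 - ((cmod s)\<^sup>2 / c\<^sup>2)\<^sup>2))"])
      show "continuous_on UNIV (\<lambda>s. Complex ((cmod s)\<^sup>2 / c\<^sup>2) (sqrt (1 - ((cmod s)\<^sup>2 / c\<^sup>2)\<^sup>2)))"
        unfolding continuous_on_def using c by (auto intro!: tendsto_intros)
      have "cmod (Complex (u z) (sqrt (1 - (u z)\<^sup>2))) \<le> 1" for z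
      proof -
        have "(u z)\<^sup>2 \<le> 1" using u[of z] by (simp add: power_le_one)
        then show ?thesis by (simp add: cmod_def)
      qed
      then show "bounded (range (\<lambda>z. Complex ((cmod (v z))\<^sup>2 / c\<^sup>2) (sqrt (1 - ((cmod (v z))\<^sup>2 / c\<^sup>2)\<^sup>2))))"
        unfolding u_def by (rule bounded_rangeI)
    qed
  qed (use u in auto)
  also have "\<dots> = (c * p x)\<^sup>2"
    unfolding p_sq[OF x] norm_of_real by (simp add: power_mult_distrib)
  finally show ?thesis
    by (rule power2_le_imp_le) (use p_nn[OF x] c in simp)
qed

text \<open>\<open>Z\<close> is a homeomorphic copy of the product, so that the left-bracketed
  triple product can live on the same space as the right-bracketed one. \<open>off\<close> makes
  elementary tensors vanish outside \<open>Z\<close>.\<close>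

locale C0_tensor_product =
  fixes X :: "'x topology" and Y :: "'y topology" and Z :: "'z topology"
    and \<pi>\<^sub>1 :: "'z \<Rightarrow> 'x" and \<pi>\<^sub>2 :: "'z \<Rightarrow> 'y"
  assumes X: "locally_compact_space X" "Hausdorff_space X"
    and Y: "locally_compact_space Y" "Hausdorff_space Y"
    and homeo: "homeomorphic_map Z (prod_topology X Y) (\<lambda>z. (\<pi>\<^sub>1 z, \<pi>\<^sub>2 z))"
    and off: "z \<notin> topspace Z \<Longrightarrow> \<pi>\<^sub>1 z \<notin> topspace X \<or> \<pi>\<^sub>2 z \<notin> topspace Y"
begin

definition tens :: "('x \<Rightarrow> complex) \<Rightarrow> ('y \<Rightarrow> complex) \<Rightarrow> 'z \<Rightarrow> complex" where
  "tens f g = (\<lambda>z. f (\<pi>\<^sub>1 z) * g (\<pi>\<^sub>2 z))"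

abbreviation S :: "('z \<Rightarrow> complex) set" where
  "S \<equiv> alg_tensor (C0 X) (C0 Y) (C0 Z) tens"

lemma tens_C0:
  assumes "f \<in> carrier (C0 X)" "g \<in> carrier (C0 Y)"
  shows "tens f g \<in> carrier (C0 Z)"
  using C0_compose[OF C0_tensor[OF assms] homeo] off by (auto simp: tens_def)

lemma S_eq: "S = {\<lambda>z. \<Sum>(a, b)\<leftarrow>xs. tens a b z | xs. set xs \<subseteq> carrier (C0 X) \<times> carrier (C0 Y)}"
  unfolding alg_tensor_def by simp

lemma S_induct [consumes 1, case_names zero add]:
  assumes "x \<in> S" "P (\<lambda>z. 0)"
    "\<And>a b x. a \<in> carrier (C0 X) \<Longrightarrow> b \<in> carrier (C0 Y) \<Longrightarrow> x \<in> S \<Longrightarrow> P x \<Longrightarrow> P (\<lambda>z. tens a b z + x z)"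
  shows "P x"
proof -
  obtain xs where "set xs \<subseteq> carrier (C0 X) \<times> carrier (C0 Y)" "x = (\<lambda>z. \<Sum>(a, b)\<leftarrow>xs. tens a b z)"
    using assms(1) unfolding S_eq by blast
  then show ?thesis
  proof (induction xs arbitrary: x)
    case Nil
    then show ?case using assms(2) by simp
  next
    case (Cons y ys)
    obtain a b where y: "y = (a, b)" by fastforce
    let ?x = "\<lambda>z. \<Sum>(a, b)\<leftarrow>ys. tens a b z"
    have "?x \<in> S" using Cons.prems unfolding S_eq by auto
    moreover have "P ?x" using Cons by simp
    ultimately show ?case
      using assms(3)[of a b ?x] Cons.prems by (simp add: y)
  qed
qed

lemma S_zero: "(\<lambda>z. 0) \<in> S"
  unfolding S_eq by (auto intro: exI[of _ "[]"])

lemma S_tens_add: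
  assumes "a \<in> carrier (C0 X)" "b \<in> carrier (C0 Y)" "x \<in> S"
  shows "(\<lambda>z. tens a b z + x z) \<in> S"
proof -
  obtain xs where "set xs \<subseteq> carrier (C0 X) \<times> carrier (C0 Y)" "x = (\<lambda>z. \<Sum>(a, b)\<leftarrow>xs. tens a b z)"
    using assms(3) unfolding S_eq by blast
  then show ?thesis
    using assms unfolding S_eq by (auto intro!: exI[of _ "(a, b) # xs"])
qed

lemma S_tens: "a \<in> carrier (C0 X) \<Longrightarrow> b \<in> carrier (C0 Y) \<Longrightarrow> tens a b \<in> S"
  using S_tens_add[OF _ _ S_zero] by simp

lemma S_add: "x \<in> S \<Longrightarrow> y \<in> S \<Longrightarrow> (\<lambda>z. x z + y z) \<in> S"
  by (induction rule: S_induct) (auto simp: add.assoc intro: S_tens_add)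

lemma S_mult_left:
  assumes "x \<in> S" and "\<And>a b. a \<in> carrier (C0 X) \<Longrightarrow> b \<in> carrier (C0 Y) \<Longrightarrow> (\<lambda>z. u z * tens a b z) \<in> S"
  shows "(\<lambda>z. u z * x z) \<in> S"
  using assms(1) by (induction rule: S_induct) (auto simp: distrib_left S_zero intro: S_add assms(2))

text \<open>A bounded continuous function of one variable is absorbed into one tensor factor. A
  function of both variables would in general lead out of \<open>S\<close>, so these are the
  multipliers available for norm estimates.\<close>

lemma S_mult1:
  assumes "x \<in> S" "continuous_map X euclidean u" "\<And>s. cmod (u s) \<le> c"
  shows "(\<lambda>z. u (\<pi>\<^sub>1 z) * x z) \<in> S"
proof (rule S_mult_left[OF assms(1)])
  fix a b assume "a \<in> carrier (C0 X)" "b \<in> carrier (C0 Y)"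
  from S_tens[OF C0_multiplier[OF this(1) assms(2,3)] this(2)]
  show "(\<lambda>z. u (\<pi>\<^sub>1 z) * tens a b z) \<in> S" by (simp add: tens_def mult.assoc)
qed

lemma S_mult2:
  assumes "x \<in> S" "continuous_map Y euclidean u" "\<And>s. cmod (u s) \<le> c"
  shows "(\<lambda>z. u (\<pi>\<^sub>2 z) * x z) \<in> S"
proof (rule S_mult_left[OF assms(1)])
  fix a b assume "a \<in> carrier (C0 X)" "b \<in> carrier (C0 Y)"
  from S_tens[OF this(1) C0_multiplier[OF this(2) assms(2,3)]]
  show "(\<lambda>z. u (\<pi>\<^sub>2 z) * tens a b z) \<in> S" by (simp add: tens_def mult.left_commute)
qed

lemma S_scale: "x \<in> S \<Longrightarrow> (\<lambda>z. c * x z) \<in> S"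
  using S_mult1[of x "\<lambda>_. c" "cmod c"] by simp

lemma S_mult:
  assumes "x \<in> S" "y \<in> S"
  shows "(\<lambda>z. x z * y z) \<in> S"
proof (rule S_mult_left[OF assms(2)])
  fix a b assume ab: "a \<in> carrier (C0 X)" "b \<in> carrier (C0 Y)"
  have "(\<lambda>z. tens a b z * x z) \<in> S"
  proof (rule S_mult_left[OF assms(1)])
    fix a' b' assume "a' \<in> carrier (C0 X)" "b' \<in> carrier (C0 Y)"
    then show "(\<lambda>z. tens a b z * tens a' b' z) \<in> S"
      using S_tens[OF C0_closed(3)[OF ab(1)] C0_closed(3)[OF ab(2)], of a' b']
      by (simp add: tens_def mult_ac)
  qed
  then show "(\<lambda>z. x z * tens a b z) \<in> S" by (simp add: mult.commute)
qed

lemma tens_star: "tens (\<lambda>x. cnj (a x)) (\<lambda>y. cnj (b y)) z = cnj (tens a b z)"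
  by (simp add: tens_def)

lemma S_star: "x \<in> S \<Longrightarrow> (\<lambda>z. cnj (x z)) \<in> S"
proof (induction rule: S_induct)
  case (add a b x)
  then show ?case
    using S_tens_add[OF C0_closed(4)[OF add(1)] C0_closed(4)[OF add(2)] add(4)]
    by (simp add: tens_star)
qed (simp add: S_zero)

lemma S_sum:
  assumes "finite I" "\<And>k. k \<in> I \<Longrightarrow> a k \<in> carrier (C0 X)" "\<And>k. k \<in> I \<Longrightarrow> b k \<in> carrier (C0 Y)"
  shows "(\<lambda>z. \<Sum>k\<in>I. tens (a k) (b k) z) \<in> S"
  using assms by (induction I) (auto simp: S_zero intro!: S_tens_add)

lemma S_C0: "x \<in> S \<Longrightarrow> x \<in> carrier (C0 Z)"
  by (induction rule: S_induct) (auto intro: C0_closed tens_C0)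

text \<open>The inverse homeomorphism carries \<open>F\<close> to the product, where
  \<open>C0_prod_approx\<close> applies; its approximant is a sum of elementary tensors with slices
  as second factors.\<close>

lemma S_dense: "dense_in (C0 Z) S"
  unfolding dense_in_def
proof (intro conjI ballI allI impI)
  show "S \<subseteq> carrier (C0 Z)" using S_C0 by blast
  fix F :: "'z \<Rightarrow> complex" and e :: real assume F: "F \<in> carrier (C0 Z)" and e: "e > 0"
  obtain g where "homeomorphic_maps Z (prod_topology X Y) (\<lambda>z. (\<pi>\<^sub>1 z, \<pi>\<^sub>2 z)) g"
    using homeo homeomorphic_map_maps by blast
  then have g: "homeomorphic_map (prod_topology X Y) Z g"
    and gh: "\<And>z. z \<in> topspace Z \<Longrightarrow> g (\<pi>\<^sub>1 z, \<pi>\<^sub>2 z) = z"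
    by (auto simp: homeomorphic_maps_map)
  define F' where "F' w = (if w \<in> topspace (prod_topology X Y) then F (g w) else 0)" for w
  have F': "F' \<in> carrier (C0 (prod_topology X Y))"
    unfolding F'_def by (rule C0_compose_homeomorphic[OF F g])
  have FF': "F z = F' (\<pi>\<^sub>1 z, \<pi>\<^sub>2 z)" for z
  proof (cases "z \<in> topspace Z")
    case True
    then have "(\<pi>\<^sub>1 z, \<pi>\<^sub>2 z) \<in> topspace (prod_topology X Y)"
      using homeomorphic_imp_surjective_map[OF homeo] by blast
    then show ?thesis using gh[OF True] unfolding F'_def by simp
  qed (use off F in \<open>auto simp: F'_def C0_iff\<close>)
  have e2: "e / 2 > 0" using e by simp
  obtain I and \<phi> :: "'x \<Rightarrow> 'x \<Rightarrow> complex" where I: "finite I"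
    "\<And>k. k \<in> I \<Longrightarrow> \<phi> k \<in> carrier (C0 X)" "\<And>k. k \<in> I \<Longrightarrow> (\<lambda>y. F' (k, y)) \<in> carrier (C0 Y)"
    "\<And>x y. cmod (F' (x, y) - (\<Sum>k\<in>I. \<phi> k x * F' (k, y))) \<le> e / 2"
    using C0_prod_approx[OF X F' e2, where thesis = thesis] by blast
  let ?s = "\<lambda>z. \<Sum>k\<in>I. tens (\<phi> k) (\<lambda>y. F' (k, y)) z"
  have s: "?s \<in> S" using I by (intro S_sum)
  have "(SUP z. cmod (F z - ?s z)) \<le> e / 2"
    using I(4) by (intro sup_norm_le) (simp add: FF' tens_def)
  then show "\<exists>s\<in>S. normA (C0 Z) (diffA (C0 Z) F s) < e"
    using s e by (intro bexI[of _ ?s]) auto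
qed

section \<open>Minimality of the supremum norm\<close>

lemma S_cstar_norm_leg1:
  assumes p: "cstar_norm_on (C0 Z) S p" and x: "x \<in> S"
    and u: "continuous_map X euclidean u" "\<And>s. cmod (u s) \<le> c" "c > 0"
  shows "p (\<lambda>z. u (\<pi>\<^sub>1 z) * x z) \<le> c * p x"
proof (rule cstar_norm_multiplier[OF p _ _ _ _ u(3)])
  fix h :: "complex \<Rightarrow> complex" and y assume h: "continuous_on UNIV h" "bounded (range (\<lambda>z. h (u (\<pi>\<^sub>1 z))))" and y: "y \<in> S"
  \<comment> \<open>\<open>S_mult1\<close> needs a bound on \<open>h (u s)\<close> for every
    \<open>s\<close>, not only on the range of \<open>\<pi>\<^sub>1\<close>. All values of
    \<open>u\<close> lie in a compact disc, on which \<open>h\<close> is bounded.\<close>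
  have "compact (cball 0 c :: complex set)" by simp
  then have "bounded (h ` cball 0 c)"
    using h(1) by (meson compact_continuous_image compact_imp_bounded continuous_on_subset subset_UNIV)
  then obtain d where "\<And>s. cmod (h (u s)) \<le> d"
    using u(2) unfolding bounded_iff by (metis imageI mem_cball_0)
  moreover have "continuous_map X euclidean (\<lambda>s. h (u s))"
    using continuous_map_compose[OF u(1), of euclidean h] h(1) by (simp add: o_def)
  ultimately show "(\<lambda>z. h (u (\<pi>\<^sub>1 z)) * y z) \<in> S" using S_mult1[OF y] by blast
qed (auto simp: S_star S_scale S_mult u x)

lemma S_cstar_norm_leg2:
  assumes p: "cstar_norm_on (C0 Z) S p" and x: "x \<in> S"
    and u: "continuous_map Y euclidean u" "\<And>s. cmod (u s) \<le> c" "c > 0"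
  shows "p (\<lambda>z. u (\<pi>\<^sub>2 z) * x z) \<le> c * p x"
proof (rule cstar_norm_multiplier[OF p _ _ _ _ u(3)])
  fix h :: "complex \<Rightarrow> complex" and y assume h: "continuous_on UNIV h" "bounded (range (\<lambda>z. h (u (\<pi>\<^sub>2 z))))" and y: "y \<in> S"
  have "compact (cball 0 c :: complex set)" by simp
  then have "bounded (h ` cball 0 c)"
    using h(1) by (meson compact_continuous_image compact_imp_bounded continuous_on_subset subset_UNIV)
  then obtain d where "\<And>s. cmod (h (u s)) \<le> d"
    using u(2) unfolding bounded_iff by (metis imageI mem_cball_0)
  moreover have "continuous_map Y euclidean (\<lambda>s. h (u s))"
    using continuous_map_compose[OF u(1), of euclidean h] h(1) by (simp add: o_def)
  ultimately show "(\<lambda>z. h (u (\<pi>\<^sub>2 z)) * y z) \<in> S" using S_mult2[OF y] by blast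
qed (auto simp: S_star S_scale S_mult u x)

text \<open>Multiplication by \<open>x\<close> acts on an elementary tensor concentrated near \<open>z\<close> almost as the scalar
  \<open>x z\<close>.\<close>

lemma S_localise:
  assumes p: "cstar_norm_on (C0 Z) S p" and x: "x \<in> S" and z0: "z0 \<in> topspace Z" and e: "e > 0"
  shows "\<exists>U V. openin X U \<and> \<pi>\<^sub>1 z0 \<in> U \<and> openin Y V \<and> \<pi>\<^sub>2 z0 \<in> V \<and>
    (\<forall>a\<in>carrier (C0 X). \<forall>b\<in>carrier (C0 Y). (\<forall>s. s \<notin> U \<longrightarrow> a s = 0) \<longrightarrow> (\<forall>t. t \<notin> V \<longrightarrow> b t = 0) \<longrightarrow>
      p (\<lambda>z. (x z - x z0) * tens a b z) \<le> e * p (tens a b))"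
  using x e
proof (induction arbitrary: e rule: S_induct)
  case zero
  have p0: "p (\<lambda>z. 0) = 0" using cstar_norm_on_C0(6)[OF p S_zero] by simp
  have "\<pi>\<^sub>1 z0 \<in> topspace X" "\<pi>\<^sub>2 z0 \<in> topspace Y"
    using z0 homeomorphic_imp_surjective_map[OF homeo] by auto
  moreover have "0 \<le> e * p (tens a b)" if "a \<in> carrier (C0 X)" "b \<in> carrier (C0 Y)" for a b
    using cstar_norm_on_C0(5)[OF p S_tens[OF that]] zero by simp
  ultimately show ?case
    by (intro exI[of _ "topspace X"] exI[of _ "topspace Y"]) (auto simp: p0)
next
  case (add f g x)
  note f = add(1) and g = add(2) and x = add(3) and e = add(5)
  have mem: "\<pi>\<^sub>1 z0 \<in> topspace X" "\<pi>\<^sub>2 z0 \<in> topspace Y"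
    using z0 homeomorphic_imp_surjective_map[OF homeo] by auto
  obtain U V where U: "openin X U" "\<pi>\<^sub>1 z0 \<in> U" and V: "openin Y V" "\<pi>\<^sub>2 z0 \<in> V"
    and UV: "\<And>a b. a\<in>carrier (C0 X) \<Longrightarrow> b\<in>carrier (C0 Y) \<Longrightarrow> (\<forall>s. s \<notin> U \<longrightarrow> a s = 0) \<Longrightarrow>
      (\<forall>t. t \<notin> V \<longrightarrow> b t = 0) \<Longrightarrow> p (\<lambda>z. (x z - x z0) * tens a b z) \<le> e / 2 * p (tens a b)"
    using add(4)[of "e / 2"] e by auto
  obtain M where M: "\<And>s. cmod (f s) \<le> M" using C0_bounded[OF f] unfolding bounded_iff by auto
  obtain N where N: "\<And>s. cmod (g s) \<le> N" using C0_bounded[OF g] unfolding bounded_iff by auto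
  have MN: "M \<ge> 0" "N \<ge> 0" using M N norm_ge_zero order_trans by blast+
  \<comment> \<open>The variation of \<open>f\<close> costs \<open>d1 * (N + 1)\<close> and that of
    \<open>g\<close> costs \<open>(M + 1) * d2\<close>, each \<open>e / 4\<close>; the remaining
    \<open>e / 2\<close> goes to the induction hypothesis.\<close>
  define d1 d2 where "d1 = e / (4 * (N + 1))" and "d2 = e / (4 * (M + 1))"
  have d: "d1 > 0" "d2 > 0" using e MN by (auto simp: d1_def d2_def)
  let ?f0 = "f (\<pi>\<^sub>1 z0)" and ?g0 = "g (\<pi>\<^sub>2 z0)"
  \<comment> \<open>Radial retraction onto the disc of radius \<open>r\<close>. It turns
    \<open>f - ?f0\<close> into a multiplier that is small everywhere and unchanged on the support
    of \<open>a\<close>; multiplier norms are bounded only through a global supremum.\<close>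
  define cut :: "real \<Rightarrow> complex \<Rightarrow> complex" where "cut r w = w * of_real (r / max r (cmod w))" for r w
  have cut_le: "cmod (cut r w) \<le> r" if "r > 0" for r w
    using that unfolding cut_def norm_mult norm_of_real by (auto simp: max_def field_simps)
  have cut_id: "cut r w = w" if "r > 0" "cmod w \<le> r" for r w
    using that by (simp add: cut_def max_def)
  have cut_cont: "continuous_map T euclidean (\<lambda>s. cut r (k s - c))"
    if "r > 0" "continuous_map T euclidean k" for r c and T :: "'t topology" and k
    using that unfolding continuous_map_atin limitin_canonical_iff cut_def
    by (auto intro!: tendsto_intros tendsto_max)
  define u where "u s = cut d1 (f s - ?f0)" for s
  define v where "v t = cut d2 (g t - ?g0)" for t
  have u: "continuous_map X euclidean u" "\<And>s. cmod (u s) \<le> d1"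
    unfolding u_def using f d by (auto simp: C0_iff intro!: cut_cont cut_le)
  have v: "continuous_map Y euclidean v" "\<And>s. cmod (v s) \<le> d2"
    unfolding v_def using g d by (auto simp: C0_iff intro!: cut_cont cut_le)
  define U' where "U' = U \<inter> {s \<in> topspace X. f s \<in> ball ?f0 d1}"
  define V' where "V' = V \<inter> {t \<in> topspace Y. g t \<in> ball ?g0 d2}"
  have "openin X {s \<in> topspace X. f s \<in> ball ?f0 d1}"
    by (rule openin_continuous_map_preimage[of _ euclidean]) (use f in \<open>simp_all add: C0_iff\<close>)
  moreover have "openin Y {t \<in> topspace Y. g t \<in> ball ?g0 d2}"
    by (rule openin_continuous_map_preimage[of _ euclidean]) (use g in \<open>simp_all add: C0_iff\<close>)
  ultimately have U': "openin X U'" "\<pi>\<^sub>1 z0 \<in> U'" and V': "openin Y V'" "\<pi>\<^sub>2 z0 \<in> V'"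
    unfolding U'_def V'_def using U V mem d by auto
  have main: "p (\<lambda>z. (tens f g z + x z - (tens f g z0 + x z0)) * tens a b z) \<le> e * p (tens a b)"
    if a: "a \<in> carrier (C0 X)" "\<forall>s. s \<notin> U' \<longrightarrow> a s = 0" and b: "b \<in> carrier (C0 Y)" "\<forall>t. t \<notin> V' \<longrightarrow> b t = 0"
    for a b
  proof -
    let ?k = "tens a b"
    have k: "?k \<in> S" by (rule S_tens[OF a(1) b(1)])
    have pk: "p ?k \<ge> 0" by (rule cstar_norm_on_C0(5)[OF p k])
    have gk: "(\<lambda>z. g (\<pi>\<^sub>2 z) * ?k z) \<in> S"
      using g N by (intro S_mult2[OF k, of _ N]) (auto simp: C0_iff)
    have "p (\<lambda>z. g (\<pi>\<^sub>2 z) * ?k z) \<le> (N + 1) * p ?k"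
      using g N MN by (intro S_cstar_norm_leg2[OF p k]) (auto simp: C0_iff intro: add_increasing2)
    moreover have "p (\<lambda>z. u (\<pi>\<^sub>1 z) * (g (\<pi>\<^sub>2 z) * ?k z)) \<le> d1 * p (\<lambda>z. g (\<pi>\<^sub>2 z) * ?k z)"
      by (rule S_cstar_norm_leg1[OF p gk u d(1)])
    ultimately have 1: "p (\<lambda>z. u (\<pi>\<^sub>1 z) * (g (\<pi>\<^sub>2 z) * ?k z)) \<le> d1 * ((N + 1) * p ?k)"
      using d by (meson mult_left_mono less_imp_le order_trans)
    have vk: "(\<lambda>z. v (\<pi>\<^sub>2 z) * ?k z) \<in> S" by (rule S_mult2[OF k v])
    have "p (\<lambda>z. ?f0 * (v (\<pi>\<^sub>2 z) * ?k z)) = cmod ?f0 * p (\<lambda>z. v (\<pi>\<^sub>2 z) * ?k z)"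
      by (rule cstar_norm_on_C0(2)[OF p vk])
    also have "\<dots> \<le> (M + 1) * (d2 * p ?k)"
      using M[of "\<pi>\<^sub>1 z0"] cstar_norm_on_C0(5)[OF p vk] MN
      by (intro mult_mono S_cstar_norm_leg2[OF p k v d(2)]) auto
    finally have 2: "p (\<lambda>z. ?f0 * (v (\<pi>\<^sub>2 z) * ?k z)) \<le> (M + 1) * (d2 * p ?k)" .
    have xk: "(\<lambda>z. (x z - x z0) * ?k z) \<in> S"
      using S_add[OF S_mult[OF x k] S_scale[OF k, of "- x z0"]] by (simp add: algebra_simps)
    have 3: "p (\<lambda>z. (x z - x z0) * ?k z) \<le> e / 2 * p ?k"
      using a b by (intro UV) (auto simp: U'_def V'_def)
    \<comment> \<open>Splitting \<open>f g - ?f0 * ?g0\<close> as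
      \<open>(f - ?f0) * g + ?f0 * (g - ?g0)\<close> leaves only one-variable multipliers.\<close>
    have eq: "(\<lambda>z. (tens f g z + x z - (tens f g z0 + x z0)) * ?k z) =
      (\<lambda>z. (u (\<pi>\<^sub>1 z) * (g (\<pi>\<^sub>2 z) * ?k z) + ?f0 * (v (\<pi>\<^sub>2 z) * ?k z)) + (x z - x z0) * ?k z)"
    proof
      fix z
      have "u (\<pi>\<^sub>1 z) * ?k z = (f (\<pi>\<^sub>1 z) - ?f0) * ?k z"
      proof (cases "\<pi>\<^sub>1 z \<in> U'")
        case True
        then have "cmod (f (\<pi>\<^sub>1 z) - ?f0) \<le> d1"
          by (auto simp: U'_def dist_norm norm_minus_commute)
        then show ?thesis using cut_id[OF d(1)] by (simp add: u_def)
      qed (use a in \<open>simp add: tens_def\<close>)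
      moreover have "v (\<pi>\<^sub>2 z) * ?k z = (g (\<pi>\<^sub>2 z) - ?g0) * ?k z"
      proof (cases "\<pi>\<^sub>2 z \<in> V'")
        case True
        then have "cmod (g (\<pi>\<^sub>2 z) - ?g0) \<le> d2"
          by (auto simp: V'_def dist_norm norm_minus_commute)
        then show ?thesis using cut_id[OF d(2)] by (simp add: v_def)
      qed (use b in \<open>simp add: tens_def\<close>)
      ultimately have "u (\<pi>\<^sub>1 z) * (g (\<pi>\<^sub>2 z) * ?k z) + ?f0 * (v (\<pi>\<^sub>2 z) * ?k z) =
        (f (\<pi>\<^sub>1 z) - ?f0) * ?k z * g (\<pi>\<^sub>2 z) + ?f0 * ((g (\<pi>\<^sub>2 z) - ?g0) * ?k z)"
        by (metis mult.assoc mult.commute)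
      then show "(tens f g z + x z - (tens f g z0 + x z0)) * ?k z =
        (u (\<pi>\<^sub>1 z) * (g (\<pi>\<^sub>2 z) * ?k z) + ?f0 * (v (\<pi>\<^sub>2 z) * ?k z)) + (x z - x z0) * ?k z"
        unfolding tens_def[of f g] by (simp add: algebra_simps)
    qed
    note s1 = S_mult1[OF gk u] and s2 = S_scale[OF vk, of ?f0]
    have "p (\<lambda>z. (tens f g z + x z - (tens f g z0 + x z0)) * ?k z) \<le>
      p (\<lambda>z. u (\<pi>\<^sub>1 z) * (g (\<pi>\<^sub>2 z) * ?k z)) + p (\<lambda>z. ?f0 * (v (\<pi>\<^sub>2 z) * ?k z))
      + p (\<lambda>z. (x z - x z0) * ?k z)"
      unfolding eq
      using cstar_norm_on_C0(1)[OF p S_add[OF s1 s2] xk] cstar_norm_on_C0(1)[OF p s1 s2] by linarith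
    also have "\<dots> \<le> d1 * ((N + 1) * p ?k) + (M + 1) * (d2 * p ?k) + e / 2 * p ?k"
      using 1 2 3 by linarith
    also have "\<dots> = (d1 * (N + 1) + (M + 1) * d2 + e / 2) * p ?k" by (simp add: algebra_simps)
    also have "d1 * (N + 1) = e / 4" using MN by (simp add: d1_def field_simps)
    also have "(M + 1) * d2 = e / 4" using MN by (simp add: d2_def field_simps)
    finally show ?thesis by simp
  qed
  show ?case
    by (intro exI[of _ U'] exI[of _ V'] conjI U' V' ballI impI main)
qed

text \<open>For \<open>k\<close> an elementary tensor of bumps near \<open>z0\<close>, the function
  \<open>x z0 * k\<close> differs from \<open>x * k\<close> by at most \<open>e * p k\<close> in
  norm. Submultiplicativity then bounds |x z0| times \<open>p k\<close> by
  \<open>(p x + e) * p k\<close>, and \<open>p k\<close> is positive since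
  \<open>k z0 = 1\<close>.\<close>

lemma S_cstar_norm_minimal:
  assumes p: "cstar_norm_on (C0 Z) S p" and x: "x \<in> S"
  shows "(SUP z. cmod (x z)) \<le> p x"
proof (rule sup_norm_le)
  fix z0
  show "cmod (x z0) \<le> p x"
  proof (cases "z0 \<in> topspace Z")
    case False
    then show ?thesis
      using S_C0[OF x] cstar_norm_on_C0(5)[OF p x] by (simp add: C0_iff)
  next
    case True
    show ?thesis
    proof (rule field_le_epsilon)
      fix e :: real assume e: "e > 0"
      obtain U V where U: "openin X U" "\<pi>\<^sub>1 z0 \<in> U" and V: "openin Y V" "\<pi>\<^sub>2 z0 \<in> V"
        and UV: "\<And>a b. a\<in>carrier (C0 X) \<Longrightarrow> b\<in>carrier (C0 Y) \<Longrightarrow> (\<forall>s. s \<notin> U \<longrightarrow> a s = 0) \<Longrightarrow>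
          (\<forall>t. t \<notin> V \<longrightarrow> b t = 0) \<Longrightarrow> p (\<lambda>z. (x z - x z0) * tens a b z) \<le> e * p (tens a b)"
        using S_localise[OF p x True e] by blast
      obtain a :: "'x \<Rightarrow> real" where a: "(\<lambda>y. of_real (a y)) \<in> carrier (C0 X)" "a (\<pi>\<^sub>1 z0) = 1"
        "\<And>s. s \<notin> U \<Longrightarrow> a s = 0"
        by (rule C0_bump[OF X U]) blast
      obtain b :: "'y \<Rightarrow> real" where b: "(\<lambda>y. of_real (b y)) \<in> carrier (C0 Y)" "b (\<pi>\<^sub>2 z0) = 1"
        "\<And>s. s \<notin> V \<Longrightarrow> b s = 0"
        by (rule C0_bump[OF Y V]) blast
      define k where "k = tens (\<lambda>y. of_real (a y)) (\<lambda>y. of_real (b y))"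
      have k: "k \<in> S" unfolding k_def by (rule S_tens[OF a(1) b(1)])
      have "k z0 = 1" using a b by (simp add: k_def tens_def)
      then have "p k \<noteq> 0" using cstar_norm_on_C0(6)[OF p k] by auto
      then have pk: "p k > 0" using cstar_norm_on_C0(5)[OF p k] by simp
      have xk: "(\<lambda>z. (x z - x z0) * k z) \<in> S"
        using S_add[OF S_mult[OF x k] S_scale[OF k, of "- x z0"]] by (simp add: algebra_simps)
      have loc: "p (\<lambda>z. (x z - x z0) * k z) \<le> e * p k"
        unfolding k_def using a b by (intro UV) auto
      have "cmod (x z0) * p k = p (\<lambda>z. x z0 * k z)"
        by (rule cstar_norm_on_C0(2)[OF p k, symmetric])
      also have "(\<lambda>z. x z0 * k z) = (\<lambda>z. x z * k z + (-1) * ((x z - x z0) * k z))"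
        by (simp add: algebra_simps)
      also have "p \<dots> \<le> p (\<lambda>z. x z * k z) + p (\<lambda>z. (-1) * ((x z - x z0) * k z))"
        by (rule cstar_norm_on_C0(1)[OF p S_mult[OF x k] S_scale[OF xk]])
      also have "p (\<lambda>z. (-1) * ((x z - x z0) * k z)) = cmod (-1) * p (\<lambda>z. (x z - x z0) * k z)"
        by (rule cstar_norm_on_C0(2)[OF p xk])
      also have "p (\<lambda>z. x z * k z) \<le> p x * p k"
        by (rule cstar_norm_on_C0(7)[OF p x k])
      finally have "cmod (x z0) * p k \<le> (p x + e) * p k"
        using loc by (simp add: algebra_simps)
      then show "cmod (x z0) \<le> p x + e" using pk by simp
    qed
  qed
qed

lemma min_tensor_C0: "min_tensor (C0 X) (C0 Y) (C0 Z) tens"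
  unfolding min_tensor_def
proof (intro conjI cstar_C0 S_dense allI impI ballI)
  show "bilinear_map (C0 X) (C0 Y) (C0 Z) tens"
    using tens_C0 unfolding bilinear_map_def by (auto simp: tens_def algebra_simps)
  fix xs \<beta>
  assume xs: "set xs \<subseteq> carrier (C0 X) \<times> carrier (C0 Y)" and zero: "tsum (C0 Z) tens xs = zeroA (C0 Z)"
    and \<beta>: "bilinear_form (C0 X) (C0 Y) \<beta>"
  \<comment> \<open>Surjectivity of the homeomorphism carries the relation from \<open>Z\<close> to
    all points of the product; elsewhere every term vanishes.\<close>
  have "(\<Sum>(a, b)\<leftarrow>xs. a s * b t) = 0" for s t
  proof (cases "s \<in> topspace X \<and> t \<in> topspace Y")
    case True
    then have "(s, t) \<in> (\<lambda>z. (\<pi>\<^sub>1 z, \<pi>\<^sub>2 z)) ` topspace Z"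
      using homeomorphic_imp_surjective_map[OF homeo] by simp
    then obtain z where "\<pi>\<^sub>1 z = s" "\<pi>\<^sub>2 z = t" by blast
    then show ?thesis using fun_cong[OF zero, of z] by (simp add: tens_def)
  next
    case False
    have "(\<Sum>(a, b)\<leftarrow>xs. a s * b t) = (\<Sum>x\<leftarrow>xs. 0)"
      using False xs by (intro arg_cong[where f = sum_list] map_cong) (auto simp: C0_iff)
    then show ?thesis by simp
  qed
  then show "(\<Sum>(a, b)\<leftarrow>xs. \<beta> a b) = 0"
    by (rule tensor_zero_bilinear_form[OF \<beta> xs])
next
  fix p x assume "cstar_norm_on (C0 Z) S p" "x \<in> S"
  then show "normA (C0 Z) x \<le> p x" using S_cstar_norm_minimal by simp
qed (auto simp: tens_def)

end

section \<open>The Haagerup norm\<close>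

lemma C0_frame_simps [simp]:
  "alg (C0_frame X) = C0 X"
  "alg2 (C0_frame X) = C0 (prod_topology X X)"
  "alg3 (C0_frame X) = C0 (prod_topology X (prod_topology X X))"
  "mul2 (C0_frame X) = Cb (prod_topology X X)"
  "mul3 (C0_frame X) = Cb (prod_topology X (prod_topology X X))"
  by (simp_all add: C0_frame_def)

lemma C0_list_sum:
  "set fs \<subseteq> carrier (C0 X) \<Longrightarrow> (\<lambda>x. \<Sum>f\<leftarrow>fs. f x) \<in> carrier (C0 X)"
  by (induction fs) (auto intro: C0_closed)

lemma C0_sum:
  assumes "finite I" "\<And>k. k \<in> I \<Longrightarrow> f k \<in> carrier (C0 X)"
  shows "(\<lambda>x. \<Sum>k\<in>I. f k x) \<in> carrier (C0 X)"
  using assms by (induction I) (auto intro: C0_closed)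

lemma sum_list_sum_swap:
  fixes f :: "'i \<Rightarrow> 'k \<Rightarrow> 'a::comm_monoid_add"
  shows "(\<Sum>x\<leftarrow>xs. \<Sum>k\<in>I. f x k) = (\<Sum>k\<in>I. \<Sum>x\<leftarrow>xs. f x k)"
  by (induction xs) (auto simp: sum.distrib)

lemma sum_list_bound:
  fixes f :: "'i \<Rightarrow> real"
  assumes "\<And>x. x \<in> set xs \<Longrightarrow> f x \<le> c"
  shows "(\<Sum>x\<leftarrow>xs. f x) \<le> real (length xs) * c"
  using assms by (induction xs) (force simp: algebra_simps)+

text \<open>Together with \<open>C0_finite_osc\<close> this supplies the hypotheses
  \<open>out\<close> and \<open>osc\<close> of \<open>C0_family_approx\<close> for a finite set of
  functions.\<close>

lemma C0_finite_vanish: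
  assumes "finite A" "A \<subseteq> carrier (C0 X)" "e > 0"
  shows "\<exists>K. compactin X K \<and> (\<forall>a\<in>A. \<forall>x. x \<notin> K \<longrightarrow> cmod (a x) \<le> e)"
  using assms(1,2)
proof (induction A)
  case (insert a A)
  then obtain K where K: "compactin X K" "\<forall>a\<in>A. \<forall>x. x \<notin> K \<longrightarrow> cmod (a x) \<le> e" by auto
  obtain L where L: "compactin X L" "\<And>x. x \<in> topspace X \<Longrightarrow> x \<notin> L \<Longrightarrow> cmod (a x) < e"
    using insert.prems assms(3) unfolding C0_iff insert_subset by meson
  have "cmod (a x) \<le> e" if "x \<notin> L" for x
    using L(2)[of x] that insert.prems assms(3) unfolding C0_iff insert_subset
    by (cases "x \<in> topspace X") auto
  then show ?case
    using K compactin_Un[OF K(1) L(1)] by (intro exI[of _ "K \<union> L"]) auto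
qed (auto intro: exI[of _ "{}"])

lemma C0_finite_osc:
  assumes "finite A" "A \<subseteq> carrier (C0 X)" "e > 0" "x \<in> topspace X"
  shows "\<exists>U. openin X U \<and> x \<in> U \<and> (\<forall>y\<in>U. \<forall>a\<in>A. cmod (a y - a x) \<le> e)"
  using assms(1,2)
proof (induction A)
  case (insert a A)
  then obtain U where U: "openin X U" "x \<in> U" "\<forall>y\<in>U. \<forall>a\<in>A. cmod (a y - a x) \<le> e" by auto
  have "openin X {y \<in> topspace X. a y \<in> ball (a x) e}"
    using insert.prems
    by (intro openin_continuous_map_preimage[of _ euclidean]) (simp_all add: C0_iff)
  then show ?case
    using U assms(3,4)
    by (intro exI[of _ "U \<inter> {y \<in> topspace X. a y \<in> ball (a x) e}"])
       (auto simp: dist_norm norm_minus_commute)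
qed (use assms in auto)

locale C0_square =
  fixes X :: "'x topology"
  assumes X: "locally_compact_space X" "Hausdorff_space X"
begin

sublocale t: C0_tensor_product X X "prod_topology X X" fst snd
  by unfold_locales (use X homeomorphic_map_id[of "prod_topology X X"] in \<open>auto simp: id_def\<close>)

abbreviation XX :: "('x \<times> 'x) topology" where "XX \<equiv> prod_topology X X"

lemma tn_eq: "tn (C0_frame X) = t.tens"
  by (auto simp: C0_frame_def t.tens_def fun_eq_iff)

text \<open>Squared Euclidean norm of the row of first factors at a point; its supremum is what
  stands under the first square root of the Haagerup norm. \<open>cols\<close> plays this role for
  the second.\<close>

definition rows :: "(('x \<Rightarrow> complex) \<times> ('x \<Rightarrow> complex)) list \<Rightarrow> 'x \<Rightarrow> real" where
  "rows xs p = (\<Sum>(a, b)\<leftarrow>xs. (cmod (a p))\<^sup>2)"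

definition cols :: "(('x \<Rightarrow> complex) \<times> ('x \<Rightarrow> complex)) list \<Rightarrow> 'x \<Rightarrow> real" where
  "cols xs q = (\<Sum>(a, b)\<leftarrow>xs. (cmod (b q))\<^sup>2)"

text \<open>A balanced witness: with both factors bounded by \<open>s\<close>, the Haagerup norm is
  at most \<open>s\<close>, and every \<open>s\<close> above the norm has such a witness. Estimates
  on witnesses replace manipulations of the infimum.\<close>

definition rep_by :: "real \<Rightarrow> ('x \<times> 'x \<Rightarrow> complex) \<Rightarrow> bool" where
  "rep_by s x \<longleftrightarrow> (\<exists>xs. set xs \<subseteq> carrier (C0 X) \<times> carrier (C0 X) \<and>
     x = (\<lambda>z. \<Sum>(a, b)\<leftarrow>xs. t.tens a b z) \<and> (\<forall>p. rows xs p \<le> s) \<and> (\<forall>q. cols xs q \<le> s))"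

abbreviation hn :: "('x \<times> 'x \<Rightarrow> complex) \<Rightarrow> real" where
  "hn \<equiv> haagerup_norm (C0_frame X)"

lemma rows_nonneg: "0 \<le> rows xs p" and cols_nonneg: "0 \<le> cols xs p"
  unfolding rows_def cols_def by (auto intro!: sum_list_nonneg)

lemma rows_eq: "cmod (\<Sum>x\<leftarrow>xs. fst x p * cnj (fst x p)) = rows xs p"
proof -
  have "(\<Sum>x\<leftarrow>xs. fst x p * cnj (fst x p)) = of_real (rows xs p)"
    by (induction xs) (auto simp: rows_def complex_norm_square simp flip: of_real_power)
  then show ?thesis using rows_nonneg[of xs p] by simp
qed

lemma cols_eq: "cmod (\<Sum>x\<leftarrow>xs. cnj (snd x q) * snd x q) = cols xs q"
proof -
  have "(\<Sum>x\<leftarrow>xs. cnj (snd x q) * snd x q) = of_real (cols xs q)"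
    by (induction xs) (auto simp: cols_def complex_norm_square mult.commute simp flip: of_real_power)
  then show ?thesis using cols_nonneg[of xs q] by simp
qed

lemma haagerup_norm_eq:
  "hn x = Inf {sqrt (SUP p. rows xs p) * sqrt (SUP q. cols xs q) | xs.
     set xs \<subseteq> carrier (C0 X) \<times> carrier (C0 X) \<and> (\<lambda>z. \<Sum>(a, b)\<leftarrow>xs. t.tens a b z) = x}"
  unfolding haagerup_norm_def
  by (simp add: tn_eq rows_eq cols_eq case_prod_unfold o_def)

lemma bdd_above_rows_cols:
  assumes "set xs \<subseteq> carrier (C0 X) \<times> carrier (C0 X)"
  shows "bdd_above (range (rows xs))" "bdd_above (range (cols xs))"
proof -
  have "set (map (\<lambda>(a, b) x. a x * cnj (a x)) xs) \<subseteq> carrier (C0 X)"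
    "set (map (\<lambda>(a, b) x. cnj (b x) * b x) xs) \<subseteq> carrier (C0 X)"
    using assms by (auto intro!: C0_closed(3,4))
  from this[THEN C0_list_sum, THEN C0_bounded]
  show "bdd_above (range (rows xs))" "bdd_above (range (cols xs))"
    unfolding bounded_iff bdd_above_def by (auto simp: case_prod_unfold o_def rows_eq cols_eq)
qed

lemma rep_by_nonneg: "rep_by s x \<Longrightarrow> 0 \<le> s"
  using rows_nonneg order_trans unfolding rep_by_def by blast

lemma haagerup_norm_le:
  assumes "rep_by s x"
  shows "hn x \<le> s"
proof -
  obtain xs where xs: "set xs \<subseteq> carrier (C0 X) \<times> carrier (C0 X)"
    "x = (\<lambda>z. \<Sum>(a, b)\<leftarrow>xs. t.tens a b z)" "\<And>p. rows xs p \<le> s" "\<And>q. cols xs q \<le> s"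
    using assms unfolding rep_by_def by blast
  have nn: "0 \<le> (SUP p. rows ys p)" "0 \<le> (SUP p. cols ys p)"
    if "set ys \<subseteq> carrier (C0 X) \<times> carrier (C0 X)" for ys
    using bdd_above_rows_cols[OF that] rows_nonneg cols_nonneg
    by (meson UNIV_I cSUP_upper2)+
  have "hn x \<le> sqrt (SUP p. rows xs p) * sqrt (SUP q. cols xs q)"
    unfolding haagerup_norm_eq
    by (rule cInf_lower) (use xs nn in \<open>auto intro!: bdd_belowI[of _ 0] mult_nonneg_nonneg\<close>)
  also have "\<dots> \<le> sqrt s * sqrt s"
    using xs(3,4) nn[OF xs(1)] rep_by_nonneg[OF assms]
    by (intro mult_mono real_sqrt_le_mono cSUP_least) auto
  finally show ?thesis using rep_by_nonneg[OF assms] by simp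
qed

text \<open>The two factors of a representation can be balanced by replacing \<open>a \<otimes> b\<close> by
  \<open>l a \<otimes> l\<inverse> b\<close>.\<close>

lemma rep_byI:
  assumes xs: "set xs \<subseteq> carrier (C0 X) \<times> carrier (C0 X)"
    and x: "x = (\<lambda>z. \<Sum>(a, b)\<leftarrow>xs. t.tens a b z)"
    and c: "c > 0" and le: "\<And>p. c * rows xs p \<le> s" "\<And>q. cols xs q / c \<le> s"
  shows "rep_by s x"
proof -
  define l :: complex where "l = of_real (sqrt c)"
  have l: "l \<noteq> 0" "(cmod l)\<^sup>2 = c" using c by (auto simp: l_def)
  define f :: "('x \<Rightarrow> complex) \<times> ('x \<Rightarrow> complex) \<Rightarrow> ('x \<Rightarrow> complex) \<times> ('x \<Rightarrow> complex)"
    where "f = (\<lambda>(a, b). (\<lambda>p. l * a p, \<lambda>q. (1 / l) * b q))"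
  have "rows (map f xs) p = c * rows xs p" for p
    by (induction xs) (auto simp: rows_def f_def norm_mult power_mult_distrib l algebra_simps)
  moreover have "cols (map f xs) p = cols xs p / c" for p
    by (induction xs)
       (auto simp: cols_def f_def norm_divide power_divide l add_divide_distrib)
  moreover have "(\<Sum>(a, b)\<leftarrow>map f xs. t.tens a b z) = (\<Sum>(a, b)\<leftarrow>xs. t.tens a b z)" for z
    by (induction xs) (use l in \<open>auto simp: f_def t.tens_def\<close>)
  moreover have "set (map f xs) \<subseteq> carrier (C0 X) \<times> carrier (C0 X)"
    using xs unfolding f_def by (auto intro!: C0_closed(5) simp del: times_divide_eq_left)
  ultimately show ?thesis
    unfolding rep_by_def x using le by (intro exI[of _ "map f xs"]) auto
qed

lemma rep_by_haagerup_norm: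
  assumes x: "x \<in> t.S" and s: "hn x < s"
  shows "rep_by s x"
proof -
  have ne: "{sqrt (SUP p. rows xs p) * sqrt (SUP q. cols xs q) | xs.
     set xs \<subseteq> carrier (C0 X) \<times> carrier (C0 X) \<and> (\<lambda>z. \<Sum>(a, b)\<leftarrow>xs. t.tens a b z) = x} \<noteq> {}"
    using x unfolding t.S_eq by blast
  from cInf_lessD[OF ne s[unfolded haagerup_norm_eq]]
  obtain xs where xs: "set xs \<subseteq> carrier (C0 X) \<times> carrier (C0 X)"
    "x = (\<lambda>z. \<Sum>(a, b)\<leftarrow>xs. t.tens a b z)"
    and lt: "sqrt (SUP p. rows xs p) * sqrt (SUP q. cols xs q) < s"
    by auto
  define A B where "A = (SUP p. rows xs p)" and "B = (SUP q. cols xs q)"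
  have le: "rows xs p \<le> A" "cols xs q \<le> B" for p q
    unfolding A_def B_def using bdd_above_rows_cols[OF xs(1)] by (auto intro: cSUP_upper)
  have AB: "0 \<le> A" "0 \<le> B" using le rows_nonneg cols_nonneg order_trans by blast+
  have lt: "sqrt (A * B) < s" using lt unfolding A_def B_def by (simp add: real_sqrt_mult)
  have s0: "s > 0" using lt AB by (meson mult_nonneg_nonneg order_le_less_trans real_sqrt_ge_zero)
  have AB2: "A * B \<le> s * s"
    using power_mono[OF less_imp_le[OF lt], of 2] AB by (simp add: power2_eq_square)
  \<comment> \<open>Possible because \<open>A * B \<le> s * s\<close>: take \<open>s / A\<close>. If
    \<open>A\<close> is 0, any large \<open>c\<close> will do, and the summand 1 keeps it positive
    when \<open>B\<close> is 0 as well.\<close>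
  have "\<exists>c>0. c * A \<le> s \<and> B / c \<le> s"
  proof (cases "A = 0")
    case True
    then show ?thesis
      using AB s0 by (intro exI[of _ "(B + 1) / s"]) (auto simp: field_simps)
  next
    case False
    then show ?thesis
      using AB s0 AB2 by (intro exI[of _ "s / A"]) (auto simp: field_simps)
  qed
  then obtain c where c: "c > 0" "c * A \<le> s" "B / c \<le> s" by blast
  show ?thesis
  proof (rule rep_byI[OF xs c(1)])
    show "c * rows xs p \<le> s" for p
      using c le(1)[of p] by (meson less_imp_le mult_left_mono order_trans)
    show "cols xs q / c \<le> s" for q
      using c le(2)[of q] by (meson divide_right_mono less_imp_le order_trans)
  qed
qed

text \<open>Rows and columns of a concatenated list add up. Balancing pays off here: for products of
  unequal factors the sums would not combine to \<open>s + r\<close>.\<close>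

lemma rep_by_add:
  assumes "rep_by s x" "rep_by r y"
  shows "rep_by (s + r) (\<lambda>z. x z + y z)"
proof -
  obtain xs where xs: "set xs \<subseteq> carrier (C0 X) \<times> carrier (C0 X)"
    "x = (\<lambda>z. \<Sum>(a, b)\<leftarrow>xs. t.tens a b z)" "\<And>p. rows xs p \<le> s" "\<And>q. cols xs q \<le> s"
    using assms(1) unfolding rep_by_def by blast
  obtain ys where ys: "set ys \<subseteq> carrier (C0 X) \<times> carrier (C0 X)"
    "y = (\<lambda>z. \<Sum>(a, b)\<leftarrow>ys. t.tens a b z)" "\<And>p. rows ys p \<le> r" "\<And>q. cols ys q \<le> r"
    using assms(2) unfolding rep_by_def by blast
  have "rows (xs @ ys) p \<le> s + r" "cols (xs @ ys) p \<le> s + r" for p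
    using xs(3)[of p] ys(3)[of p] xs(4)[of p] ys(4)[of p] by (simp_all add: rows_def cols_def)
  then show ?thesis
    unfolding rep_by_def using xs(1,2) ys(1,2) by (intro exI[of _ "xs @ ys"]) simp
qed

lemma rep_by_zero: "rep_by 0 (\<lambda>z. 0)"
  unfolding rep_by_def by (intro exI[of _ "[]"]) (simp add: rows_def cols_def)

lemma rep_by_uminus:
  assumes "rep_by s x"
  shows "rep_by s (\<lambda>z. - x z)"
proof -
  obtain xs where xs: "set xs \<subseteq> carrier (C0 X) \<times> carrier (C0 X)"
    "x = (\<lambda>z. \<Sum>(a, b)\<leftarrow>xs. t.tens a b z)" "\<And>p. rows xs p \<le> s" "\<And>q. cols xs q \<le> s"
    using assms unfolding rep_by_def by blast
  define f :: "('x \<Rightarrow> complex) \<times> ('x \<Rightarrow> complex) \<Rightarrow> ('x \<Rightarrow> complex) \<times> ('x \<Rightarrow> complex)"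
    where "f = (\<lambda>(a, b). (\<lambda>p. (-1) * a p, b))"
  have "rows (map f xs) p = rows xs p" "cols (map f xs) p = cols xs p" for p
    by (induction xs) (auto simp: rows_def cols_def f_def)
  moreover have "(\<Sum>(a, b)\<leftarrow>map f xs. t.tens a b z) = - (\<Sum>(a, b)\<leftarrow>xs. t.tens a b z)" for z
    by (induction xs) (auto simp: f_def t.tens_def)
  moreover have "set (map f xs) \<subseteq> carrier (C0 X) \<times> carrier (C0 X)"
    using xs C0_closed(5)[of _ X "-1"] unfolding f_def by auto
  ultimately show ?thesis
    unfolding rep_by_def xs(2) using xs(3,4) by (intro exI[of _ "map f xs"]) simp
qed

lemma rep_by_diff: "rep_by s x \<Longrightarrow> rep_by r y \<Longrightarrow> rep_by (s + r) (\<lambda>z. x z - y z)"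
  using rep_by_add[OF _ rep_by_uminus] by simp

text \<open>Since rows and columns have the same bound, the inequality between arithmetic and
  geometric means, applied term by term, takes the place of Cauchy-Schwarz. This is the comparison
  of the supremum norm with the Haagerup norm.\<close>

lemma rep_by_bound:
  assumes "rep_by s x"
  shows "cmod (x z) \<le> s"
proof -
  obtain xs where xs: "x = (\<lambda>z. \<Sum>(a, b)\<leftarrow>xs. t.tens a b z)"
    "\<And>p. rows xs p \<le> s" "\<And>q. cols xs q \<le> s"
    using assms unfolding rep_by_def by blast
  have "cmod (\<Sum>(a, b)\<leftarrow>xs. t.tens a b z) \<le> (rows xs (fst z) + cols xs (snd z)) / 2"
  proof (induction xs)
    case (Cons y ys)
    obtain a b where y: "y = (a, b)" by fastforce
    have "0 \<le> (cmod (a (fst z)) - cmod (b (snd z)))\<^sup>2" by simp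
    then have "cmod (t.tens a b z) \<le> ((cmod (a (fst z)))\<^sup>2 + (cmod (b (snd z)))\<^sup>2) / 2"
      unfolding power2_diff by (simp add: t.tens_def norm_mult)
    then show ?case
      using Cons norm_triangle_ineq[of "t.tens a b z" "\<Sum>(a, b)\<leftarrow>ys. t.tens a b z"]
      by (simp add: y rows_def cols_def add_divide_distrib)
  qed (simp add: rows_def cols_def)
  also have "\<dots> \<le> s" using add_mono[OF xs(2)[of "fst z"] xs(3)[of "snd z"]] by simp
  finally show ?thesis by (simp add: xs(1))
qed

lemma haagerup_norm_nonneg: "x \<in> t.S \<Longrightarrow> 0 \<le> hn x"
  by (rule dense_ge) (blast intro: rep_by_nonneg rep_by_haagerup_norm)

lemma haagerup_norm_zero: "hn (\<lambda>z. 0) = 0"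
  using haagerup_norm_le[OF rep_by_zero] haagerup_norm_nonneg[OF t.S_zero] by simp

lemma cmod_le_haagerup_norm: "x \<in> t.S \<Longrightarrow> cmod (x z) \<le> hn x"
  by (meson dense_ge rep_by_bound rep_by_haagerup_norm)

lemma haagerup_norm_diff:
  assumes "x \<in> t.S" "y \<in> t.S"
  shows "hn (\<lambda>z. x z - y z) \<le> hn x + hn y"
proof (rule field_le_epsilon)
  fix e :: real assume "e > 0"
  then have "rep_by (hn x + e / 2) x" "rep_by (hn y + e / 2) y"
    using assms by (auto intro: rep_by_haagerup_norm)
  from haagerup_norm_le[OF rep_by_diff[OF this]] show "hn (\<lambda>z. x z - y z) \<le> hn x + hn y + e"
    by simp
qed

lemma S_diff: "x \<in> t.S \<Longrightarrow> y \<in> t.S \<Longrightarrow> (\<lambda>z. x z - y z) \<in> t.S"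
  using t.S_add[OF _ t.S_scale[of y "-1"]] by simp

lemma haagerup_norm_add:
  assumes "x \<in> t.S" "y \<in> t.S"
  shows "hn (\<lambda>z. x z + y z) \<le> hn x + hn y"
proof -
  have "hn (\<lambda>z. - y z) \<le> hn y"
    using haagerup_norm_diff[OF t.S_zero assms(2)] by (simp add: haagerup_norm_zero)
  then show ?thesis
    using haagerup_norm_diff[OF assms(1) S_diff[OF t.S_zero assms(2)]] by simp
qed

lemma haagerup_norm_minus_commute:
  assumes "x \<in> t.S" "y \<in> t.S"
  shows "hn (\<lambda>z. x z - y z) = hn (\<lambda>z. y z - x z)"
  using haagerup_norm_diff[OF t.S_zero S_diff[OF assms]]
    haagerup_norm_diff[OF t.S_zero S_diff[OF assms(2,1)]]
  by (simp add: haagerup_norm_zero)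

section \<open>Injectivity on the Haagerup tensor product\<close>

text \<open>The finite rank sampling operator in the first variable, tensored with the identity. It
  is defined on functions, not on representations, so that it visibly depends only on the slices of
  \<open>x\<close> at the points of \<open>I\<close>.\<close>

definition compression :: "'x set \<Rightarrow> ('x \<Rightarrow> 'x \<Rightarrow> real) \<Rightarrow> ('x \<times> 'x \<Rightarrow> complex) \<Rightarrow> 'x \<times> 'x \<Rightarrow> complex" where
  "compression I \<phi> x = (\<lambda>z. \<Sum>k\<in>I. of_real (\<phi> k (fst z)) * x (k, snd z))"

definition subpartition :: "'x set \<Rightarrow> ('x \<Rightarrow> 'x \<Rightarrow> real) \<Rightarrow> bool" where
  "subpartition I \<phi> \<longleftrightarrow> finite I \<and> (\<forall>k\<in>I. (\<lambda>y. of_real (\<phi> k y)) \<in> carrier (C0 X)) \<and>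
     (\<forall>k y. 0 \<le> \<phi> k y) \<and> (\<forall>y. (\<Sum>k\<in>I. \<phi> k y) \<le> 1)"

lemma compression_diff: "compression I \<phi> (\<lambda>z. x z - y z) = (\<lambda>z. compression I \<phi> x z - compression I \<phi> y z)"
  by (simp add: compression_def right_diff_distrib sum_subtractf)

lemma compression_tensor:
  "compression I \<phi> (\<lambda>z. \<Sum>(a, b)\<leftarrow>xs. t.tens a b z) =
    (\<lambda>z. \<Sum>(a, b)\<leftarrow>xs. t.tens (\<lambda>p. \<Sum>k\<in>I. of_real (\<phi> k p) * a k) b z)"
proof
  fix z
  have "compression I \<phi> (\<lambda>z. \<Sum>(a, b)\<leftarrow>xs. t.tens a b z) z =
    (\<Sum>x\<leftarrow>xs. \<Sum>k\<in>I. of_real (\<phi> k (fst z)) * t.tens (fst x) (snd x) (k, snd z))"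
    unfolding compression_def sum_list_sum_swap sum_list_const_mult by (simp add: case_prod_unfold)
  also have "\<dots> = (\<Sum>(a, b)\<leftarrow>xs. t.tens (\<lambda>p. \<Sum>k\<in>I. of_real (\<phi> k p) * a k) b z)"
    by (intro arg_cong[where f = sum_list] map_cong)
       (auto simp: t.tens_def sum_distrib_right mult.assoc)
  finally show "compression I \<phi> (\<lambda>z. \<Sum>(a, b)\<leftarrow>xs. t.tens a b z) z =
    (\<Sum>(a, b)\<leftarrow>xs. t.tens (\<lambda>p. \<Sum>k\<in>I. of_real (\<phi> k p) * a k) b z)" .
qed

lemma compression_C0:
  assumes "subpartition I \<phi>"
  shows "(\<lambda>p. \<Sum>k\<in>I. of_real (\<phi> k p) * a k) \<in> carrier (C0 X)"
proof (rule C0_sum)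
  show "finite I" using assms by (simp add: subpartition_def)
  show "(\<lambda>p. of_real (\<phi> k p) * a k) \<in> carrier (C0 X)" if "k \<in> I" for k
    using C0_closed(5)[of "\<lambda>p. of_real (\<phi> k p)" X "a k"] assms that
    by (simp add: subpartition_def mult.commute)
qed

text \<open>Convexity of the squared modulus for weights of total mass at most 1, obtained from
  Cauchy-Schwarz with each weight split into two square roots.\<close>

lemma compression_cmod_square:
  assumes "subpartition I \<phi>"
  shows "(cmod (\<Sum>k\<in>I. of_real (\<phi> k p) * a k))\<^sup>2 \<le> (\<Sum>k\<in>I. \<phi> k p * (cmod (a k))\<^sup>2)"
proof -
  have nn: "0 \<le> \<phi> k p" and le: "(\<Sum>k\<in>I. \<phi> k p) \<le> 1" for k
    using assms by (auto simp: subpartition_def)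
  have "cmod (\<Sum>k\<in>I. of_real (\<phi> k p) * a k) \<le> (\<Sum>k\<in>I. sqrt (\<phi> k p) * (sqrt (\<phi> k p) * cmod (a k)))"
    using nn by (intro order_trans[OF norm_sum] sum_mono) (simp add: norm_mult flip: mult.assoc)
  then have "(cmod (\<Sum>k\<in>I. of_real (\<phi> k p) * a k))\<^sup>2 \<le>
    (\<Sum>k\<in>I. sqrt (\<phi> k p) * (sqrt (\<phi> k p) * cmod (a k)))\<^sup>2"
    by (intro power_mono) auto
  also have "\<dots> \<le> (\<Sum>k\<in>I. (sqrt (\<phi> k p))\<^sup>2) * (\<Sum>k\<in>I. (sqrt (\<phi> k p) * cmod (a k))\<^sup>2)"
    by (rule Cauchy_Schwarz_ineq_sum)
  also have "\<dots> = (\<Sum>k\<in>I. \<phi> k p) * (\<Sum>k\<in>I. \<phi> k p * (cmod (a k))\<^sup>2)"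
    using nn by (simp add: power_mult_distrib)
  also have "\<dots> \<le> 1 * (\<Sum>k\<in>I. \<phi> k p * (cmod (a k))\<^sup>2)"
    using nn le by (intro mult_right_mono sum_nonneg) auto
  finally show ?thesis by simp
qed

text \<open>Only the first factors change. By convexity the new row at \<open>p\<close> is bounded
  by a combination of the old rows at the sample points, with nonnegative weights of sum at most
  1.\<close>

lemma rep_by_compression:
  assumes \<phi>: "subpartition I \<phi>" and x: "rep_by s x"
  shows "rep_by s (compression I \<phi> x)"
proof -
  obtain xs where xs: "set xs \<subseteq> carrier (C0 X) \<times> carrier (C0 X)"
    "x = (\<lambda>z. \<Sum>(a, b)\<leftarrow>xs. t.tens a b z)" "\<And>p. rows xs p \<le> s" "\<And>q. cols xs q \<le> s"
    using x unfolding rep_by_def by blast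
  have nn: "0 \<le> \<phi> k p" and le: "(\<Sum>k\<in>I. \<phi> k p) \<le> 1" for k p
    using \<phi> by (auto simp: subpartition_def)
  define f :: "('x \<Rightarrow> complex) \<times> ('x \<Rightarrow> complex) \<Rightarrow> ('x \<Rightarrow> complex) \<times> ('x \<Rightarrow> complex)"
    where "f = (\<lambda>(a, b). (\<lambda>p. \<Sum>k\<in>I. of_real (\<phi> k p) * a k, b))"
  have eq: "compression I \<phi> x = (\<lambda>z. \<Sum>(a, b)\<leftarrow>map f xs. t.tens a b z)"
    unfolding xs(2) compression_tensor by (simp add: f_def case_prod_unfold o_def)
  have "cols (map f xs) q = cols xs q" for q
    by (simp add: cols_def f_def case_prod_unfold o_def)
  moreover have "rows (map f xs) p \<le> s" for p
  proof -
    have "rows (map f xs) p \<le> (\<Sum>x\<leftarrow>xs. \<Sum>k\<in>I. \<phi> k p * (cmod (fst x k))\<^sup>2)"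
      unfolding rows_def map_map
      by (rule sum_list_mono) (auto simp: f_def intro: compression_cmod_square[OF \<phi>])
    also have "\<dots> = (\<Sum>k\<in>I. \<phi> k p * rows xs k)"
      unfolding sum_list_sum_swap sum_list_const_mult rows_def by (simp add: case_prod_unfold)
    also have "\<dots> \<le> (\<Sum>k\<in>I. \<phi> k p * s)"
      using nn xs(3) by (intro sum_mono mult_left_mono)
    also have "\<dots> \<le> 1 * s"
      unfolding sum_distrib_right[symmetric] using le rep_by_nonneg[OF x] by (intro mult_right_mono)
    finally show ?thesis by simp
  qed
  moreover have "set (map f xs) \<subseteq> carrier (C0 X) \<times> carrier (C0 X)"
    using xs(1) compression_C0[OF \<phi>] by (auto simp: f_def)
  ultimately show ?thesis
    unfolding rep_by_def eq using xs(4) by (intro exI[of _ "map f xs"]) auto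
qed

text \<open>The compression is the sum of the tensors of \<open>\<phi> k\<close> with the slice of
  \<open>x\<close> at \<open>k\<close>. Rows are at most 1, as the square of \<open>\<phi> k\<close>
  is at most \<open>\<phi> k\<close>; columns are at most \<open>card I\<close> times the square of
  \<open>d\<close>; rescaling by \<open>d\<close> balances them. Only the supremum of
  \<open>x\<close> enters the bound.\<close>

lemma rep_by_compression_small:
  assumes \<phi>: "subpartition I \<phi>" and x: "x \<in> t.S" and d: "d > 0" "\<And>z. cmod (x z) \<le> d"
  shows "rep_by ((real (card I) + 1) * d) (compression I \<phi> x)"
proof -
  have fin: "finite I" and nn: "0 \<le> \<phi> k p" and le: "(\<Sum>k\<in>I. \<phi> k p) \<le> 1"
    and C: "k \<in> I \<Longrightarrow> (\<lambda>y. of_real (\<phi> k y)) \<in> carrier (C0 X)" for k p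
    using \<phi> by (auto simp: subpartition_def)
  obtain ks where ks: "set ks = I" "distinct ks" using fin finite_distinct_list by blast
  define xs where "xs = map (\<lambda>k. (\<lambda>p. complex_of_real (\<phi> k p), \<lambda>q. x (k, q))) ks"
  have slice: "(\<lambda>q. x (k, q)) \<in> carrier (C0 X)" for k
    using x by (induction rule: t.S_induct) (auto simp: t.tens_def intro!: C0_closed)
  show ?thesis
  proof (rule rep_byI[OF _ _ d(1)])
    show "set xs \<subseteq> carrier (C0 X) \<times> carrier (C0 X)"
      using C slice ks by (auto simp: xs_def)
    show "compression I \<phi> x = (\<lambda>z. \<Sum>(a, b)\<leftarrow>xs. t.tens a b z)"
      using ks by (auto simp: xs_def compression_def o_def t.tens_def sum_list_distinct_conv_sum_set)
    show "d * rows xs p \<le> (real (card I) + 1) * d" for p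
    proof -
      have "rows xs p = (\<Sum>k\<in>I. (\<phi> k p)\<^sup>2)"
        using ks by (simp add: xs_def rows_def o_def sum_list_distinct_conv_sum_set)
      also have "\<dots> \<le> (\<Sum>k\<in>I. \<phi> k p)"
      proof (rule sum_mono)
        fix k assume "k \<in> I"
        then have "\<phi> k p \<le> 1" using member_le_sum[of k I "\<lambda>k. \<phi> k p"] fin nn le[of p] by force
        then show "(\<phi> k p)\<^sup>2 \<le> \<phi> k p" using nn by (simp add: power2_eq_square mult_left_le)
      qed
      also have "\<dots> \<le> real (card I) + 1" using le[of p] by simp
      finally show ?thesis using d by (simp add: mult.commute)
    qed
    show "cols xs q / d \<le> (real (card I) + 1) * d" for q
    proof -
      have "cols xs q = (\<Sum>k\<in>I. (cmod (x (k, q)))\<^sup>2)"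
        using ks by (simp add: xs_def cols_def o_def sum_list_distinct_conv_sum_set)
      also have "\<dots> \<le> real (card I) * d\<^sup>2"
        using d(2) by (intro sum_bounded_above power_mono) auto
      also have "\<dots> \<le> (real (card I) + 1) * d\<^sup>2" by (intro mult_right_mono) auto
      finally show ?thesis using d by (simp add: divide_le_eq power2_eq_square mult.assoc)
    qed
  qed
qed

text \<open>A representation has finitely many first factors, so one partition approximates all of
  them within \<open>d\<close>. The error has rows of order \<open>d\<close> squared and unchanged
  columns; rescaling by \<open>1 / d\<close> makes both of order \<open>d\<close>.\<close>

lemma rep_by_compression_approx:
  assumes x: "x \<in> t.S" and e: "e > 0"
  obtains I \<phi> where "subpartition I \<phi>" "rep_by e (\<lambda>z. compression I \<phi> x z - x z)"
proof -
  obtain xs where xs: "set xs \<subseteq> carrier (C0 X) \<times> carrier (C0 X)"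
    and x_eq: "x = (\<lambda>z. \<Sum>(a, b)\<leftarrow>xs. t.tens a b z)"
    using x unfolding t.S_eq by blast
  obtain N where N: "\<And>q. cols xs q \<le> N"
    using bdd_above_rows_cols(2)[OF xs] unfolding bdd_above_def by auto
  have N0: "N \<ge> 0" using N cols_nonneg order_trans by blast
  \<comment> \<open>Dominates both the number of terms and the column bound, so that after rescaling
    rows and columns are at most \<open>n * d = e\<close>; the summand 1 makes it positive.\<close>
  define n where "n = real (length xs) + N + 1"
  have n: "n > 0" using N0 by (simp add: n_def)
  define d where "d = e / n"
  have d: "d > 0" using e n by (simp add: d_def)
  define A where "A = fst ` set xs"
  have A: "finite A" "A \<subseteq> carrier (C0 X)" using xs by (auto simp: A_def)
  have d2: "d / 2 > 0" using d by simp
  obtain K where K: "compactin X K" "\<forall>a\<in>A. \<forall>x. x \<notin> K \<longrightarrow> cmod (a x) \<le> d / 2"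
    using C0_finite_vanish[OF A d2] by blast
  obtain I and \<phi> :: "'x \<Rightarrow> 'x \<Rightarrow> real" where I: "finite I"
    "\<And>k. k \<in> I \<Longrightarrow> (\<lambda>y. of_real (\<phi> k y)) \<in> carrier (C0 X)"
    "\<And>k y. 0 \<le> \<phi> k y" "\<And>y. (\<Sum>k\<in>I. \<phi> k y) \<le> 1"
    "\<And>x a. a \<in> A \<Longrightarrow> cmod (a x - (\<Sum>k\<in>I. of_real (\<phi> k x) * a k)) \<le> 2 * \<bar>d / 2\<bar>"
  proof (rule C0_family_approx[OF X K(1), of A "\<lambda>x a. a x" "d / 2"])
    fix x assume "x \<in> K"
    then have "x \<in> topspace X" using compactin_subset_topspace[OF K(1)] by blast
    then show "\<exists>U. openin X U \<and> x \<in> U \<and> (\<forall>y\<in>U. \<forall>a\<in>A. cmod (a y - a x) \<le> d / 2)"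
      by (rule C0_finite_osc[OF A d2])
  qed (use K in blast)+
  have sub: "subpartition I \<phi>" using I(1-4) by (simp add: subpartition_def)
  define f :: "('x \<Rightarrow> complex) \<times> ('x \<Rightarrow> complex) \<Rightarrow> ('x \<Rightarrow> complex) \<times> ('x \<Rightarrow> complex)"
    where "f = (\<lambda>(a, b). (\<lambda>p. (\<Sum>k\<in>I. of_real (\<phi> k p) * a k) - a p, b))"
  have "rep_by e (\<lambda>z. compression I \<phi> x z - x z)"
  proof (rule rep_byI[of "map f xs" _ "1 / d"])
    show "set (map f xs) \<subseteq> carrier (C0 X) \<times> carrier (C0 X)"
      using xs compression_C0[OF sub] by (auto simp: f_def intro!: C0_diff)
    show "(\<lambda>z. compression I \<phi> x z - x z) = (\<lambda>z. \<Sum>(a, b)\<leftarrow>map f xs. t.tens a b z)"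
      unfolding x_eq compression_tensor
      by (simp add: f_def case_prod_unfold o_def t.tens_def left_diff_distrib sum_list_subtractf)
    show "1 / d > 0" using d by simp
    show "1 / d * rows (map f xs) p \<le> e" for p
    proof -
      have "rows (map f xs) p \<le> real (length xs) * d\<^sup>2"
        unfolding rows_def map_map
      proof (rule sum_list_bound)
        fix y assume "y \<in> set xs"
        then have "cmod (fst y p - (\<Sum>k\<in>I. of_real (\<phi> k p) * fst y k)) \<le> d"
          using I(5)[of "fst y" p] d by (simp add: A_def)
        then show "((\<lambda>(a, b). (cmod (a p))\<^sup>2) \<circ> f) y \<le> d\<^sup>2"
          by (auto simp: f_def case_prod_unfold norm_minus_commute intro!: power_mono)
      qed
      also have "\<dots> \<le> n * d\<^sup>2" using N0 by (intro mult_right_mono) (auto simp: n_def)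
      also have "\<dots> = e * d" using n by (simp add: d_def power2_eq_square)
      finally show ?thesis using d by (simp add: field_simps)
    qed
    show "cols (map f xs) q / (1 / d) \<le> e" for q
    proof -
      have "cols (map f xs) q = cols xs q"
        by (simp add: cols_def f_def case_prod_unfold o_def)
      also have "\<dots> \<le> n" using N[of q] by (simp add: n_def)
      finally have "cols (map f xs) q * d \<le> n * d" using d by simp
      then show ?thesis using n by (simp add: d_def)
    qed
  qed
  with sub show thesis by (rule that)
qed

text \<open>Compressions are contractive for the Haagerup norm and converge strongly to the identity, while
  a fixed compression of \<open>u m\<close> only depends on finitely many slices of \<open>u m\<close>, which tend to \<open>0\<close>
  uniformly.\<close>

lemma haagerup_null_sequence:
  assumes S: "\<And>n. u n \<in> t.S"
    and cau: "\<And>e. e > 0 \<Longrightarrow> \<exists>N. \<forall>m\<ge>N. \<forall>n\<ge>N. hn (\<lambda>z. u m z - u n z) < e"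
    and null: "\<And>e. e > 0 \<Longrightarrow> \<exists>N. \<forall>n\<ge>N. \<forall>z. cmod (u n z) \<le> e"
  shows "(\<lambda>n. hn (u n)) \<longlonglongrightarrow> 0"
  unfolding LIMSEQ_iff
proof (intro allI impI)
  fix r :: real assume r: "r > 0"
  \<comment> \<open>Four errors of size \<open>e\<close> add up to less than
    \<open>r\<close>.\<close>
  define e where "e = r / 5"
  have e: "e > 0" using r by (simp add: e_def)
  obtain N where N: "\<And>m n. m \<ge> N \<Longrightarrow> n \<ge> N \<Longrightarrow> hn (\<lambda>z. u m z - u n z) < e" using cau[OF e] by blast
  obtain I \<phi> where I: "subpartition I \<phi>" "rep_by e (\<lambda>z. compression I \<phi> (u N) z - u N z)"
    using rep_by_compression_approx[OF S e] .
  define d where "d = e / (real (card I) + 1)"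
  have d: "d > 0" "(real (card I) + 1) * d = e" using e by (auto simp: d_def)
  \<comment> \<open>The tolerance \<open>d\<close> depends on the number of sample points, so
    \<open>M\<close> comes after the partition, which itself is adapted to the single function
    \<open>u N\<close>.\<close>
  obtain M where M: "\<And>m z. m \<ge> M \<Longrightarrow> cmod (u m z) \<le> d" using null[OF d(1)] by blast
  have "hn (u m) < r" if m: "m \<ge> max M N" for m
  proof -
    have 1: "rep_by e (\<lambda>z. u m z - u N z)"
      using N[of m N] m S by (intro rep_by_haagerup_norm S_diff) auto
    have 2: "rep_by e (\<lambda>z. compression I \<phi> (u m) z - compression I \<phi> (u N) z)"
      using rep_by_compression[OF I(1) 1] by (simp add: compression_diff)
    have 3: "rep_by e (compression I \<phi> (u m))"
      using rep_by_compression_small[OF I(1) S d(1), of m] M m d(2) by auto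
    \<comment> \<open>With \<open>P\<close> the compression: \<open>u m = (u m - u N) - (P (u N) - u
      N) - (P (u m) - P (u N)) + P (u m)\<close>.\<close>
    from rep_by_add[OF rep_by_diff[OF rep_by_diff[OF 1 I(2)] 2] 3]
    have "rep_by (e + e + e + e) (u m)" by simp
    from haagerup_norm_le[OF this] e show ?thesis by (simp add: e_def)
  qed
  then show "\<exists>no. \<forall>n\<ge>no. norm (hn (u n) - 0) < r"
    using haagerup_norm_nonneg[OF S] by (intro exI[of _ "max M N"]) auto
qed

section \<open>The completion and extensions by continuity\<close>

lemma alg_sq_eq: "alg_sq (C0_frame X) = t.S"
  by (simp add: tn_eq)

lemma haagerup_cauchy_iff:
  "u \<in> haagerup_cauchy (C0_frame X) \<longleftrightarrow> (\<forall>n. u n \<in> t.S) \<and>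
     (\<forall>e>0. \<exists>N. \<forall>m\<ge>N. \<forall>n\<ge>N. hn (\<lambda>z. u m z - u n z) < e)"
  by (simp add: haagerup_cauchy_def tn_eq)

lemma haagerup_equiv_iff:
  "(u, v) \<in> haagerup_equiv (C0_frame X) \<longleftrightarrow> u \<in> haagerup_cauchy (C0_frame X) \<and>
     v \<in> haagerup_cauchy (C0_frame X) \<and> (\<lambda>n. hn (\<lambda>z. u n z - v n z)) \<longlonglongrightarrow> 0"
  by (simp add: haagerup_equiv_def)

lemma equiv_haagerup: "equiv (haagerup_cauchy (C0_frame X)) (haagerup_equiv (C0_frame X))"
proof (rule equivI)
  show "haagerup_equiv (C0_frame X) \<subseteq> haagerup_cauchy (C0_frame X) \<times> haagerup_cauchy (C0_frame X)"
    by (auto simp: haagerup_equiv_def)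
  show "refl_on (haagerup_cauchy (C0_frame X)) (haagerup_equiv (C0_frame X))"
    by (auto simp: refl_on_def haagerup_equiv_iff haagerup_norm_zero)
  show "sym (haagerup_equiv (C0_frame X))"
  proof (rule symI)
    fix u v assume uv: "(u, v) \<in> haagerup_equiv (C0_frame X)"
    then have "hn (\<lambda>z. v n z - u n z) = hn (\<lambda>z. u n z - v n z)" for n
      by (intro haagerup_norm_minus_commute) (auto simp: haagerup_equiv_iff haagerup_cauchy_iff)
    with uv show "(v, u) \<in> haagerup_equiv (C0_frame X)" by (simp add: haagerup_equiv_iff)
  qed
  show "trans (haagerup_equiv (C0_frame X))"
  proof (rule transI)
    fix u v w assume uv: "(u, v) \<in> haagerup_equiv (C0_frame X)" and vw: "(v, w) \<in> haagerup_equiv (C0_frame X)"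
    have S: "u n \<in> t.S" "v n \<in> t.S" "w n \<in> t.S" for n
      using uv vw by (auto simp: haagerup_equiv_iff haagerup_cauchy_iff)
    have "hn (\<lambda>z. u n z - w n z) \<le> hn (\<lambda>z. u n z - v n z) + hn (\<lambda>z. v n z - w n z)" for n
      using haagerup_norm_add[OF S_diff[OF S(1,2)] S_diff[OF S(2,3)], of n n n] by simp
    moreover have "(\<lambda>n. hn (\<lambda>z. u n z - v n z) + hn (\<lambda>z. v n z - w n z)) \<longlonglongrightarrow> 0 + 0"
      using uv vw by (intro tendsto_add) (auto simp: haagerup_equiv_iff)
    moreover have "0 \<le> hn (\<lambda>z. u n z - w n z)" for n
      by (rule haagerup_norm_nonneg[OF S_diff[OF S(1,3)]])
    ultimately have "(\<lambda>n. hn (\<lambda>z. u n z - w n z)) \<longlonglongrightarrow> 0"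
      using tendsto_sandwich[of "\<lambda>_. 0" "\<lambda>n. hn (\<lambda>z. u n z - w n z)" sequentially
          "\<lambda>n. hn (\<lambda>z. u n z - v n z) + hn (\<lambda>z. v n z - w n z)" 0] by simp
    then show "(u, w) \<in> haagerup_equiv (C0_frame X)"
      using uv vw by (auto simp: haagerup_equiv_iff)
  qed
qed

lemma converges_in_C0:
  assumes "\<And>n. u n \<in> carrier (C0 Z)" "l \<in> carrier (C0 Z)"
  shows "converges_in (C0 Z) u l \<longleftrightarrow> (\<forall>e>0. \<exists>N. \<forall>n\<ge>N. \<forall>x. cmod (u n x - l x) \<le> e)"
  using converges_in_function_algebra[of u l "carrier (C0 Z)"] C0_bounded[OF assms(1)] C0_bounded[OF assms(2)]
  by (simp add: converges_in_def)

text \<open>Contractivity is the bound of the supremum norm by the Haagerup norm. For injectivity,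
  equal limits of \<open>u n\<close> and \<open>v n\<close> composed with \<open>W\<close> mean, as
  \<open>W\<close> is onto, that \<open>u n - v n\<close> tends to 0 uniformly; being Haagerup
  Cauchy it is Haagerup null, so both sequences represent the same class.\<close>

lemma
  assumes W: "homeomorphic_map XX XX W" "\<And>z. z \<notin> topspace XX \<Longrightarrow> W z \<notin> topspace XX"
    and T: "\<And>x. x \<in> t.S \<Longrightarrow> T x = (\<lambda>z. x (W z))"
  shows haagerup_contractive_compose: "haagerup_contractive (C0_frame X) T"
    and inj_haagerup_extension_compose:
      "inj_on (haagerup_extension (C0_frame X) T) (haagerup_tensor (C0_frame X))"
proof -
  let ?H = "haagerup_cauchy (C0_frame X)" and ?E = "haagerup_equiv (C0_frame X)"
  have TC: "T x \<in> carrier (C0 XX)" if "x \<in> t.S" for x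
    unfolding T[OF that] by (rule C0_compose[OF t.S_C0[OF that] W])
  show "haagerup_contractive (C0_frame X) T"
    unfolding haagerup_contractive_def alg_sq_eq
  proof (intro ballI conjI)
    fix x assume x: "x \<in> t.S"
    show "T x \<in> carrier (alg2 (C0_frame X))" using TC[OF x] by simp
    have "(SUP z. cmod (x (W z))) \<le> hn x" by (intro sup_norm_le cmod_le_haagerup_norm x)
    then show "normA (alg2 (C0_frame X)) (T x) \<le> hn x" by (simp add: T[OF x])
  qed
  \<comment> \<open>The limit along a single representative. Existence, uniqueness and invariance
    under equivalence together evaluate the definite description in
    \<open>haagerup_extension\<close>.\<close>
  define lim where "lim u l \<longleftrightarrow> l \<in> carrier (C0 XX) \<and> converges_in (C0 XX) (\<lambda>n. T (u n)) l" for u l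
  have lim_iff: "lim u l \<longleftrightarrow> l \<in> carrier (C0 XX) \<and>
    (\<forall>e>0. \<exists>N. \<forall>n\<ge>N. \<forall>z. cmod (u n (W z) - l z) \<le> e)" if "u \<in> ?H" for u l
    using that converges_in_C0[of "\<lambda>n. T (u n)" XX l] TC
    unfolding lim_def haagerup_cauchy_iff by (auto simp: T)
  have lim_unique: "l = l'" if u: "u \<in> ?H" and l: "lim u l" "lim u l'" for u l l'
  proof
    fix z
    have "cmod (l z - l' z) \<le> 0"
    proof (rule field_le_epsilon)
      fix e :: real assume "e > 0"
      then have e: "e / 2 > 0" by simp
      obtain N where N: "\<And>n z. n \<ge> N \<Longrightarrow> cmod (u n (W z) - l z) \<le> e / 2"
        using l(1) e unfolding lim_iff[OF u] by blast
      obtain N' where N': "\<And>n z. n \<ge> N' \<Longrightarrow> cmod (u n (W z) - l' z) \<le> e / 2"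
        using l(2) e unfolding lim_iff[OF u] by blast
      show "cmod (l z - l' z) \<le> 0 + e"
        using N[of "max N N'" z] N'[of "max N N'" z]
          norm_triangle_ineq4[of "u (max N N') (W z) - l' z" "u (max N N') (W z) - l z"]
        by simp
    qed
    then show "l z = l' z" by simp
  qed
  have lim_exists: "\<exists>l. lim u l" if u: "u \<in> ?H" for u
  proof -
    have uS: "u n \<in> t.S" for n using u by (simp add: haagerup_cauchy_iff)
    interpret cstar_algebra "C0 XX" by (rule cstar_C0)
    have "\<exists>l\<in>carrier (C0 XX). converges_in (C0 XX) (\<lambda>n. T (u n)) l"
    proof (rule complete)
      show "T (u n) \<in> carrier (C0 XX)" for n by (rule TC[OF uS])
      fix e :: real assume "e > 0"
      then obtain N where N: "\<And>m n. m \<ge> N \<Longrightarrow> n \<ge> N \<Longrightarrow> hn (\<lambda>z. u m z - u n z) < e"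
        using u unfolding haagerup_cauchy_iff by meson
      have "(SUP z. cmod (T (u m) z - T (u n) z)) < e" if "m \<ge> N" "n \<ge> N" for m n
      proof -
        have "(SUP z. cmod (T (u m) z - T (u n) z)) \<le> hn (\<lambda>z. u m z - u n z)"
          using cmod_le_haagerup_norm[OF S_diff[OF uS uS]] by (intro sup_norm_le) (simp add: T uS)
        also have "\<dots> < e" using N that by blast
        finally show ?thesis .
      qed
      then show "\<exists>N. \<forall>m\<ge>N. \<forall>n\<ge>N. normA (C0 XX) (diffA (C0 XX) (T (u m)) (T (u n))) < e" by auto
    qed
    then show ?thesis by (auto simp: lim_def)
  qed
  have lim_equiv: "lim v l" if uv: "(u, v) \<in> ?E" and l: "lim u l" for u v l
  proof -
    have u: "u \<in> ?H" and v: "v \<in> ?H" and uv0: "(\<lambda>n. hn (\<lambda>z. u n z - v n z)) \<longlonglongrightarrow> 0"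
      using uv by (auto simp: haagerup_equiv_iff)
    have uS: "u n \<in> t.S" "v n \<in> t.S" for n using u v by (simp_all add: haagerup_cauchy_iff)
    show ?thesis
      unfolding lim_iff[OF v]
    proof (intro conjI allI impI)
      show "l \<in> carrier (C0 XX)" using l by (simp add: lim_def)
      fix e :: real assume "e > 0"
      then have e: "e / 2 > 0" by simp
      obtain N where N: "\<And>n z. n \<ge> N \<Longrightarrow> cmod (u n (W z) - l z) \<le> e / 2"
        using l e unfolding lim_iff[OF u] by blast
      obtain N' where N': "\<And>n. n \<ge> N' \<Longrightarrow> \<bar>hn (\<lambda>z. u n z - v n z)\<bar> < e / 2"
        using uv0[unfolded LIMSEQ_iff, rule_format, OF e] by auto
      have "cmod (v n (W z) - l z) \<le> e" if "n \<ge> max N N'" for n z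
        using N[of n z] N'[of n] that cmod_le_haagerup_norm[OF S_diff[OF uS(1)[of n] uS(2)[of n]], of "W z"]
          norm_triangle_ineq4[of "u n (W z) - l z" "u n (W z) - v n (W z)"] by simp
      then show "\<exists>N. \<forall>n\<ge>N. \<forall>z. cmod (v n (W z) - l z) \<le> e" by blast
    qed
  qed
  have ext: "lim u (haagerup_extension (C0_frame X) T (?E `` {u}))" if u: "u \<in> ?H" for u
  proof -
    have self: "u \<in> ?E `` {u}" using equiv_class_self[OF equiv_haagerup u] .
    obtain l where l: "lim u l" using lim_exists[OF u] by blast
    have "haagerup_extension (C0_frame X) T (?E `` {u}) = l"
      unfolding haagerup_extension_def
    proof (rule the_equality)
      show "l \<in> carrier (alg2 (C0_frame X)) \<and>
        (\<forall>v\<in>?E `` {u}. converges_in (alg2 (C0_frame X)) (\<lambda>n. T (v n)) l)"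
        using lim_equiv[OF _ l] l by (auto simp: lim_def)
      fix l' assume "l' \<in> carrier (alg2 (C0_frame X)) \<and>
        (\<forall>v\<in>?E `` {u}. converges_in (alg2 (C0_frame X)) (\<lambda>n. T (v n)) l')"
      then have "lim u l'" using self by (auto simp: lim_def)
      then show "l' = l" using lim_unique[OF u _ l] by blast
    qed
    with l show ?thesis by simp
  qed
  show "inj_on (haagerup_extension (C0_frame X) T) (haagerup_tensor (C0_frame X))"
  proof (rule inj_onI)
    fix \<xi> \<eta> assume "\<xi> \<in> haagerup_tensor (C0_frame X)" "\<eta> \<in> haagerup_tensor (C0_frame X)"
      and eq: "haagerup_extension (C0_frame X) T \<xi> = haagerup_extension (C0_frame X) T \<eta>"
    then obtain u v where u: "u \<in> ?H" "\<xi> = ?E `` {u}" and v: "v \<in> ?H" "\<eta> = ?E `` {v}"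
      unfolding haagerup_tensor_def quotient_def by blast
    define l where "l = haagerup_extension (C0_frame X) T \<xi>"
    have lu: "lim u l" and lv: "lim v l"
      using ext[OF u(1)] ext[OF v(1)] eq unfolding l_def u(2) v(2) by simp_all
    have uS: "u n \<in> t.S" "v n \<in> t.S" for n using u v by (simp_all add: haagerup_cauchy_iff)
    have "(\<lambda>n. hn (\<lambda>z. u n z - v n z)) \<longlonglongrightarrow> 0"
    proof (rule haagerup_null_sequence)
      show "(\<lambda>z. u n z - v n z) \<in> t.S" for n by (rule S_diff[OF uS])
      fix e :: real assume "e > 0"
      then have e: "e / 2 > 0" by simp
      obtain N where N: "\<And>m n. m \<ge> N \<Longrightarrow> n \<ge> N \<Longrightarrow> hn (\<lambda>z. u m z - u n z) < e / 2"
        using u(1) e unfolding haagerup_cauchy_iff by meson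
      obtain N' where N': "\<And>m n. m \<ge> N' \<Longrightarrow> n \<ge> N' \<Longrightarrow> hn (\<lambda>z. v m z - v n z) < e / 2"
        using v(1) e unfolding haagerup_cauchy_iff by meson
      have "hn (\<lambda>z. (u m z - v m z) - (u n z - v n z)) < e" if "m \<ge> max N N'" "n \<ge> max N N'" for m n
      proof -
        have "(\<lambda>z. (u m z - v m z) - (u n z - v n z)) = (\<lambda>z. (u m z - u n z) - (v m z - v n z))"
          by (simp add: algebra_simps)
        then show ?thesis
          using haagerup_norm_diff[OF S_diff[OF uS(1) uS(1)] S_diff[OF uS(2) uS(2)], of m n m n]
            N[of m n] N'[of m n] that by simp
      qed
      then show "\<exists>N. \<forall>m\<ge>N. \<forall>n\<ge>N. hn (\<lambda>z. (u m z - v m z) - (u n z - v n z)) < e" by blast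
      obtain M where M: "\<And>n z. n \<ge> M \<Longrightarrow> cmod (u n (W z) - l z) \<le> e / 2"
        using lu e unfolding lim_iff[OF u(1)] by blast
      obtain M' where M': "\<And>n z. n \<ge> M' \<Longrightarrow> cmod (v n (W z) - l z) \<le> e / 2"
        using lv e unfolding lim_iff[OF v(1)] by blast
      have "cmod (u n z - v n z) \<le> e" if n: "n \<ge> max M M'" for n z
      proof (cases "z \<in> topspace XX")
        case True
        then obtain y where y: "z = W y" using homeomorphic_imp_surjective_map[OF W(1)] by blast
        show ?thesis
          using M[of n y] M'[of n y] n norm_triangle_ineq4[of "u n (W y) - l y" "v n (W y) - l y"]
          by (simp add: y)
      next
        case False
        then have "u n z = 0" "v n z = 0"
          using t.S_C0[OF uS(1)[of n]] t.S_C0[OF uS(2)[of n]] unfolding C0_iff by blast+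
        then show ?thesis using e by simp
      qed
      then show "\<exists>N. \<forall>n\<ge>N. \<forall>z. cmod (u n z - v n z) \<le> e" by blast
    qed
    then have "(u, v) \<in> ?E" using u v by (simp add: haagerup_equiv_iff)
    then show "\<xi> = \<eta>" unfolding u v by (rule equiv_class_eq[OF equiv_haagerup])
  qed
qed

end

section \<open>The comultiplication\<close>

text \<open>Pullbacks are cut off outside \<open>topspace Z\<close>, where functions vanish by convention.\<close>

definition pullback :: "'z topology \<Rightarrow> ('z \<Rightarrow> 'y) \<Rightarrow> ('y \<Rightarrow> complex) \<Rightarrow> 'z \<Rightarrow> complex" where
  "pullback Z h m = (\<lambda>z. if z \<in> topspace Z then m (h z) else 0)"

lemma pullback_Cb:
  assumes h: "continuous_map Z Y h" and m: "m \<in> carrier (Cb Y)"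
  shows "pullback Z h m \<in> carrier (Cb Z)"
  unfolding Cb_iff
proof (intro conjI allI impI)
  have "continuous_map Z euclidean (\<lambda>z. m (h z))"
    using continuous_map_compose[OF h, of euclidean m] m by (simp add: Cb_iff o_def)
  then show "continuous_map Z euclidean (pullback Z h m)"
    by (rule continuous_map_eq) (simp add: pullback_def)
  show "pullback Z h m z = 0" if "z \<notin> topspace Z" for z
    using that by (simp add: pullback_def)
  obtain c where c: "\<And>y. cmod (m y) \<le> c" using m unfolding Cb_iff bounded_iff by auto
  have "0 \<le> c" using c norm_ge_zero order_trans by blast
  then show "bounded (range (pullback Z h m))"
    using c by (intro bounded_rangeI[of _ c]) (simp add: pullback_def)
qed

lemma star_hom_pullback: "continuous_map Z Y h \<Longrightarrow> star_hom (Cb Y) (Cb Z) (pullback Z h)"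
  using pullback_Cb[of Z Y h] by (auto simp: star_hom_def) (auto simp: pullback_def fun_eq_iff)

lemma homeomorphic_map_prod_assoc:
  "homeomorphic_map (prod_topology X (prod_topology Y Z)) (prod_topology (prod_topology X Y) Z)
     (\<lambda>z. ((fst z, fst (snd z)), snd (snd z)))"
proof -
  have "homeomorphic_maps (prod_topology X (prod_topology Y Z)) (prod_topology (prod_topology X Y) Z)
     (\<lambda>z. ((fst z, fst (snd z)), snd (snd z))) (\<lambda>z. (fst (fst z), (snd (fst z), snd z)))"
    unfolding homeomorphic_maps_def
    by (auto intro!: continuous_map_pairedI continuous_map_fst_of continuous_map_snd_of
        continuous_map_fst continuous_map_snd continuous_map_compose[unfolded o_def, OF continuous_map_fst]
        continuous_map_compose[unfolded o_def, OF continuous_map_snd])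
  then show ?thesis by (rule homeomorphic_maps_imp_map)
qed

section \<open>The tensor frame over one space\<close>

context C0_square
begin

abbreviation XXX :: "('x \<times> 'x \<times> 'x) topology" where "XXX \<equiv> prod_topology X XX"

text \<open>All three tensor products are instances of \<open>C0_tensor_product\<close>; the
  left-bracketed one uses reassociation of coordinates as its homeomorphism.\<close>

lemma valid_frame: "valid_frame (C0_frame X)"
proof -
  have XX: "locally_compact_space XX" "Hausdorff_space XX"
    using X by (simp_all add: locally_compact_space_prod_topology Hausdorff_space_prod_topology)
  have XXX: "locally_compact_space XXX" "Hausdorff_space XXX"
    using X XX by (simp_all add: locally_compact_space_prod_topology Hausdorff_space_prod_topology)
  interpret l: C0_tensor_product XX X XXX "\<lambda>z. (fst z, fst (snd z))" "\<lambda>z. snd (snd z)"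
    by unfold_locales (use X XX homeomorphic_map_prod_assoc[of X X X] in auto)
  interpret r: C0_tensor_product X XX XXX fst snd
    by unfold_locales (use X XX homeomorphic_map_id[of XXX XXX] in \<open>auto simp: id_def\<close>)
  have "tnl (C0_frame X) = l.tens" "tnr (C0_frame X) = r.tens"
    by (auto simp: C0_frame_def l.tens_def r.tens_def fun_eq_iff)
  then show ?thesis
    unfolding valid_frame_def
    using t.min_tensor_C0 l.min_tensor_C0 r.min_tensor_C0
      multiplier_algebra_C0[OF XX] multiplier_algebra_C0[OF XXX]
    by (auto simp: tn_eq t.tens_def l.tens_def r.tens_def mult.assoc)
qed

lemma C0_XX_nonzero:
  assumes "z \<in> topspace XX"
  obtains c d where "c \<in> carrier (C0 X)" "d \<in> carrier (C0 X)" "t.tens c d z = 1"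
proof -
  obtain c where "c \<in> carrier (C0 X)" "c (fst z) = 1"
    by (rule C0_peak[OF X, of "fst z"]) (use assms in auto)
  moreover obtain d where "d \<in> carrier (C0 X)" "d (snd z) = 1"
    by (rule C0_peak[OF X, of "snd z"]) (use assms in auto)
  ultimately show thesis by (intro that[of c d]) (auto simp: t.tens_def)
qed

text \<open>\<open>leg1\<close> and \<open>leg2\<close> are specified by their action on elementary
  tensors alone. That determines a multiplier, since at each point some elementary tensor takes the
  value 1.\<close>

lemma multiplier_eqI:
  assumes "m \<in> carrier (Cb XX)" "m' \<in> carrier (Cb XX)"
    and "\<And>c d. c \<in> carrier (C0 X) \<Longrightarrow> d \<in> carrier (C0 X) \<Longrightarrow>
      (\<lambda>z. m z * t.tens c d z) = (\<lambda>z. m' z * t.tens c d z)"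
  shows "m = m'"
proof
  fix z
  show "m z = m' z"
  proof (cases "z \<in> topspace XX")
    case True
    then obtain c d where "c \<in> carrier (C0 X)" "d \<in> carrier (C0 X)" "t.tens c d z = 1"
      by (rule C0_XX_nonzero)
    then show ?thesis using fun_cong[OF assms(3)[of c d], of z] by simp
  qed (simp add: Cb_off[OF assms(1)] Cb_off[OF assms(2)])
qed

lemma leg_eq:
  assumes b: "b \<in> carrier (C0 X)"
  shows "leg1 (C0_frame X) b = pullback XX fst b" "leg2 (C0_frame X) b = pullback XX snd b"
proof -
  have Cb: "b \<in> carrier (Cb X)" using b C0_subset_Cb by blast
  note mem = pullback_Cb[OF continuous_map_fst Cb, of X] pullback_Cb[OF continuous_map_snd Cb, of X]
  have 1: "(\<lambda>z. pullback XX fst b z * t.tens c d z) = t.tens (\<lambda>x. b x * c x) d"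
    "(\<lambda>z. pullback XX snd b z * t.tens c d z) = t.tens c (\<lambda>x. b x * d x)"
    if "c \<in> carrier (C0 X)" "d \<in> carrier (C0 X)" for c d
    using that by (auto simp: pullback_def t.tens_def fun_eq_iff C0_iff)
  show "leg1 (C0_frame X) b = pullback XX fst b"
    unfolding leg1_def
  proof (rule the_equality)
    fix m assume m: "m \<in> carrier (mul2 (C0_frame X)) \<and> (\<forall>c\<in>carrier (alg (C0_frame X)). \<forall>d\<in>carrier (alg (C0_frame X)).
      m \<cdot>\<^bsub>mul2 (C0_frame X)\<^esub> tn (C0_frame X) c d = tn (C0_frame X) (b \<cdot>\<^bsub>alg (C0_frame X)\<^esub> c) d)"
    show "m = pullback XX fst b"
      by (rule multiplier_eqI) (use m mem 1 in \<open>auto simp: tn_eq\<close>)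
  qed (use mem 1 in \<open>auto simp: tn_eq\<close>)
  show "leg2 (C0_frame X) b = pullback XX snd b"
    unfolding leg2_def
  proof (rule the_equality)
    fix m assume m: "m \<in> carrier (mul2 (C0_frame X)) \<and> (\<forall>c\<in>carrier (alg (C0_frame X)). \<forall>d\<in>carrier (alg (C0_frame X)).
      m \<cdot>\<^bsub>mul2 (C0_frame X)\<^esub> tn (C0_frame X) c d = tn (C0_frame X) c (b \<cdot>\<^bsub>alg (C0_frame X)\<^esub> d))"
    show "m = pullback XX snd b"
      by (rule multiplier_eqI) (use m mem 1 in \<open>auto simp: tn_eq\<close>)
  qed (use mem 1 in \<open>auto simp: tn_eq\<close>)
qed

text \<open>Every representation of \<open>x\<close> gives the same sum, namely \<open>x\<close>
  composed with \<open>W\<close>, so the definite description in \<open>tensor_lift\<close> is well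
  defined.\<close>

lemma tensor_lift_compose:
  assumes x: "x \<in> t.S"
    and g: "\<And>a b. a \<in> carrier (C0 X) \<Longrightarrow> b \<in> carrier (C0 X) \<Longrightarrow> g a b = (\<lambda>z. t.tens a b (W z))"
  shows "tensor_lift (C0 X) (C0 X) (C0 XX) t.tens g x = (\<lambda>z. x (W z))"
proof -
  have eq: "(\<lambda>z. \<Sum>(a, b)\<leftarrow>xs. g a b z) = (\<lambda>z. \<Sum>(a, b)\<leftarrow>xs. t.tens a b (W z))"
    if "set xs \<subseteq> carrier (C0 X) \<times> carrier (C0 X)" for xs
    using that by (induction xs) (auto simp: g fun_eq_iff)
  show ?thesis
    unfolding tensor_lift_def C0_simps
  proof (rule the_equality)
    obtain xs where "set xs \<subseteq> carrier (C0 X) \<times> carrier (C0 X)"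
      "x = (\<lambda>z. \<Sum>(a, b)\<leftarrow>xs. t.tens a b z)"
      using x unfolding t.S_eq by blast
    then show "\<exists>xs. set xs \<subseteq> carrier (C0 X) \<times> carrier (C0 X) \<and> (\<lambda>z. \<Sum>(a, b)\<leftarrow>xs. t.tens a b z) = x \<and>
      (\<lambda>z. x (W z)) = (\<lambda>z. \<Sum>(a, b)\<leftarrow>xs. g a b z)"
      using eq by (intro exI[of _ xs]) auto
  next
    fix y assume "\<exists>xs. set xs \<subseteq> carrier (C0 X) \<times> carrier (C0 X) \<and> (\<lambda>z. \<Sum>(a, b)\<leftarrow>xs. t.tens a b z) = x \<and>
      y = (\<lambda>z. \<Sum>(a, b)\<leftarrow>xs. g a b z)"
    then show "y = (\<lambda>z. x (W z))" using eq by auto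
  qed
qed

end

section \<open>The group structure\<close>

context locally_compact_group
begin

sublocale C0_square X
  by unfold_locales (use locally_compact Hausdorff in auto)

lemma C0_comult_eq: "C0_comult G = pullback XX (\<lambda>(p, q). p \<otimes> q)"
  by (auto simp: C0_comult_def pullback_def fun_eq_iff topspace_eq)

lemma continuous_map_mult_pair:
  assumes "continuous_map Z X f" "continuous_map Z X g"
  shows "continuous_map Z X (\<lambda>z. f z \<otimes> g z)"
  using continuous_map_compose[OF continuous_map_pairedI[OF assms] continuous_mult] by (simp add: o_def)

lemma continuous_map_inv_of:
  "continuous_map Z X f \<Longrightarrow> continuous_map Z X (\<lambda>z. inv (f z))"
  using continuous_map_compose[OF _ continuous_inv, of Z f] by (simp add: o_def)

text \<open>Off \<open>topspace XX\<close> the group product is unspecified and might fall into the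
  carrier. Being the identity there, \<open>W1\<close> and \<open>W2\<close> map the complement into
  itself, as \<open>C0_compose\<close> requires.\<close>

definition W1 :: "'g \<times> 'g \<Rightarrow> 'g \<times> 'g" where
  "W1 z = (if z \<in> topspace XX then (fst z \<otimes> snd z, snd z) else z)"

definition W2 :: "'g \<times> 'g \<Rightarrow> 'g \<times> 'g" where
  "W2 z = (if z \<in> topspace XX then (fst z, fst z \<otimes> snd z) else z)"

lemma homeomorphic_W: "homeomorphic_map XX XX W1" "homeomorphic_map XX XX W2"
proof -
  have "homeomorphic_maps XX XX (\<lambda>z. (fst z \<otimes> snd z, snd z)) (\<lambda>z. (fst z \<otimes> inv (snd z), snd z))"
    unfolding homeomorphic_maps_def
    by (auto intro!: continuous_map_pairedI continuous_map_mult_pair continuous_map_inv_of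
        continuous_map_fst continuous_map_snd simp: topspace_eq m_assoc)
  then have "homeomorphic_map XX XX (\<lambda>z. (fst z \<otimes> snd z, snd z))"
    by (rule homeomorphic_maps_imp_map)
  then show "homeomorphic_map XX XX W1"
    by (rule homeomorphic_map_eq) (simp add: W1_def)
  have "homeomorphic_maps XX XX (\<lambda>z. (fst z, fst z \<otimes> snd z)) (\<lambda>z. (fst z, inv (fst z) \<otimes> snd z))"
    unfolding homeomorphic_maps_def
    by (auto intro!: continuous_map_pairedI continuous_map_mult_pair continuous_map_inv_of
        continuous_map_fst continuous_map_snd simp: topspace_eq m_assoc[symmetric])
  then have "homeomorphic_map XX XX (\<lambda>z. (fst z, fst z \<otimes> snd z))"
    by (rule homeomorphic_maps_imp_map)
  then show "homeomorphic_map XX XX W2"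
    by (rule homeomorphic_map_eq) (simp add: W2_def)
qed

lemma W_off: "z \<notin> topspace XX \<Longrightarrow> W1 z \<notin> topspace XX" "z \<notin> topspace XX \<Longrightarrow> W2 z \<notin> topspace XX"
  by (simp_all add: W1_def W2_def)

text \<open>A single product suffices. Let \<open>x\<close> be small off the compact
  \<open>K\<close>, and let \<open>a\<close> take values in [0,1] and equal 1 on the set of products
  of \<open>K\<close>, compact as a continuous image. Then \<open>C0_comult G a\<close> is 1 on
  \<open>K\<close>, so multiplying \<open>x\<close> by it changes \<open>x\<close> only where
  \<open>x\<close> is small.\<close>

lemma nondegenerate_comult: "nondegenerate_hom (C0 X) (C0 XX) (Cb XX) (C0_comult G)"
  unfolding nondegenerate_hom_def
proof
  have hom: "star_hom (Cb X) (Cb XX) (C0_comult G)"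
    unfolding C0_comult_eq by (rule star_hom_pullback[OF continuous_mult])
  show "star_hom (C0 X) (Cb XX) (C0_comult G)"
    using hom C0_subset_Cb[of X] unfolding star_hom_def by (auto simp: subset_iff)
  let ?B = "{C0_comult G a \<cdot>\<^bsub>Cb XX\<^esub> x |a x. a \<in> carrier (C0 X) \<and> x \<in> carrier (C0 XX)}"
  have memB: "(\<lambda>z. C0_comult G a z * x z) \<in> carrier (C0 XX)"
    if "a \<in> carrier (C0 X)" "x \<in> carrier (C0 XX)" for a x
    using hom that C0_subset_Cb[of X] unfolding star_hom_def by (intro Cb_mult_C0) auto
  show "dense_in (C0 XX) (lin_span (C0 XX) ?B)"
    unfolding dense_in_def
  proof (intro conjI ballI allI impI)
    show "lin_span (C0 XX) ?B \<subseteq> carrier (C0 XX)"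
    proof
      fix y assume "y \<in> lin_span (C0 XX) ?B"
      then obtain cs where cs: "snd ` set cs \<subseteq> ?B" and y: "y = lsum (C0 XX) (map (\<lambda>(c, x). scaleA (C0 XX) c x) cs)"
        unfolding lin_span_def by blast
      have "set (map (\<lambda>(c, x). scaleA (C0 XX) c x) cs) \<subseteq> carrier (C0 XX)"
        using cs memB by (auto intro!: C0_closed(5))
      from C0_list_sum[OF this] show "y \<in> carrier (C0 XX)" unfolding y C0_simps .
    qed
    fix x :: "'g \<times> 'g \<Rightarrow> complex" and e :: real
    assume x: "x \<in> carrier (C0 XX)" and e: "e > 0"
    then have e2: "e / 2 > 0" by simp
    then obtain K where K: "compactin XX K" "\<And>z. z \<in> topspace XX \<Longrightarrow> z \<notin> K \<Longrightarrow> cmod (x z) < e / 2"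
      using x unfolding C0_iff by meson
    have KX: "K \<subseteq> topspace XX" using K compactin_subset_topspace by blast
    define L where "L = (\<lambda>(p, q). p \<otimes> q) ` K"
    have L: "compactin X L" unfolding L_def by (rule image_compactin[OF K(1) continuous_mult])
    \<comment> \<open>For the trivial cover by the whole space, the sum of a partition is a Urysohn
      function for \<open>L\<close>.\<close>
    obtain I and \<phi> :: "'g \<Rightarrow> 'g \<Rightarrow> real" where I: "finite I"
      "\<And>k. k \<in> I \<Longrightarrow> (\<lambda>y. of_real (\<phi> k y)) \<in> carrier (C0 X)" "\<And>k y. 0 \<le> \<phi> k y"
      "\<And>y. (\<Sum>k\<in>I. \<phi> k y) \<le> 1" "\<And>y. y \<in> L \<Longrightarrow> (\<Sum>k\<in>I. \<phi> k y) = 1"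
    proof (rule C0_partition[OF X L, of "\<lambda>_. topspace X"])
      show "openin X (topspace X) \<and> y \<in> topspace X" if "y \<in> L" for y
        using that compactin_subset_topspace[OF L] by auto
    qed (rule that)
    define a :: "'g \<Rightarrow> complex" where "a y = (\<Sum>k\<in>I. of_real (\<phi> k y))" for y
    have a: "a \<in> carrier (C0 X)" using C0_sum[OF I(1,2)] unfolding a_def by simp
    have a01: "a y = of_real (\<Sum>k\<in>I. \<phi> k y)" "0 \<le> (\<Sum>k\<in>I. \<phi> k y)" for y
      using I(3) by (auto simp: a_def sum_nonneg)
    let ?s = "\<lambda>z. C0_comult G a z * x z"
    have "cmod (x z - ?s z) \<le> e / 2" for z
    proof (cases "z \<in> topspace XX")
      case True
      then have c: "C0_comult G a z = a (fst z \<otimes> snd z)"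
        unfolding C0_comult_eq by (simp add: pullback_def case_prod_unfold)
      show ?thesis
      proof (cases "z \<in> K")
        case True
        then have "fst z \<otimes> snd z \<in> L" unfolding L_def by (force simp: case_prod_unfold)
        then have "C0_comult G a z = 1" using I(5) by (simp add: c a01)
        then show ?thesis using e by simp
      next
        case False
        define r where "r = (\<Sum>k\<in>I. \<phi> k (fst z \<otimes> snd z))"
        have r: "0 \<le> r" "r \<le> 1" using I(4) a01(2) by (auto simp: r_def)
        have "x z - ?s z = of_real (1 - r) * x z" by (simp add: c a01 r_def algebra_simps)
        then have "cmod (x z - ?s z) = (1 - r) * cmod (x z)"
          using r by (simp add: norm_mult del: of_real_diff)
        also have "\<dots> \<le> 1 * cmod (x z)" using r by (intro mult_right_mono) auto
        finally show ?thesis using K(2)[OF True False] by simp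
      qed
    next
      case False
      then show ?thesis using C0_off[OF x False] e by simp
    qed
    then have le: "(SUP z. cmod (x z - ?s z)) \<le> e / 2" by (rule sup_norm_le)
    have "?s \<in> ?B" by (rule CollectI, intro exI[of _ a] exI[of _ x]) (simp add: a x)
    then have "?s \<in> lin_span (C0 XX) ?B"
      unfolding lin_span_def by (intro CollectI exI[of _ "[(1, ?s)]"]) simp
    then show "\<exists>s\<in>lin_span (C0 XX) ?B. normA (C0 XX) (diffA (C0 XX) x s) < e"
      using le e by (intro bexI[of _ ?s]) auto
  qed
qed

text \<open>Pullback along \<open>(p, q, r) \<mapsto> (pq, r)\<close> and along
  \<open>(p, q, r) \<mapsto> (p, qr)\<close> is defined on all bounded continuous functions, so it
  already is the extension to the multiplier algebra. Coassociativity is then associativity of the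
  group.\<close>

lemma comultiplication_C0: "comultiplication (C0_frame X) (C0_comult G)"
  unfolding comultiplication_def
proof (intro conjI exI ballI)
  show "valid_frame (C0_frame X)" by (rule valid_frame)
  show "nondegenerate_hom (alg (C0_frame X)) (alg2 (C0_frame X)) (mul2 (C0_frame X)) (C0_comult G)"
    using nondegenerate_comult by simp
  let ?\<Phi> = "pullback XXX (\<lambda>z. (fst z \<otimes> fst (snd z), snd (snd z)))"
  let ?\<Psi> = "pullback XXX (\<lambda>z. (fst z, fst (snd z) \<otimes> snd (snd z)))"
  have proj: "continuous_map XXX X fst" "continuous_map XXX X (\<lambda>z. fst (snd z))"
    "continuous_map XXX X (\<lambda>z. snd (snd z))"
    using continuous_map_compose[OF continuous_map_snd continuous_map_fst]
      continuous_map_compose[OF continuous_map_snd continuous_map_snd]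
    by (auto simp: o_def continuous_map_fst)
  show "extends_phi_iota (C0_frame X) (C0_comult G) ?\<Phi>"
    unfolding extends_phi_iota_def
  proof (intro conjI ballI)
    show "star_hom (mul2 (C0_frame X)) (mul3 (C0_frame X)) ?\<Phi>"
      unfolding C0_frame_simps
      by (intro star_hom_pullback continuous_map_pairedI continuous_map_mult_pair proj)
    fix a b x c assume "a \<in> carrier (alg (C0_frame X))" "b \<in> carrier (alg (C0_frame X))"
      "x \<in> carrier (alg2 (C0_frame X))" "c \<in> carrier (alg (C0_frame X))"
    then show "?\<Phi> (tn (C0_frame X) a b) \<cdot>\<^bsub>mul3 (C0_frame X)\<^esub> tnl (C0_frame X) x c =
      tnl (C0_frame X) (C0_comult G a \<cdot>\<^bsub>mul2 (C0_frame X)\<^esub> x) (b \<cdot>\<^bsub>alg (C0_frame X)\<^esub> c)"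
      by (auto simp: fun_eq_iff C0_frame_def pullback_def C0_comult_def C0_iff topspace_eq)
  qed
  show "extends_iota_phi (C0_frame X) (C0_comult G) ?\<Psi>"
    unfolding extends_iota_phi_def
  proof (intro conjI ballI)
    show "star_hom (mul2 (C0_frame X)) (mul3 (C0_frame X)) ?\<Psi>"
      unfolding C0_frame_simps
      by (intro star_hom_pullback continuous_map_pairedI continuous_map_mult_pair proj)
    fix a b c x assume "a \<in> carrier (alg (C0_frame X))" "b \<in> carrier (alg (C0_frame X))"
      "c \<in> carrier (alg (C0_frame X))" "x \<in> carrier (alg2 (C0_frame X))"
    then show "?\<Psi> (tn (C0_frame X) a b) \<cdot>\<^bsub>mul3 (C0_frame X)\<^esub> tnr (C0_frame X) c x =
      tnr (C0_frame X) (a \<cdot>\<^bsub>alg (C0_frame X)\<^esub> c) (C0_comult G b \<cdot>\<^bsub>mul2 (C0_frame X)\<^esub> x)"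
      by (auto simp: fun_eq_iff C0_frame_def pullback_def C0_comult_def C0_iff topspace_eq)
  qed
  show "?\<Phi> (C0_comult G a) = ?\<Psi> (C0_comult G a)" for a
    by (auto simp: pullback_def C0_comult_def fun_eq_iff topspace_eq m_assoc)
qed

text \<open>The multiplier \<open>1 \<otimes> b\<close> depends on \<open>q\<close> alone, so its
  product with \<open>a(pq)\<close> is an elementary tensor evaluated at \<open>(pq, q)\<close>;
  symmetrically for \<open>b \<otimes> 1\<close>, whose side does not matter as functions
  commute.\<close>

lemma comult_leg:
  assumes a: "a \<in> carrier (C0 X)" and b: "b \<in> carrier (C0 X)"
  shows "C0_comult G a \<cdot>\<^bsub>Cb XX\<^esub> leg2 (C0_frame X) b = (\<lambda>z. t.tens a b (W1 z))"
    and "leg1 (C0_frame X) b \<cdot>\<^bsub>Cb XX\<^esub> C0_comult G a = (\<lambda>z. t.tens b a (W2 z))"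
    and "C0_comult G a \<cdot>\<^bsub>Cb XX\<^esub> leg1 (C0_frame X) b = (\<lambda>z. t.tens b a (W2 z))"
  unfolding leg_eq[OF b]
  using a b by (auto simp: fun_eq_iff C0_comult_def pullback_def t.tens_def W1_def W2_def topspace_eq C0_iff)

lemma T_eq:
  assumes "x \<in> t.S"
  shows "T1 (C0_frame X) (C0_comult G) x = (\<lambda>z. x (W1 z))"
    "T2 (C0_frame X) (C0_comult G) x = (\<lambda>z. x (W2 z))"
  unfolding T1_def T2_def C0_frame_simps tn_eq
  by (rule tensor_lift_compose[OF assms], simp only: comult_leg)+

lemma hopf_cstar_algebra_C0: "hopf_cstar_algebra (C0_frame X) (C0_comult G)"
  unfolding hopf_cstar_algebra_def
proof (intro conjI ballI comultiplication_C0)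
  note W = homeomorphic_W(1) W_off(1) T_eq(1) homeomorphic_W(2) W_off(2) T_eq(2)
  show "haagerup_contractive (C0_frame X) (T1 (C0_frame X) (C0_comult G))"
    "haagerup_contractive (C0_frame X) (T2 (C0_frame X) (C0_comult G))"
    by (rule haagerup_contractive_compose[OF W(1-3)], assumption+)
       (rule haagerup_contractive_compose[OF W(4-6)], assumption+)
  show "inj_on (haagerup_extension (C0_frame X) (T1 (C0_frame X) (C0_comult G))) (haagerup_tensor (C0_frame X))"
    "inj_on (haagerup_extension (C0_frame X) (T2 (C0_frame X) (C0_comult G))) (haagerup_tensor (C0_frame X))"
    by (rule inj_haagerup_extension_compose[OF W(1-3)], assumption+)
       (rule inj_haagerup_extension_compose[OF W(4-6)], assumption+)
  fix a b assume "a \<in> carrier (alg (C0_frame X))" "b \<in> carrier (alg (C0_frame X))"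
  then have ab: "a \<in> carrier (C0 X)" "b \<in> carrier (C0 X)" by simp_all
  show "C0_comult G a \<cdot>\<^bsub>mul2 (C0_frame X)\<^esub> leg2 (C0_frame X) b \<in> carrier (alg2 (C0_frame X))"
    "C0_comult G a \<cdot>\<^bsub>mul2 (C0_frame X)\<^esub> leg1 (C0_frame X) b \<in> carrier (alg2 (C0_frame X))"
    unfolding C0_frame_simps comult_leg[OF ab]
    by (rule C0_compose[OF t.tens_C0[OF ab] W(1,2)], assumption)
       (rule C0_compose[OF t.tens_C0[OF ab(2,1)] W(4,5)], assumption)
qed

end

theorem proposition5p1:
  fixes G :: "('g, 'm) monoid_scheme" and X :: "'g topology"
  assumes "locally_compact_group G X"
  shows "comultiplication (C0_frame X) (C0_comult G) \<and>
         hopf_cstar_algebra (C0_frame X) (C0_comult G)"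
  using locally_compact_group.comultiplication_C0[OF assms]
    locally_compact_group.hopf_cstar_algebra_C0[OF assms] by blast

end
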